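(* For all partitions $\lambda,\mu$, $$G_{\lambda/\!\!/\mu}(x)={}^g\langle \mu|\,e^{H(x)}\,|\lambda\rangle^G .$$
   Context: Symmetric functions. $k=\mathbb{C}(\beta)$; $\Lambda$ is the $k$-algebra of symmetric functions in $x=(x_1,x_2,\dots)$, with Schur functions $s_\lambda$ and Hall inner product $\langle s_\lambda,s_\mu\rangle=\delta_{\lambda,\mu}$. $I_n=\mathrm{span}_k\{s_\lambda:\ell(\lambda)>n\}$ and $\widehat\Lambda=\varprojlim\Lambda/I_n$; elements of $\widehat\Lambda$ are formal sums $\sum c_\lambda s_\lambda$ such that for every $n$ only finitely many $\lambda$ with $\ell(\lambda)\le n$ have $c_\lambda\neq0$. The Hall product extends to $\widehat\Lambda\times\Lambda\to k$. For $f\in\Lambda$, $f^\perp:\widehat\Lambda\to\widehat\Lambda$ is defined by $\langle f^\perp g,h\rangle=\langle g,fh\rangle$ for all $h\in\Lambda$. The stable Grothendieck polynomial $G_\lambda(x)\in\widehat\Lambda$ is the unique element such that for all $n\ge\ell(\lambda)$, $G_\lambda(x_1,\dots,x_n,0,0,\dots)=\det\bigl(x_i^{\lambda_j+n-j}(1+\beta x_i)^{j-1}\bigr)_{1\le i,j\le n}/\prod_{1\le i<j\le n}(x_i-x_j)$. The dual stable Grothendieck polynomials $g_\mu\in\Lambda$ are determined by $\langle G_\lambda,g_\mu\rangle=\delta_{\lambda,\mu}$. Buch's function $G_{\lambda/\!\!/\mu}(x)$ is defined by $\Delta(G_\lambda)=\sum_{\mu}G_\mu\otimes G_{\lambda/\!\!/\mu}$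 (where $(\Delta f)(x,y)=f(x,y)$), equivalently $G_{\lambda/\!\!/\mu}=g_\mu^\perp G_\lambda$. Fermions. $\mathcal A$ is the $k$-algebra generated by $\psi_n,\psi_n^*$ ($n\in\mathbb Z$) with $[\psi_m,\psi_n]_+=[\psi_m^*,\psi_n^*]_+=0$, $[\psi_m,\psi_n^*]_+=\delta_{m,n}$ ($[A,B]_+=AB+BA$). The Fock space $\mathcal F$ is the left $\mathcal A$-module generated by $|0\rangle$ with $\psi_m|0\rangle=\psi^*_n|0\rangle=0$ for $m<0\le n$ (with basis $\psi_{n_1}\cdots\psi_{n_r}\psi^*_{m_1}\cdots\psi^*_{m_s}|0\rangle$, $n_1>\dots>n_r\ge0>m_s>\dots>m_1$); $\mathcal F^*$ is the right $\mathcal A$-module generated by $\langle0|$ with $\langle0|\psi_n=\langle0|\psi_m^*=0$ for $m<0\le n$. The pairing $\mathcal F^*\otimes\mathcal F\to k$, $\langle w|\otimes|v\rangle\mapsto\langle w|v\rangle$, is the bilinear map with $\langle0|0\rangle=1$ and $(\langle w|X)|v\rangle=\langle w|(X|v\rangle)$ for $X\in\mathcal A$. ${}^*$ is the anti-involution of $\mathcal A$ exchanging $\psi_n$ and $\psi_n^*$, and $\omega:\mathcal F\to\mathcal F^*$, $X|0\rangle\mapsto\langle0|X^*$. For $r\ge0$, $|-r\rangle=\psi^*_{-r}\cdots\psi^*_{-1}|0\rangle$. For $m\ne0$, $a_m=\sum_{j\in\mathbb Z}\psi_j\psi^*_{j+m}$ (so $a_m^*=a_{-m}$). $H(x)=\sum_{n>0}\frac{p_n(x)}{n}a_n$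 with $p_n$ the power sums; $\Theta=\sum_{n\ge1}\frac{(-1)^{n-1}\beta^n}{n}a_{-n}$, $\theta=\sum_{n\ge1}\frac{(-1)^{n-1}\beta^n}{n}a_{n}$. For a partition $\lambda$ and any $r\ge\ell(\lambda)$ (padding with zeros), $|\lambda\rangle^G=\psi_{\lambda_1-1}e^{\Theta}\psi_{\lambda_2-2}e^{\Theta}\cdots\psi_{\lambda_r-r}e^{\Theta}|-r\rangle$, $|\lambda\rangle^g=\psi_{\lambda_1-1}e^{-\theta}\psi_{\lambda_2-2}e^{-\theta}\cdots\psi_{\lambda_r-r}e^{-\theta}|-r\rangle$; these do not depend on $r$. ${}^g\langle\mu|=\omega(|\mu\rangle^g)$. Infinite linear combinations of basis vectors (produced by $e^{\Theta}$) are allowed, and brackets are extended termwise. *)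

theory Defs
  imports
    "HOL-Computational_Algebra.Polynomial"
    "HOL-Computational_Algebra.Fraction_Field"
    "HOL-Library.Poly_Mapping"
    "Jordan_Normal_Form.Determinant"
begin

text \<open>
  Throughout, \<^const>\<open>Sum_any\<close> is the sum of a finitely supported family; it
  renders every formal infinite sum coefficientwise, each coefficient being a finite sum.
\<close>

section \<open>The ground field and partitions\<close>

type_synonym scalar = "complex poly fract"

definition \<beta> :: scalar where
  "\<beta> = Fract [:0, 1:] 1"

text \<open>A partition is its list of nonzero parts; \<^const>\<open>length\<close> is the usual length of a partition.
  Parts are indexed from \<open>0\<close>, so \<open>part p i\<close> is the classical \<open>p\<^sub>i\<^sub>+\<^sub>1\<close>, padded with zeros.\<close>

definition is_partition :: "nat list \<Rightarrow> bool" where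
  "is_partition p \<longleftrightarrow> sorted_wrt (\<ge>) p \<and> 0 \<notin> set p"

definition part :: "nat list \<Rightarrow> nat \<Rightarrow> nat" where
  "part p i = (if i < length p then p ! i else 0)"


section \<open>Symmetric functions\<close>

text \<open>Formal power series in \<open>x\<^sub>0, x\<^sub>1, \<dots>\<close> are coefficient functions on monomials (exponent vectors).\<close>

type_synonym mono = "nat \<Rightarrow>\<^sub>0 nat"
type_synonym series = "mono \<Rightarrow> scalar"
type_synonym mpol = "mono \<Rightarrow>\<^sub>0 scalar"

definition X :: "nat \<Rightarrow> mpol" where
  "X i = Poly_Mapping.single (Poly_Mapping.single i 1) 1"

definition Const :: "scalar \<Rightarrow> mpol" where
  "Const c = Poly_Mapping.single 0 c"

text \<open>\<open>restricts_to n f P\<close>: the series \<open>f(x\<^sub>0, \<dots>, x\<^sub>n\<^sub>-\<^sub>1, 0, 0, \<dots>)\<close> is the polynomial \<open>P\<close>.\<close>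

definition restricts_to :: "nat \<Rightarrow> series \<Rightarrow> mpol \<Rightarrow> bool" where
  "restricts_to n f P \<longleftrightarrow>
     (\<forall>\<alpha>. Poly_Mapping.lookup P \<alpha> = (f \<alpha> when Poly_Mapping.keys \<alpha> \<subseteq> {..<n}))"

text \<open>
  \<open>bialternant b p f\<close>: for every \<open>n \<ge> \<ell>(p)\<close>, the restriction of \<open>f\<close> to \<open>n\<close> variables is the quotient
  of \<open>det (x\<^sub>i^(p\<^sub>j + n - j) (1 + b x\<^sub>i)^(j - 1))\<close> by the Vandermonde product
  (classical indices; below rows and columns start at \<open>0\<close>).
\<close>

definition bialternant :: "scalar \<Rightarrow> nat list \<Rightarrow> series \<Rightarrow> bool" where
  "bialternant b p f \<longleftrightarrow>
     (\<forall>n \<ge> length p. \<exists>P. restricts_to n f P \<and>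
        P * (\<Prod>(i, j) \<in> {(i, j). i < j \<and> j < n}. X i - X j) =
        det (mat n n (\<lambda>(i, j). X i ^ (part p j + n - Suc j) * (1 + Const b * X i) ^ j)))"

definition schur :: "nat list \<Rightarrow> series" where
  "schur p = (THE f. bialternant 0 p f)"

text \<open>The completion \<open>\<Lambda>^\<close>: formal sums \<open>\<Sum> c\<^sub>\<nu> s\<^sub>\<nu>\<close> with, for each \<open>n\<close>, finitely many nonzero
  \<open>c\<^sub>\<nu>\<close> with \<open>\<ell>(\<nu>) \<le> n\<close>.\<close>

definition Lambda_hat :: "series set" where
  "Lambda_hat = {f. \<exists>c :: nat list \<Rightarrow> scalar.
     (\<forall>n. finite {\<nu>. is_partition \<nu> \<and> length \<nu> \<le> n \<and> c \<nu> \<noteq> 0}) \<and>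
     f = (\<lambda>\<alpha>. Sum_any (\<lambda>\<nu>. c \<nu> * schur \<nu> \<alpha> when is_partition \<nu>))}"

definition grothendieck :: "nat list \<Rightarrow> series" where
  "grothendieck p = (THE f. f \<in> Lambda_hat \<and> bialternant \<beta> p f)"

text \<open>In \<open>f(x, y)\<close> the variables of the joint alphabet are taken in the order
  \<open>x\<^sub>0, y\<^sub>0, x\<^sub>1, y\<^sub>1, \<dots>\<close>, which is immaterial for symmetric \<open>f\<close>; \<open>coproduct f \<alpha> \<gamma>\<close> is the coefficient
  of \<open>x\<^sup>\<alpha> y\<^sup>\<gamma>\<close>.\<close>

lift_definition interleave :: "mono \<Rightarrow> mono \<Rightarrow> mono" is
  "\<lambda>\<alpha> \<gamma> i. if even i then \<alpha> (i div 2) else \<gamma> (i div 2)"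
proof -
  fix \<alpha> \<gamma> :: "nat \<Rightarrow> nat"
  assume "finite {i. \<alpha> i \<noteq> 0}" "finite {i. \<gamma> i \<noteq> 0}"
  then have "finite ((\<lambda>i. 2 * i) ` {i. \<alpha> i \<noteq> 0} \<union> (\<lambda>i. 2 * i + 1) ` {i. \<gamma> i \<noteq> 0})"
    by simp
  then show "finite {i. (if even i then \<alpha> (i div 2) else \<gamma> (i div 2)) \<noteq> 0}"
  proof (rule rev_finite_subset, intro subsetI)
    fix i
    assume i: "i \<in> {i. (if even i then \<alpha> (i div 2) else \<gamma> (i div 2)) \<noteq> 0}"
    show "i \<in> (\<lambda>i. 2 * i) ` {i. \<alpha> i \<noteq> 0} \<union> (\<lambda>i. 2 * i + 1) ` {i. \<gamma> i \<noteq> 0}"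
    proof (cases "even i")
      case True
      then have "i = 2 * (i div 2)" "i div 2 \<in> {i. \<alpha> i \<noteq> 0}" using i by simp_all
      then show ?thesis by (rule UnI1[OF image_eqI])
    next
      case False
      then have "i = 2 * (i div 2) + 1" "i div 2 \<in> {i. \<gamma> i \<noteq> 0}" using i by simp_all
      then show ?thesis by (rule UnI2[OF image_eqI])
    qed
  qed
qed

definition coproduct :: "series \<Rightarrow> mono \<Rightarrow> mono \<Rightarrow> scalar" where
  "coproduct f \<alpha> \<gamma> = f (interleave \<alpha> \<gamma>)"

text \<open>Buch's \<open>G\<^bsub>\<lambda>//\<mu>\<^esub>\<close>, as the family of coefficients in \<open>\<Delta>(G\<^sub>\<lambda>) = \<Sum>\<^sub>\<nu> G\<^sub>\<nu> \<otimes> G\<^bsub>\<lambda>//\<nu>\<^esub>\<close>.\<close>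

definition buch :: "nat list \<Rightarrow> nat list \<Rightarrow> series" where
  "buch p = (THE F.
     (\<forall>\<nu>. is_partition \<nu> \<longrightarrow> F \<nu> \<in> Lambda_hat) \<and>
     (\<forall>\<nu>. \<not> is_partition \<nu> \<longrightarrow> F \<nu> = (\<lambda>_. 0)) \<and>
     (\<forall>\<alpha> \<gamma>. coproduct (grothendieck p) \<alpha> \<gamma> =
        Sum_any (\<lambda>\<nu>. grothendieck \<nu> \<alpha> * F \<nu> \<gamma> when is_partition \<nu>)))"


section \<open>Fermions\<close>

text \<open>
  A (possibly infinite) linear combination of basis vectors of the Fock space is its coefficient
  function on Maya diagrams \<open>S\<close>. The diagram \<open>S\<close> stands for the semi-infinite word
  \<open>\<psi>\<^sub>s\<^sub>1 \<psi>\<^sub>s\<^sub>2 \<dots>\<close> with \<open>S = {s\<^sub>1 > s\<^sub>2 > \<dots>}\<close>; it agrees up to sign with the basis vector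
  \<open>\<psi>\<^sub>n\<^sub>1 \<dots> \<psi>\<^sub>n\<^sub>r \<psi>\<^sup>*\<^sub>m\<^sub>1 \<dots> \<psi>\<^sup>*\<^sub>m\<^sub>s |0\<rangle>\<close>, where the \<open>n\<^sub>i\<close> are the nonnegative elements of \<open>S\<close> and the
  \<open>m\<^sub>i\<close> the negative integers not in \<open>S\<close> (\<open>word_ket_eq\<close> below).
\<close>

type_synonym vec = "int set \<Rightarrow> scalar"

definition maya :: "int set \<Rightarrow> bool" where
  "maya S \<longleftrightarrow> finite (S \<inter> {0..}) \<and> finite ({..<0} - S)"

definition fock :: "vec set" where
  "fock = {v. \<forall>S. v S \<noteq> 0 \<longrightarrow> maya S}"

definition ket :: "int set \<Rightarrow> vec" where
  "ket S = (\<lambda>T. 1 when T = S)"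

definition vac :: vec where
  "vac = ket {..<0}"

definition above_sign :: "int \<Rightarrow> int set \<Rightarrow> scalar" where
  "above_sign n S = (- 1) ^ card {k \<in> S. n < k}"

definition psi :: "int \<Rightarrow> vec \<Rightarrow> vec" where
  "psi n v = (\<lambda>S. above_sign n S * v (S - {n}) when n \<in> S)"

definition psi_star :: "int \<Rightarrow> vec \<Rightarrow> vec" where
  "psi_star n v = (\<lambda>S. above_sign n S * v (insert n S) when n \<notin> S)"

text \<open>Elements of \<open>\<F>\<^sup>*\<close> are realised as functionals \<open>\<langle>w|\<close> on \<open>\<F>\<close>, with right action
  \<open>\<langle>w|X = \<langle>w| \<circ> X\<close>, so that the pairing is evaluation. For \<open>v\<close> of finite support, \<open>\<omega>\<close> is the map
  \<open>X|0\<rangle> \<mapsto> \<langle>0|X\<^sup>*\<close>: see \<open>omega_vac\<close>, \<open>omega_psi\<close> and \<open>omega_psi_star\<close> below.\<close>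

definition bra_vac :: "vec \<Rightarrow> scalar" where
  "bra_vac w = w {..<0}"

definition omega :: "vec \<Rightarrow> vec \<Rightarrow> scalar" where
  "omega v w = Sum_any (\<lambda>S. v S * w S)"

text \<open>\<open>cket r = |-r\<rangle>\<close>\<close>

definition cket :: "nat \<Rightarrow> vec" where
  "cket r = foldr psi_star [- int r..-1] vac"

text \<open>The current \<open>a\<^sub>m\<close> is only used for \<open>m \<noteq> 0\<close>, where no normal ordering is needed.\<close>

definition current :: "int \<Rightarrow> vec \<Rightarrow> vec" where
  "current m v = (\<lambda>S. Sum_any (\<lambda>j. psi j (psi_star (j + m) v) S))"

definition Theta :: "vec \<Rightarrow> vec" where
  "Theta v = (\<lambda>S. Sum_any (\<lambda>n. (- 1) ^ (n - 1) * \<beta> ^ n / of_nat n * current (- int n) v S when n \<ge> 1))"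

definition theta :: "vec \<Rightarrow> vec" where
  "theta v = (\<lambda>S. Sum_any (\<lambda>n. (- 1) ^ (n - 1) * \<beta> ^ n / of_nat n * current (int n) v S when n \<ge> 1))"

definition op_exp :: "(('i \<Rightarrow> scalar) \<Rightarrow> 'i \<Rightarrow> scalar) \<Rightarrow> ('i \<Rightarrow> scalar) \<Rightarrow> 'i \<Rightarrow> scalar" where
  "op_exp A v = (\<lambda>i. Sum_any (\<lambda>k. (A ^^ k) v i / of_nat (fact k)))"

text \<open>\<open>|\<lambda>\<rangle>\<^sup>G\<close> and \<open>|\<lambda>\<rangle>\<^sup>g\<close>, written with \<open>r \<ge> \<ell>(\<lambda>)\<close> factors.\<close>

definition ket_G :: "nat \<Rightarrow> nat list \<Rightarrow> vec" where
  "ket_G r p =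
     foldr (\<lambda>i v. psi (int (part p i) - int (Suc i)) (op_exp Theta v)) [0..<r] (cket r)"

definition ket_g :: "nat \<Rightarrow> nat list \<Rightarrow> vec" where
  "ket_g r p =
     foldr (\<lambda>i v. psi (int (part p i) - int (Suc i)) (op_exp (\<lambda>u S. - theta u S) v)) [0..<r] (cket r)"

text \<open>\<open>e\<^sup>H\<^sup>(\<^sup>x\<^sup>)\<close> acts on power series in \<open>x\<close> with coefficients in the Fock space, i.e. on functions of
  a monomial and a Maya diagram.\<close>

definition power_sum :: "nat \<Rightarrow> series" where
  "power_sum n = (\<lambda>\<alpha>. 1 when (\<exists>i. \<alpha> = Poly_Mapping.single i n))"

definition Hx :: "(mono \<times> int set \<Rightarrow> scalar) \<Rightarrow> mono \<times> int set \<Rightarrow> scalar" where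
  "Hx V = (\<lambda>(\<alpha>, S). Sum_any (\<lambda>n.
     Sum_any (\<lambda>(\<delta>, \<gamma>).
       power_sum n \<delta> / of_nat n * current (int n) (\<lambda>T. V (\<gamma>, T)) S when \<delta> + \<gamma> = \<alpha>)
     when n \<ge> 1))"

definition exp_Hx :: "vec \<Rightarrow> mono \<Rightarrow> vec" where
  "exp_Hx v \<alpha> = (\<lambda>S. op_exp Hx (\<lambda>(\<gamma>, T). v T when \<gamma> = 0) (\<alpha>, S))"


section \<open>The relations of the fermion algebra and of the vacuum\<close>

lemma maya_insert [simp]: "maya (insert n S) \<longleftrightarrow> maya S"
proof -
  have "{..<0} - S \<subseteq> insert n ({..<0} - insert n S)" by auto
  then show ?thesis
    unfolding maya_def by (auto simp: Int_insert_left intro: finite_subset)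
qed

lemma maya_remove [simp]: "maya (S - {n}) \<longleftrightarrow> maya S"
  by (metis insert_Diff_single maya_insert)

lemma finite_above: "maya S \<Longrightarrow> finite {k \<in> S. n < k}"
  by (rule finite_subset[of _ "(S \<inter> {0..}) \<union> {n<..<0}"]) (auto simp: maya_def)

lemma above_sign_insert:
  assumes "maya S" "n \<notin> S"
  shows "above_sign m (insert n S) = (if m < n then - above_sign m S else above_sign m S)"
proof -
  have "{k \<in> insert n S. m < k} = (if m < n then insert n {k \<in> S. m < k} else {k \<in> S. m < k})"
    by auto
  then show ?thesis
    using assms finite_above[OF assms(1), of m] by (simp add: above_sign_def)
qed

lemma above_sign_remove:
  assumes "maya S" "n \<in> S"
  shows "above_sign m (S - {n}) = (if m < n then - above_sign m S else above_sign m S)"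
  using above_sign_insert[of "S - {n}" n m] assms by (auto simp: insert_absorb)

lemma above_sign_minus: "above_sign n (S - {n}) = above_sign n S"
  unfolding above_sign_def by (rule arg_cong[where f = "\<lambda>A. (- 1) ^ card A"]) auto

lemma above_sign_insert_self: "above_sign n (insert n S) = above_sign n S"
  unfolding above_sign_def by (rule arg_cong[where f = "\<lambda>A. (- 1) ^ card A"]) auto

lemma above_sign_square [simp]: "above_sign n S * above_sign n S = 1"
  by (simp add: above_sign_def flip: power_add mult_2)

lemma vac_fock: "vac \<in> fock"
proof -
  have "{..<0::int} \<inter> {0..} = {}" by auto
  then show ?thesis by (simp add: vac_def ket_def fock_def maya_def when_def)
qed

lemma psi_fock: "v \<in> fock \<Longrightarrow> psi n v \<in> fock"
  by (auto simp: psi_def fock_def when_def split: if_splits)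

lemma psi_star_fock: "v \<in> fock \<Longrightarrow> psi_star n v \<in> fock"
  by (auto simp: psi_star_def fock_def when_def split: if_splits)

lemma fock_zero: "v \<in> fock \<Longrightarrow> \<not> maya S \<Longrightarrow> v S = 0"
  by (auto simp: fock_def)

lemma car_psi_psi:
  assumes "v \<in> fock"
  shows "psi m (psi n v) S + psi n (psi m v) S = 0"
proof (cases "maya S \<and> m \<in> S \<and> n \<in> S \<and> m \<noteq> n")
  case True
  have comm: "v (S - {n} - {m}) = v (S - {m} - {n})"
    by (rule arg_cong[where f = v]) auto
  have sgn: "above_sign m S * above_sign n (S - {m}) = - (above_sign n S * above_sign m (S - {n}))"
    using True by (cases m n rule: linorder_cases) (simp_all add: above_sign_remove)
  have "psi m (psi n v) S = (above_sign m S * above_sign n (S - {m})) * v (S - {m} - {n})"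
    using True by (simp add: psi_def)
  moreover have "psi n (psi m v) S = (above_sign n S * above_sign m (S - {n})) * v (S - {m} - {n})"
    using True by (simp add: psi_def comm)
  ultimately show ?thesis
    by (simp only: sgn mult_minus_left left_minus)
next
  case False
  then show ?thesis
    by (cases "maya S") (auto simp: psi_def fock_zero[OF assms])
qed

lemma car_psi_star_psi_star:
  assumes "v \<in> fock"
  shows "psi_star m (psi_star n v) S + psi_star n (psi_star m v) S = 0"
proof (cases "maya S \<and> m \<notin> S \<and> n \<notin> S \<and> m \<noteq> n")
  case True
  have comm: "v (insert m (insert n S)) = v (insert n (insert m S))"
    by (rule arg_cong[where f = v]) auto
  have sgn: "above_sign m S * above_sign n (insert m S) =
      - (above_sign n S * above_sign m (insert n S))"
    using True by (cases m n rule: linorder_cases) (simp_all add: above_sign_insert)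
  have "psi_star m (psi_star n v) S =
      (above_sign m S * above_sign n (insert m S)) * v (insert n (insert m S))"
    using True by (simp add: psi_star_def)
  moreover have "psi_star n (psi_star m v) S =
      (above_sign n S * above_sign m (insert n S)) * v (insert n (insert m S))"
    using True by (simp add: psi_star_def comm)
  ultimately show ?thesis
    by (simp only: sgn mult_minus_left left_minus)
next
  case False
  then show ?thesis
    by (cases "maya S") (auto simp: psi_star_def fock_zero[OF assms])
qed

lemma car_psi_psi_star:
  assumes "v \<in> fock"
  shows "psi m (psi_star n v) S + psi_star n (psi m v) S = (v S when m = n)"
proof (cases "maya S")
  case maya: True
  show ?thesis
  proof (cases "m = n")
    case eq: True
    have "above_sign n S * (above_sign n S * v S) = v S"
      by (simp only: mult.assoc[symmetric] above_sign_square mult_1_left)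
    then show ?thesis
      using eq
      by (cases "n \<in> S")
         (simp_all add: psi_def psi_star_def above_sign_minus above_sign_insert_self insert_absorb)
  next
    case neq: False
    show ?thesis
    proof (cases "m \<in> S \<and> n \<notin> S")
      case True
      have comm: "v (insert n (S - {m})) = v (insert n S - {m})"
        by (rule arg_cong[where f = v]) (use neq in auto)
      have sgn: "above_sign m S * above_sign n (S - {m}) =
          - (above_sign n S * above_sign m (insert n S))"
        using maya True neq
        by (cases m n rule: linorder_cases) (simp_all add: above_sign_remove above_sign_insert)
      have "psi m (psi_star n v) S =
          (above_sign m S * above_sign n (S - {m})) * v (insert n S - {m})"
        using True by (simp add: psi_def psi_star_def comm)
      moreover have "psi_star n (psi m v) S =
          (above_sign n S * above_sign m (insert n S)) * v (insert n S - {m})"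
        using True by (simp add: psi_def psi_star_def)
      ultimately show ?thesis
        using neq by (simp only: sgn mult_minus_left left_minus Poly_Mapping.when(2) not_False_eq_True)
    next
      case False
      then show ?thesis using neq by (auto simp: psi_def psi_star_def)
    qed
  qed
next
  case False
  then show ?thesis
    by (simp add: psi_def psi_star_def fock_zero[OF assms])
qed

lemma psi_vac:
  assumes "m < 0"
  shows "psi m vac = (\<lambda>_. 0)"
proof
  fix S
  have "S - {m} \<noteq> {..<0}" using assms by blast
  then show "psi m vac S = 0" by (simp add: psi_def vac_def ket_def)
qed

lemma psi_star_vac:
  assumes "0 \<le> n"
  shows "psi_star n vac = (\<lambda>_. 0)"
proof
  fix S
  have "insert n S \<noteq> {..<0}" using assms by (metis insertI1 lessThan_iff not_le)
  then show "psi_star n vac S = 0" by (simp add: psi_star_def vac_def ket_def)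
qed

lemma bra_vac_psi: "0 \<le> n \<Longrightarrow> bra_vac (psi n v) = 0"
  by (simp add: bra_vac_def psi_def)

lemma bra_vac_psi_star: "m < 0 \<Longrightarrow> bra_vac (psi_star m v) = 0"
  by (simp add: bra_vac_def psi_star_def)

lemma bra_vac_vac: "bra_vac vac = 1"
  by (simp add: bra_vac_def vac_def ket_def)

lemma omega_ket: "omega (ket S) w = w S"
proof -
  have "omega (ket S) w = Sum_any (\<lambda>T. w T when T = S)"
    unfolding omega_def by (rule Sum_any.cong) (simp add: ket_def when_def)
  then show ?thesis by simp
qed

lemma omega_vac: "omega vac = bra_vac"
  by (rule ext) (simp add: vac_def omega_ket bra_vac_def)

lemma omega_psi: "omega (psi n v) w = omega v (psi_star n w)"
  unfolding omega_def Sum_any.expand_set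
  by (rule sum.reindex_bij_witness[where i = "insert n" and j = "\<lambda>S. S - {n}"])
     (auto simp: psi_def psi_star_def when_def insert_absorb above_sign_minus above_sign_insert_self
        split: if_splits)

lemma omega_psi_star: "omega (psi_star n v) w = omega v (psi n w)"
  unfolding omega_def Sum_any.expand_set
  by (rule sum.reindex_bij_witness[where i = "\<lambda>S. S - {n}" and j = "insert n"])
     (auto simp: psi_def psi_star_def when_def insert_absorb above_sign_minus above_sign_insert_self
        split: if_splits)

lemma psi_ket:
  assumes "n \<notin> S"
  shows "psi n (\<lambda>T. c * ket S T) = (\<lambda>T. (above_sign n S * c) * ket (insert n S) T)"
proof
  fix T
  show "psi n (\<lambda>T. c * ket S T) T = (above_sign n S * c) * ket (insert n S) T"
    using assms
    by (cases "T = insert n S")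
       (auto simp: psi_def ket_def when_def above_sign_insert_self insert_absorb)
qed

lemma psi_star_ket:
  assumes "n \<in> S"
  shows "psi_star n (\<lambda>T. c * ket S T) = (\<lambda>T. (above_sign n S * c) * ket (S - {n}) T)"
proof
  fix T
  show "psi_star n (\<lambda>T. c * ket S T) T = (above_sign n S * c) * ket (S - {n}) T"
    using assms
    by (cases "T = S - {n}")
       (auto simp: psi_star_def ket_def when_def above_sign_minus insert_absorb)
qed

lemma above_sign_cases: "above_sign n S \<in> {1, - 1}"
  by (cases "even (card {k \<in> S. n < k})") (auto simp: above_sign_def)

lemma word_ket_eq:
  assumes "maya S"
  shows "\<exists>\<epsilon> \<in> {1, - 1}.
    foldr psi (rev (sorted_list_of_set (S \<inter> {0..})))
      (foldr psi_star (sorted_list_of_set ({..<0} - S)) vac) = (\<lambda>T. \<epsilon> * ket S T)"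
proof -
  have holes: "\<exists>\<epsilon> \<in> {1, - 1}.
      foldr psi_star (sorted_list_of_set M) vac = (\<lambda>T. \<epsilon> * ket ({..<0} - M) T)"
    if "finite M" "M \<subseteq> {..<0}" for M
    using that
  proof (induction M rule: finite_linorder_min_induct)
    case empty
    then show ?case by (auto simp: vac_def)
  next
    case (insert m M)
    then have "M \<subseteq> {..<0}" by simp
    from insert.IH[OF this] obtain \<epsilon> where \<epsilon>: "\<epsilon> \<in> {1, - 1}"
      "foldr psi_star (sorted_list_of_set M) vac = (\<lambda>T. \<epsilon> * ket ({..<0} - M) T)"
      by (rule bexE)
    have m: "m \<in> {..<0} - M" using insert by auto
    have "sorted_list_of_set (insert m M) = m # sorted_list_of_set M"
      using insert by (subst sorted_list_of_set_nonempty) (auto simp: Min_insert2 less_imp_le)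
    moreover have "{..<0} - M - {m} = {..<0} - insert m M" by auto
    ultimately have "foldr psi_star (sorted_list_of_set (insert m M)) vac =
        (\<lambda>T. (above_sign m ({..<0} - M) * \<epsilon>) * ket ({..<0} - insert m M) T)"
      using psi_star_ket[OF m, of \<epsilon>] by (simp only: foldr.simps o_apply \<epsilon>(2))
    moreover have "above_sign m ({..<0} - M) * \<epsilon> \<in> {1, - 1}"
      using above_sign_cases[of m "{..<0} - M"] \<epsilon>(1) by auto
    ultimately show ?case by blast
  qed
  have particles: "\<exists>\<epsilon> \<in> {1, - 1}.
      foldr psi (rev (sorted_list_of_set N)) (\<lambda>T. c * ket R T) = (\<lambda>T. \<epsilon> * ket (N \<union> R) T)"
    if "finite N" "N \<subseteq> {0..}" "R \<subseteq> {..<0}" "c \<in> {1, - 1}" for N R c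
    using that
  proof (induction N rule: finite_linorder_max_induct)
    case empty
    then show ?case by auto
  next
    case (insert n N)
    then have "N \<subseteq> {0..}" by simp
    from insert.IH[OF this insert.prems(2,3)] obtain \<epsilon> where \<epsilon>: "\<epsilon> \<in> {1, - 1}"
      "foldr psi (rev (sorted_list_of_set N)) (\<lambda>T. c * ket R T) = (\<lambda>T. \<epsilon> * ket (N \<union> R) T)"
      by (rule bexE)
    have n: "n \<notin> N \<union> R" using insert by auto
    have "sorted_list_of_set (insert n N) = sorted_list_of_set N @ [n]"
    proof -
      have "n \<notin> N" using insert.hyps(2) by blast
      then have "sorted_list_of_set (insert n N) = insort n (sorted_list_of_set N)"
        using insert.hyps(1) by (simp)
      also have "\<dots> = sorted_list_of_set N @ [n]"
        by (rule sorted_insort_is_snoc) (use insert.hyps in \<open>auto simp: less_imp_le\<close>)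
      finally show ?thesis .
    qed
    then have "foldr psi (rev (sorted_list_of_set (insert n N))) (\<lambda>T. c * ket R T) =
        (\<lambda>T. (above_sign n (N \<union> R) * \<epsilon>) * ket (insert n N \<union> R) T)"
      using psi_ket[OF n, of \<epsilon>] by (simp only: rev_append rev.simps append.simps foldr.simps o_apply \<epsilon>(2) Un_insert_left)
    moreover have "above_sign n (N \<union> R) * \<epsilon> \<in> {1, - 1}"
      using above_sign_cases[of n "N \<union> R"] \<epsilon>(1) by auto
    ultimately show ?case by blast
  qed
  have fin: "finite (S \<inter> {0..})" "finite ({..<0} - S)" using assms by (auto simp: maya_def)
  obtain c where c: "c \<in> {1, - 1}" "foldr psi_star (sorted_list_of_set ({..<0} - S)) vac =
      (\<lambda>T. c * ket ({..<0} - ({..<0} - S)) T)"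
    using holes[OF fin(2)] by blast
  have "S \<inter> {0..} \<union> ({..<0} - ({..<0} - S)) = S" by auto
  then show ?thesis
    using particles[OF fin(1) _ _ c(1), of "{..<0} - ({..<0} - S)"] c(2) by auto
qed

end

theory Submission
  imports Defs "HOL-Computational_Algebra.Formal_Power_Series"
begin

text \<open>
  An exponential of currents is determined by its commutation with the modes \<open>\<psi>\<^sub>n\<close>:
  \<open>e\<^sup>\<Theta> \<psi>\<^sub>n = (\<psi>\<^sub>n + \<beta> \<psi>\<^sub>n\<^sub>+\<^sub>1) e\<^sup>\<Theta>\<close>, \<open>e\<^sup>-\<^sup>\<theta> \<psi>\<^sub>n = \<Sum> (-\<beta>)\<^sup>k \<psi>\<^sub>n\<^sub>-\<^sub>k e\<^sup>-\<^sup>\<theta>\<close> and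
  \<open>e\<^sup>H \<psi>\<^sub>n = \<Sum> h\<^sub>k(x) \<psi>\<^sub>n\<^sub>-\<^sub>k e\<^sup>H\<close>. Hence the coefficients of \<open>|\<lambda>\<rangle>\<^sup>G\<close>, of \<open>|\<mu>\<rangle>\<^sup>g\<close> and of \<open>e\<^sup>H\<close> on
  basis vectors are determinants, and Cauchy--Binet gives \<open>\<^sup>g\<langle>\<mu>|\<lambda>\<rangle>\<^sup>G = \<delta>\<close>, the bialternant formula for
  \<open>\<langle>0|e\<^sup>H|\<lambda>\<rangle>\<^sup>G = G\<^sub>\<lambda>\<close>, and Jacobi--Trudi for \<open>\<langle>0|e\<^sup>H\<close> on basis vectors. Since both families are
  triangular, duality implies completeness \<open>\<Sum> |\<mu>\<rangle>\<^sup>G \<^sup>g\<langle>\<mu>| = 1\<close> in charge \<open>0\<close>; inserting it into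
  \<open>G\<^sub>\<lambda>(x, y) = \<langle>0|e\<^sup>H\<^sup>(\<^sup>x\<^sup>) e\<^sup>H\<^sup>(\<^sup>y\<^sup>)|\<lambda>\<rangle>\<^sup>G\<close> yields \<open>\<Delta>(G\<^sub>\<lambda>) = \<Sum> G\<^sub>\<mu> \<otimes> \<^sup>g\<langle>\<mu>|e\<^sup>H|\<lambda>\<rangle>\<^sup>G\<close>, and the
  coefficients in such an expansion are unique because the \<open>G\<^sub>\<mu>\<close> are linearly independent.
\<close>

text \<open>Finiteness is the first obstacle: \<open>Sum_any\<close> is 0 on an infinite support, so
  every series of currents has to be finite at each diagram. A current of fixed degree reads the
  coefficient at \<open>S\<close> from diagrams a fixed weight away, and only finitely many Maya
  diagrams have weight below a given bound; identities are therefore proved coefficientwise. The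
  second obstacle is that \<open>e\<^sup>\<Theta>\<close> digs arbitrarily deep holes into the sea.
  A determinant with N rows describes \<open>|\<lambda>\<rangle>\<^sup>G\<close> only at diagrams
  containing everything below -N. This fits the bialternant in N variables, where Schur functions
  with more than N parts vanish. The factor \<open>(1 + \<beta> x\<^sub>i)^(j - 1)\<close> records
  the j - 1 exponentials to the left of the j-th fermion. Finally, \<open>buch\<close> requires each
  bracket to lie in \<open>Lambda_hat\<close>, which the coproduct expansion alone does not show. On
  charge 0 the functional \<open>\<^sup>g\<langle>\<mu>|\<close> is a finite combination of
  functionals \<open>\<langle>0|E\<close> with E a coefficient of \<open>e\<^sup>H\<close>. Such E
  commute with \<open>e\<^sup>H\<close>, so the bracket is again a vacuum coefficient
  \<open>\<langle>0|e\<^sup>H|w\<rangle>\<close>.\<close>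

lemma of_nat_scalar_eq_0_iff [simp]: "(of_nat n :: scalar) = 0 \<longleftrightarrow> n = 0"
  by (simp add: of_nat_fract Zero_fract_def eq_fract)

section \<open>Wedge coefficients and determinants\<close>

text \<open>This is the minor of the rows \<open>r 0\<close>, \<open>r 1\<close>, ... on the columns
  \<open>M\<close> in decreasing order, expanded along its first row. The recursion avoids
  enumerating \<open>M\<close>, and its sign is the \<open>above_sign\<close> of the outermost
  fermion.\<close>

fun wedge :: "nat \<Rightarrow> (nat \<Rightarrow> int \<Rightarrow> 'a::comm_ring_1) \<Rightarrow> int set \<Rightarrow> 'a" where
  "wedge 0 r M = (if M = {} then 1 else 0)"
| "wedge (Suc n) r M = (\<Sum>m\<in>M. (- 1) ^ card {k \<in> M. m < k} * r 0 m * wedge n (\<lambda>i. r (Suc i)) (M - {m}))"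

lemma wedge_eq_0: "infinite M \<or> card M \<noteq> n \<Longrightarrow> wedge n r M = 0"
proof (induction n arbitrary: r M)
  case 0
  then show ?case by auto
next
  case (Suc n)
  have "wedge n (\<lambda>i. r (Suc i)) (M - {m}) = 0" if "m \<in> M" for m
    using Suc.prems that card_Suc_Diff1[of M m] by (intro Suc.IH) auto
  then show ?case by simp
qed

lemma wedge_cong:
  "(\<And>i m. i < n \<Longrightarrow> m \<in> M \<Longrightarrow> r i m = r' i m) \<Longrightarrow> wedge n r M = wedge n r' M"
proof (induction n arbitrary: r r' M)
  case (Suc n)
  have "wedge n (\<lambda>i. r (Suc i)) (M - {m}) = wedge n (\<lambda>i. r' (Suc i)) (M - {m})" for m
    using Suc.prems by (intro Suc.IH) auto
  then show ?case using Suc.prems by (auto intro!: sum.cong)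
qed simp

text \<open>A minor with a zero column vanishes. This later confines the diagrams on which a product
  of fermions is nonzero.\<close>

lemma wedge_nonzero_support:
  "wedge n r M \<noteq> 0 \<Longrightarrow> m \<in> M \<Longrightarrow> \<exists>i<n. r i m \<noteq> 0"
proof (induction n arbitrary: r M)
  case (Suc n)
  from Suc.prems(1) obtain l where l: "l \<in> M"
    "(- 1) ^ card {k \<in> M. l < k} * r 0 l * wedge n (\<lambda>i. r (Suc i)) (M - {l}) \<noteq> 0"
    unfolding wedge.simps by (rule sum.not_neutral_contains_not_neutral)
  show ?case
  proof (cases "l = m")
    case True
    then show ?thesis using l(2) by (intro exI[of _ 0]) (auto simp del: wedge.simps)
  next
    case False
    have "wedge n (\<lambda>i. r (Suc i)) (M - {l}) \<noteq> 0" using l by auto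
    from Suc.IH[OF this] False Suc.prems(2) obtain i where "i < n" "r (Suc i) m \<noteq> 0" by auto
    then show ?thesis by (intro exI[of _ "Suc i"]) auto
  qed
qed (auto split: if_splits)

lemma mat_delete_mat:
  "mat_delete (mat (Suc n) (Suc n) f) 0 j = mat n n (\<lambda>(i, k). f (Suc i, insert_index j k))"
  by (rule eq_matI) (auto simp: mat_delete_def insert_index_def)

text \<open>Since \<open>m\<close> decreases, the number of columns above \<open>m j\<close> is
  \<open>j\<close>, so the recursion is the Laplace expansion along row 0.\<close>

lemma wedge_det:
  assumes "\<And>i j. i < j \<Longrightarrow> j < n \<Longrightarrow> m j < m i"
  shows "wedge n r (m ` {..<n}) = det (mat n n (\<lambda>(i, j). r i (m j)))"
  using assms
proof (induction n arbitrary: r m)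
  case 0
  then show ?case by simp
next
  case (Suc n)
  have inj: "inj_on m {..<Suc n}"
    by (rule inj_onI) (metis Suc.prems lessThan_iff linorder_neqE_nat less_irrefl)
  let ?A = "mat (Suc n) (Suc n) (\<lambda>(i, j). r i (m j))"
  have "det ?A = (\<Sum>j<Suc n. ?A $$ (0, j) * cofactor ?A 0 j)"
    by (rule laplace_expansion_row) auto
  also have "\<dots> = (\<Sum>j<Suc n. (- 1) ^ card {k \<in> m ` {..<Suc n}. m j < k} * r 0 (m j)
      * wedge n (\<lambda>i. r (Suc i)) (m ` {..<Suc n} - {m j}))"
  proof (rule sum.cong)
    fix j assume "j \<in> {..<Suc n}"
    then have j: "j < Suc n" by simp
    have lt: "m a < m b \<longleftrightarrow> b < a" if "a < Suc n" "b < Suc n" for a b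
      using Suc.prems[of a b] Suc.prems[of b a] that by (cases a b rule: linorder_cases) auto
    have "{k \<in> m ` {..<Suc n}. m j < k} = m ` {..<j}"
      using j by (auto simp: lt)
    moreover have "card (m ` {..<j}) = j"
      by (subst card_image) (use j in \<open>auto intro: inj_on_subset[OF inj]\<close>)
    ultimately have c: "card {k \<in> m ` {..<Suc n}. m j < k} = j" by simp
    have "m ` {..<Suc n} - {m j} = m ` ({..<Suc n} - {j})"
      using inj_on_image_set_diff[OF inj, of "{..<Suc n}" "{j}"] j by simp
    also have "{..<Suc n} - {j} = insert_index j ` {..<n}"
      using insert_index_image[of j n] j by (simp add: atLeast0LessThan)
    finally have im: "m ` {..<Suc n} - {m j} = (m \<circ> insert_index j) ` {..<n}"
      by (simp add: image_comp)
    have w: "wedge n (\<lambda>i. r (Suc i)) ((m \<circ> insert_index j) ` {..<n}) =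
        det (mat n n (\<lambda>(i, k). r (Suc i) ((m \<circ> insert_index j) k)))"
      by (rule Suc.IH) (auto simp: insert_index_def lt Suc.prems)
    show "?A $$ (0, j) * cofactor ?A 0 j = (- 1) ^ card {k \<in> m ` {..<Suc n}. m j < k} * r 0 (m j)
      * wedge n (\<lambda>i. r (Suc i)) (m ` {..<Suc n} - {m j})"
      unfolding c im w cofactor_def mat_delete_mat using j by (simp add: mult_ac)
  qed simp
  also have "\<dots> = wedge (Suc n) r (m ` {..<Suc n})"
    by (simp add: sum.reindex[OF inj] del: image_Suc_lessThan lessThan_Suc)
  finally show ?case by simp
qed

section \<open>Contraction of a minor by a column, and the Cauchy-Binet formula\<close>

definition contract :: "int \<Rightarrow> (int set \<Rightarrow> 'a::comm_ring_1) \<Rightarrow> int set \<Rightarrow> 'a" where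
  "contract m F M = (if m \<in> M then 0 else (- 1) ^ card {k \<in> M. m < k} * F (insert m M))"

lemma sign_insert:
  assumes "finite M" "n \<notin> M"
  shows "(- 1 :: 'a::comm_ring_1) ^ card {k \<in> insert n M. m < k} =
    (if m < n then - 1 else 1) * (- 1) ^ card {k \<in> M. m < k}"
proof -
  have "{k \<in> insert n M. m < k} = (if m < n then insert n {k \<in> M. m < k} else {k \<in> M. m < k})"
    by auto
  then show ?thesis using assms by simp
qed

lemma sign_remove_self:
  "{k \<in> M - {m}. (m::int) < k} = {k \<in> M. m < k}" "{k \<in> insert m M. m < k} = {k \<in> M. m < k}"
  by auto

lemma neq_less_conj [simp]: "k \<noteq> b \<and> b < k \<longleftrightarrow> b < (k::int)"
  by auto

lemma eq_less_disj [simp]: "(k = b \<or> P) \<and> b < k \<longleftrightarrow> P \<and> b < (k::int)"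
  by auto

lemma sign_square: "(- 1 :: 'a::comm_ring_1) ^ c * ((- 1) ^ c * x) = x"
  by (simp flip: mult.assoc power_add mult_2)

text \<open>Laplace expansion along the column \<open>m\<close>, obtained from the first-row
  expansion by induction; \<open>insert_index j\<close> skips row \<open>j\<close>. In fermionic
  terms a contraction is an antiderivation.\<close>

lemma contract_wedge:
  assumes "finite M"
  shows "contract m (wedge (Suc n) r) M =
    (\<Sum>j<Suc n. (- 1) ^ j * r j m * wedge n (\<lambda>i. r (insert_index j i)) M)"
  using assms
proof (induction n arbitrary: r M)
  case 0
  have e: "{k. k = m \<and> m < k} = {}" by auto
  have "wedge (Suc 0) r (insert m M) = 0" if "M \<noteq> {}" "m \<notin> M"
    using that 0 by (intro wedge_eq_0) simp
  then show ?case
    by (cases "M = {}") (simp_all add: contract_def e del: wedge.simps(2), simp add: e)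
next
  case (Suc n)
  let ?s = "\<lambda>l M. (- 1 :: 'a) ^ card {k \<in> M. l < k}"
  let ?r = "\<lambda>i. r (Suc i)"
  let ?W = "wedge (Suc n) ?r"
  have ins0: "insert_index 0 i = Suc i" for i by (simp add: insert_index_def)
  have insS: "insert_index (Suc j) 0 = 0" "insert_index (Suc j) (Suc i) = Suc (insert_index j i)" for i j
    by (simp_all add: insert_index_def)
  \<comment> \<open>Row 0 is split off. In all other terms it survives as first row, so unfolding
    \<open>wedge\<close> exposes the induction hypothesis on the remaining rows.\<close>
  have "(\<Sum>j<Suc (Suc n). (- 1) ^ j * r j m * wedge (Suc n) (\<lambda>i. r (insert_index j i)) M) =
      r 0 m * ?W M - (\<Sum>j<Suc n. (- 1) ^ j * ?r j m * wedge (Suc n) (\<lambda>i. r (insert_index (Suc j) i)) M)"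
    by (subst sum.lessThan_Suc_shift)
      (simp add: ins0 sum_negf del: wedge.simps sum.lessThan_Suc)
  also have "(\<Sum>j<Suc n. (- 1) ^ j * ?r j m * wedge (Suc n) (\<lambda>i. r (insert_index (Suc j) i)) M)
     = (\<Sum>j<Suc n. \<Sum>l\<in>M. ?s l M * r 0 l * ((- 1) ^ j * ?r j m * wedge n (\<lambda>i. ?r (insert_index j i)) (M - {l})))"
    by (simp add: insS sum_distrib_left mult_ac del: sum.lessThan_Suc)
  also have "\<dots> = (\<Sum>l\<in>M. ?s l M * r 0 l * contract m ?W (M - {l}))"
    using Suc.prems by (subst sum.swap) (simp add: Suc.IH sum_distrib_left del: wedge.simps sum.lessThan_Suc)
  finally have rhs: "(\<Sum>j<Suc (Suc n). (- 1) ^ j * r j m * wedge (Suc n) (\<lambda>i. r (insert_index j i)) M) =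
      r 0 m * ?W M - (\<Sum>l\<in>M. ?s l M * r 0 l * contract m ?W (M - {l}))" .
  show ?case
  proof (cases "m \<in> M")
    case True
    \<comment> \<open>The column \<open>m\<close> would occur twice: only \<open>l = m\<close>
      survives, and it cancels the row-0 term.\<close>
    have "(\<Sum>l\<in>M. ?s l M * r 0 l * contract m ?W (M - {l})) =
        (\<Sum>l\<in>M. if l = m then r 0 m * ?W M else 0)"
    proof (rule sum.cong)
      fix l assume "l \<in> M"
      show "?s l M * r 0 l * contract m ?W (M - {l}) = (if l = m then r 0 m * ?W M else 0)"
      proof (cases "l = m")
        case eq: True
        have "contract m ?W (M - {m}) = ?s m M * ?W M"
          using True by (simp add: contract_def sign_remove_self insert_absorb del: wedge.simps)
        then have "?s l M * r 0 l * contract m ?W (M - {l}) = ?s m M * (?s m M * (r 0 m * ?W M))"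
          using eq by (simp only: mult_ac)
        then show ?thesis using eq by (simp add: sign_square del: wedge.simps)
      qed (use True in \<open>auto simp: contract_def\<close>)
    qed simp
    also have "\<dots> = r 0 m * ?W M" using True Suc.prems by simp
    finally show ?thesis unfolding rhs using True by (simp add: contract_def del: wedge.simps)
  next
    case False
    have "contract m (wedge (Suc (Suc n)) r) M = ?s m M *
       (\<Sum>l\<in>insert m M. ?s l (insert m M) * r 0 l * ?W (insert m M - {l}))"
      using False unfolding contract_def by (simp only: wedge.simps(2)[of "Suc n"] if_False)
    also have "\<dots> = ?s m M * (?s m M * (r 0 m * ?W M)) +
        (\<Sum>l\<in>M. ?s m M * (?s l (insert m M) * r 0 l * ?W (insert m M - {l})))"
      using False Suc.prems
      by (simp add: sign_remove_self distrib_left sum_distrib_left mult_ac del: wedge.simps)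
    also have "(\<Sum>l\<in>M. ?s m M * (?s l (insert m M) * r 0 l * ?W (insert m M - {l}))) =
       (\<Sum>l\<in>M. - (?s l M * r 0 l * contract m ?W (M - {l})))"
    proof (rule sum.cong)
      fix l assume l: "l \<in> M"
      then have lm: "l \<noteq> m" using False by auto
      have e: "insert m M - {l} = insert m (M - {l})" using lm by auto
      have "?s m M = (if m < l then - 1 else 1) * ?s m (M - {l})"
        using sign_insert[of "M - {l}" l m, where 'a = 'a] Suc.prems l by (simp add: insert_absorb)
      moreover have "?s l (insert m M) = (if l < m then - 1 else 1) * ?s l M"
        using sign_insert[of M m l, where 'a = 'a] Suc.prems False by simp
      \<comment> \<open>Exactly one of \<open>m < l\<close> and \<open>l < m\<close> holds, which
        makes removing \<open>l\<close> and inserting \<open>m\<close> anticommute.\<close>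
      ultimately have "?s m M * ?s l (insert m M) = - (?s l M * ?s m (M - {l}))"
        using lm by (cases l m rule: linorder_cases) auto
      then have "?s m M * (?s l (insert m M) * r 0 l * ?W (insert m M - {l})) =
          - (?s l M * ?s m (M - {l})) * (r 0 l * ?W (insert m (M - {l})))"
        unfolding e by (simp only: mult.assoc[symmetric])
      then show "?s m M * (?s l (insert m M) * r 0 l * ?W (insert m M - {l})) =
        - (?s l M * r 0 l * contract m ?W (M - {l}))"
        using False by (simp only: contract_def) (simp add: mult_ac del: wedge.simps)
    qed simp
    finally show ?thesis unfolding rhs sign_square by (simp add: sum_negf del: wedge.simps)
  qed
qed

text \<open>Expanding the first row of \<open>A\<close> removes a column \<open>l\<close>, which
  contracts the minor of \<open>B\<close> by \<open>l\<close>. Expanding that contraction gives the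
  first-row Laplace expansion of the product matrix.\<close>

lemma cauchy_binet:
  assumes "finite U"
  shows "(\<Sum>M\<in>Pow U. wedge n A M * wedge n B M) = det (mat n n (\<lambda>(i, j). \<Sum>u\<in>U. A i u * B j u))"
proof (induction n arbitrary: A B)
  case 0
  have "(\<Sum>M\<in>Pow U. wedge 0 A M * wedge 0 B M) = (\<Sum>M\<in>Pow U. if M = {} then 1 else 0)"
    by (rule sum.cong) auto
  then show ?case using assms by simp
next
  case (Suc n)
  let ?s = "\<lambda>l M. (- 1 :: 'a) ^ card {k \<in> M. l < k}"
  let ?A = "\<lambda>i. A (Suc i)"
  have fin: "finite M" if "M \<in> Pow U" for M using that assms finite_subset by auto
  let ?D = "mat (Suc n) (Suc n) (\<lambda>(i, j). \<Sum>u\<in>U. A i u * B j u)"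
  have "(\<Sum>M\<in>Pow U. wedge (Suc n) A M * wedge (Suc n) B M) =
    (\<Sum>(M, l)\<in>Sigma (Pow U) (\<lambda>M. M). ?s l M * A 0 l * wedge n ?A (M - {l}) * wedge (Suc n) B M)"
    using assms fin by (subst sum.Sigma[symmetric]) (auto simp: sum_distrib_right)
  also have "\<dots> = (\<Sum>(T, l)\<in>Sigma (Pow U) (\<lambda>T. U - T). A 0 l * wedge n ?A T * contract l (wedge (Suc n) B) T)"
    by (rule sum.reindex_bij_witness[where i = "\<lambda>(T, l). (insert l T, l)" and j = "\<lambda>(M, l). (M - {l}, l)"])
      (auto simp: insert_absorb contract_def sign_remove_self mult_ac simp del: wedge.simps)
  \<comment> \<open>The contraction vanishes for \<open>l \<in> T\<close>, so \<open>l\<close> may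
    run over all of \<open>U\<close>; only then do the sums over \<open>T\<close> and
    \<open>l\<close> separate.\<close>
  also have "\<dots> = (\<Sum>T\<in>Pow U. \<Sum>l\<in>U. A 0 l * wedge n ?A T * contract l (wedge (Suc n) B) T)"
  proof -
    have "(\<Sum>(T, l)\<in>Sigma (Pow U) (\<lambda>T. U - T). A 0 l * wedge n ?A T * contract l (wedge (Suc n) B) T) =
        (\<Sum>T\<in>Pow U. \<Sum>l\<in>U - T. A 0 l * wedge n ?A T * contract l (wedge (Suc n) B) T)"
      using assms by (subst sum.Sigma) auto
    also have "\<dots> = (\<Sum>T\<in>Pow U. \<Sum>l\<in>U. A 0 l * wedge n ?A T * contract l (wedge (Suc n) B) T)"
    proof (rule sum.cong[OF refl])
      fix T
      show "(\<Sum>l\<in>U - T. A 0 l * wedge n ?A T * contract l (wedge (Suc n) B) T) =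
          (\<Sum>l\<in>U. A 0 l * wedge n ?A T * contract l (wedge (Suc n) B) T)"
        by (rule sum.mono_neutral_left) (use assms in \<open>auto simp: contract_def\<close>)
    qed
    finally show ?thesis .
  qed
  also have "\<dots> = (\<Sum>T\<in>Pow U. \<Sum>l\<in>U. \<Sum>j<Suc n. (- 1) ^ j * (A 0 l * B j l) *
      (wedge n ?A T * wedge n (\<lambda>i. B (insert_index j i)) T))"
    by (intro sum.cong refl) (simp only: contract_wedge[OF fin] sum_distrib_left mult_ac)
  also have "\<dots> = (\<Sum>j<Suc n. (- 1) ^ j * (\<Sum>l\<in>U. A 0 l * B j l) *
      (\<Sum>T\<in>Pow U. wedge n ?A T * wedge n (\<lambda>i. B (insert_index j i)) T))"
  proof -
    let ?f = "\<lambda>T l j. (- 1) ^ j * (A 0 l * B j l) * (wedge n ?A T * wedge n (\<lambda>i. B (insert_index j i)) T)"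
    have "(\<Sum>T\<in>Pow U. \<Sum>l\<in>U. \<Sum>j<Suc n. ?f T l j) = (\<Sum>T\<in>Pow U. \<Sum>j<Suc n. \<Sum>l\<in>U. ?f T l j)"
      by (intro sum.cong refl) (rule sum.swap)
    also have "\<dots> = (\<Sum>j<Suc n. \<Sum>T\<in>Pow U. \<Sum>l\<in>U. ?f T l j)"
      by (rule sum.swap)
    finally show ?thesis
      by (simp only: sum_distrib_left[symmetric] sum_distrib_right[symmetric])
  qed
  also have "\<dots> = (\<Sum>j<Suc n. ?D $$ (0, j) * cofactor ?D 0 j)"
  proof (rule sum.cong)
    fix j assume j: "j \<in> {..<Suc n}"
    show "(- 1) ^ j * (\<Sum>l\<in>U. A 0 l * B j l) *
      (\<Sum>T\<in>Pow U. wedge n ?A T * wedge n (\<lambda>i. B (insert_index j i)) T) = ?D $$ (0, j) * cofactor ?D 0 j"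
      unfolding Suc.IH cofactor_def mat_delete_mat using j by (simp add: mult_ac)
  qed simp
  also have "\<dots> = det ?D"
    by (rule laplace_expansion_row[symmetric]) auto
  finally show ?case .
qed

text \<open>By pigeonhole every permutation sends some row of \<open>I\<close> into
  \<open>J\<close>, so each term of the Leibniz formula has a zero factor.\<close>

lemma det_zero_block:
  fixes A :: "'a::comm_ring_1 mat"
  assumes A: "A \<in> carrier_mat n n" and I: "I \<subseteq> {..<n}" "J \<subseteq> {..<n}" "n < card I + card J"
    and zero: "\<And>i j. i \<in> I \<Longrightarrow> j \<in> J \<Longrightarrow> A $$ (i, j) = 0"
  shows "det A = 0"
proof -
  have "(\<Prod>i = 0..<n. A $$ (i, p i)) = 0" if p: "p permutes {0..<n}" for p
  proof -
    have inj: "inj_on p I" using p by (meson permutes_inj inj_on_subset subset_UNIV)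
    have sub: "p ` I \<subseteq> {..<n}" using I(1) permutes_in_image[OF p] by auto
    have "p ` I \<inter> J \<noteq> {}"
    proof
      assume "p ` I \<inter> J = {}"
      then have "card (p ` I \<union> J) = card I + card J"
        using I finite_subset[OF I(1)] finite_subset[OF I(2)]
        by (simp add: card_Un_disjoint card_image[OF inj])
      moreover have "card (p ` I \<union> J) \<le> card {..<n}"
        using sub I by (intro card_mono) auto
      ultimately show False using I(3) by simp
    qed
    then obtain i where "i \<in> I" "p i \<in> J" by auto
    then show ?thesis using I zero by (intro prod_zero) (auto intro!: bexI[of _ i])
  qed
  then show ?thesis by (simp add: det_def'[OF A])
qed

text \<open>Column operations replace the powers by the monic polynomials \<open>p j\<close> with
  roots at the later points \<open>x l\<close>. The change of basis is unitriangular and the matrix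
  of values is triangular.\<close>

lemma det_vandermonde:
  fixes x :: "nat \<Rightarrow> 'a::comm_ring_1"
  shows "det (mat n n (\<lambda>(i, j). x i ^ (n - Suc j))) = (\<Prod>(i, j) \<in> {(i, j). i < j \<and> j < n}. x i - x j)"
proof -
  define p where "p j = (\<Prod>l\<in>{j<..<n}. [:- x l, 1:])" for j
  have p: "degree (p j) \<le> n - Suc j \<and> coeff (p j) (n - Suc j) = 1" for j
  proof -
    have "degree (\<Prod>l\<in>L. [:- x l, 1:]) \<le> card L \<and> coeff (\<Prod>l\<in>L. [:- x l, 1:]) (card L) = 1"
      if "finite L" for L :: "nat set"
      using that
    proof (induction L rule: finite_induct)
      case (insert l L)
      let ?q = "\<Prod>l\<in>L. [:- x l, 1:]"
      have e: "(\<Prod>l\<in>insert l L. [:- x l, 1:]) = smult (- x l) ?q + pCons 0 ?q"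
        using insert by simp
      have "degree (smult (- x l) ?q + pCons 0 ?q) \<le> Suc (card L)"
        using insert.IH by (intro degree_add_le order.trans[OF degree_smult_le] order.trans[OF degree_pCons_le]) auto
      moreover have "coeff (smult (- x l) ?q + pCons 0 ?q) (Suc (card L)) = 1"
        using insert.IH by (simp add: coeff_eq_0)
      ultimately show ?case unfolding e using insert.hyps by simp
    qed simp
    from this[of "{j<..<n}"] show ?thesis by (simp add: p_def)
  qed
  have ev: "poly (p j) (x i) = (\<Sum>k<n. x i ^ (n - Suc k) * coeff (p j) (n - Suc k))" if "j < n" for i j
  proof -
    have "poly (p j) (x i) = (\<Sum>k<n. coeff (p j) k * x i ^ k)"
      unfolding poly_altdef using p[of j] that
      by (intro sum.mono_neutral_left) (auto simp: coeff_eq_0)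
    also have "\<dots> = (\<Sum>k<n. x i ^ (n - Suc k) * coeff (p j) (n - Suc k))"
      by (rule sum.reindex_bij_witness[where i = "\<lambda>k. n - Suc k" and j = "\<lambda>k. n - Suc k"]) (auto simp: mult.commute)
    finally show ?thesis .
  qed
  let ?V = "mat n n (\<lambda>(i, j). x i ^ (n - Suc j))"
  let ?T = "mat n n (\<lambda>(k, j). coeff (p j) (n - Suc k))"
  let ?U = "mat n n (\<lambda>(i, j). poly (p j) (x i))"
  have "?V * ?T = ?U"
    by (rule eq_matI) (auto simp: ev scalar_prod_def atLeast0LessThan)
  then have "det ?V * det ?T = det ?U"
    by (metis det_mult mat_carrier)
  moreover have "det ?T = 1"
  proof -
    have "det ?T = prod_list (diag_mat ?T)"
    proof (rule det_lower_triangular[of n])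
      fix k j assume "k < j" "j < n"
      then show "?T $$ (k, j) = 0" using p[of j] by (auto simp: intro!: coeff_eq_0)
    qed simp
    also have "\<dots> = 1" using p by (simp add: prod_list_diag_prod)
    finally show ?thesis .
  qed
  moreover have "det ?U = (\<Prod>(i, j) \<in> {(i, j). i < j \<and> j < n}. x i - x j)"
  proof -
    have "det ?U = prod_list (diag_mat ?U)"
    proof (rule det_upper_triangular)
      show "upper_triangular ?U"
        unfolding upper_triangular_def by (auto simp: p_def poly_prod intro!: prod_zero)
    qed auto
    also have "\<dots> = (\<Prod>i<n. \<Prod>j\<in>{i<..<n}. x i - x j)"
      by (simp add: prod_list_diag_prod p_def poly_prod atLeast0LessThan)
    also have "\<dots> = (\<Prod>(i, j) \<in> Sigma {..<n} (\<lambda>i. {i<..<n}). x i - x j)"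
      by (subst prod.Sigma) auto
    also have "Sigma {..<n} (\<lambda>i. {i<..<n}) = {(i, j). i < j \<and> j < n}" by auto
    finally show ?thesis .
  qed
  ultimately show ?thesis by simp
qed

section \<open>Currents\<close>

text \<open>Operators act on coefficient functions by pullback: at \<open>S\<close>, the
  \<open>j\<close>-th term of the current reads the vector at \<open>S\<close> with \<open>j\<close>
  replaced by \<open>j + m\<close>. These are the \<open>j\<close> for which that move
  exists.\<close>

definition movable :: "int \<Rightarrow> int set \<Rightarrow> int set" where
  "movable m S = {j \<in> S. j + m \<notin> S}"

lemma maya_bounds:
  assumes "maya S"
  obtains l u where "{..<l} \<subseteq> S" "S \<subseteq> {..u}"
proof
  let ?H = "{..<0} - S" let ?Q = "S \<inter> {0..}"
  have f: "finite ?H" "finite ?Q" using assms by (auto simp: maya_def)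
  show "{..<Min (insert 0 ?H)} \<subseteq> S"
  proof
    fix x assume x: "x \<in> {..<Min (insert 0 ?H)}"
    then have "x < 0" "x \<notin> ?H" using f by (auto simp: Min_gr_iff)
    then show "x \<in> S" by auto
  qed
  show "S \<subseteq> {..Max (insert 0 ?Q)}"
  proof
    fix x assume "x \<in> S"
    then show "x \<in> {..Max (insert 0 ?Q)}" using f by (cases "x \<ge> 0") (auto simp: Max_ge_iff)
  qed
qed

lemma finite_movable: "maya S \<Longrightarrow> m \<noteq> 0 \<Longrightarrow> finite (movable m S)"
proof -
  assume "maya S" "m \<noteq> 0"
  then obtain l u where lu: "{..<l} \<subseteq> S" "S \<subseteq> {..u}" by (metis maya_bounds)
  have "movable m S \<subseteq> {l - \<bar>m\<bar>..u}"
  proof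
    fix j assume "j \<in> movable m S"
    then have "j \<in> S" "j + m \<notin> S" by (auto simp: movable_def)
    then have "\<not> j + m < l" "j \<le> u" using lu by auto
    then show "j \<in> {l - \<bar>m\<bar>..u}" by auto
  qed
  then show ?thesis using finite_subset by blast
qed

lemma hop_eq:
  assumes "m \<noteq> 0"
  shows "psi j (psi_star (j + m) v) S = (if j \<in> movable m S
    then above_sign j S * (above_sign (j + m) (S - {j}) * v (insert (j + m) (S - {j}))) else 0)"
  using assms by (auto simp: psi_def psi_star_def movable_def)

lemma current_eq:
  assumes "m \<noteq> 0" "maya S" "finite A" "movable m S \<subseteq> A"
  shows "current m v S = (\<Sum>j\<in>A. psi j (psi_star (j + m) v) S)"
  unfolding current_def
  by (rule Sum_any.expand_superset) (use assms in \<open>auto simp: hop_eq\<close>)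

lemma current_not_maya:
  assumes "v \<in> fock" "\<not> maya S" "m \<noteq> 0"
  shows "current m v S = 0"
  using assms by (simp add: current_def hop_eq fock_zero[OF assms(1)] cong: if_cong)

section \<open>Weight and charge of a Maya diagram, normalised to 0 on the vacuum\<close>

definition wt :: "int set \<Rightarrow> int" where
  "wt S = \<Sum>(S \<inter> {0..}) - \<Sum>({..<0} - S)"

definition charge :: "int set \<Rightarrow> int" where
  "charge S = int (card (S \<inter> {0..})) - int (card ({..<0} - S))"

lemma wt_charge_insert:
  assumes "maya S" "n \<notin> S"
  shows "wt (insert n S) = wt S + n" "charge (insert n S) = charge S + 1"
proof -
  have f: "finite (S \<inter> {0..})" "finite ({..<0} - S)" using assms by (auto simp: maya_def)
  have "wt (insert n S) = wt S + n \<and> charge (insert n S) = charge S + 1"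
  proof (cases "n \<ge> 0")
    case True
    then have "insert n S \<inter> {0..} = insert n (S \<inter> {0..})" "{..<0} - insert n S = {..<0} - S" by auto
    then show ?thesis using f assms by (simp add: wt_def charge_def)
  next
    case False
    define H where "H = {..<0} - insert n S"
    have "insert n S \<inter> {0..} = S \<inter> {0..}" "{..<0} - S = insert n H" "n \<notin> H"
      using assms False by (auto simp: H_def)
    then show ?thesis using f by (simp add: wt_def charge_def H_def[symmetric])
  qed
  then show "wt (insert n S) = wt S + n" "charge (insert n S) = charge S + 1" by auto
qed

lemma wt_charge_remove:
  assumes "maya S" "n \<in> S"
  shows "wt (S - {n}) = wt S - n" "charge (S - {n}) = charge S - 1"
  using wt_charge_insert[of "S - {n}" n] assms by (auto simp: insert_absorb)

lemma wt_bounds: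
  assumes "maya S"
  shows "S \<inter> {0..} \<subseteq> {0..wt S}" "{..<0} - S \<subseteq> {- wt S..<0}"
proof -
  have f: "finite (S \<inter> {0..})" "finite ({..<0} - S)" using assms by (auto simp: maya_def)
  have p: "0 \<le> \<Sum>(S \<inter> {0..})" by (rule sum_nonneg) auto
  have q: "\<Sum>({..<0} - S) \<le> 0" by (rule sum_nonpos) auto
  show "S \<inter> {0..} \<subseteq> {0..wt S}"
  proof
    fix x assume x: "x \<in> S \<inter> {0..}"
    then have "x \<le> \<Sum>(S \<inter> {0..})"
      by (intro member_le_sum[of x "S \<inter> {0..}" "\<lambda>x. x"]) (use f in auto)
    then have "x \<le> wt S" using q by (simp add: wt_def)
    then show "x \<in> {0..wt S}" using x by simp
  qed
  show "{..<0} - S \<subseteq> {- wt S..<0}"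
  proof
    fix x assume x: "x \<in> {..<0} - S"
    then have "- x \<le> (\<Sum>x\<in>{..<0} - S. - x)"
      by (intro member_le_sum[of x "{..<0} - S" "\<lambda>x. - x"]) (use f in auto)
    then have "- wt S \<le> x" using p by (simp add: wt_def sum_negf)
    then show "x \<in> {- wt S..<0}" using x by simp
  qed
qed

text \<open>Particles and holes both contribute nonnegatively to \<open>wt\<close>, so a bound on
  the weight confines both to finite intervals. This is the source of finiteness for
  \<open>reach\<close> and \<open>parts\<close>.\<close>

lemma finite_maya_wt: "finite {T. maya T \<and> wt T \<le> w}"
proof -
  let ?f = "\<lambda>T::int set. (T \<inter> {0..}, {..<0} - T)"
  have "inj ?f"
  proof (rule injI)
    fix S T assume "?f S = ?f T"
    then have "S \<inter> {0..} \<union> ({..<0} - ({..<0} - S)) = T \<inter> {0..} \<union> ({..<0} - ({..<0} - T))" by simp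
    moreover have "U \<inter> {0..} \<union> ({..<0} - ({..<0} - U)) = U" for U :: "int set" by auto
    ultimately show "S = T" by simp
  qed
  moreover have "?f ` {T. maya T \<and> wt T \<le> w} \<subseteq> Pow {0..w} \<times> Pow {- w..<0}"
  proof -
    have "T \<inter> {0..} \<subseteq> {0..w}" "{..<0} - T \<subseteq> {- w..<0}" if "maya T" "wt T \<le> w" for T
    proof -
      have "{0..wt T} \<subseteq> {0..w}" "{- wt T..<0} \<subseteq> {- w..<0}" using that(2) by simp_all
      then show "T \<inter> {0..} \<subseteq> {0..w}" "{..<0} - T \<subseteq> {- w..<0}"
        using wt_bounds[OF that(1)] by (meson order.trans)+
    qed
    then show ?thesis by blast
  qed
  then have "finite (?f ` {T. maya T \<and> wt T \<le> w})"
    by (rule finite_subset) simp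
  ultimately show ?thesis
    by (meson finite_imageD inj_on_subset subset_UNIV)
qed

text \<open>The diagrams that a product of currents of total degree \<open>a\<close>, all of the same sign, can move
  to \<open>S\<close>.\<close>

definition reach :: "int \<Rightarrow> int set \<Rightarrow> int set set" where
  "reach a S = {T. maya T \<and> wt T = wt S + a \<and> charge T = charge S \<and>
     (\<forall>l. {..<l} \<subseteq> S \<longrightarrow> {..<l - max 0 a} \<subseteq> T)}"

lemma reach_maya: "T \<in> reach a S \<Longrightarrow> maya T"
  by (simp add: reach_def)

lemma finite_reach: "finite (reach a S)"
  by (rule finite_subset[OF _ finite_maya_wt[of "wt S + a"]]) (auto simp: reach_def)

lemma reach_refl: "maya S \<Longrightarrow> S \<in> reach 0 S"
  by (simp add: reach_def)

text \<open>The condition on absolute values says that \<open>a\<close> and \<open>b\<close> do not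
  have opposite signs; then the losses \<open>max 0 a\<close> and \<open>max 0 b\<close> at the
  bottom of the sea add up.\<close>

lemma reach_trans:
  assumes "T \<in> reach a S" "U \<in> reach b T" "\<bar>a + b\<bar> = \<bar>a\<bar> + \<bar>b\<bar>"
  shows "U \<in> reach (a + b) S"
proof -
  have "{..<l - max 0 (a + b)} \<subseteq> U" if "{..<l} \<subseteq> S" for l
  proof -
    have "{..<l - max 0 a} \<subseteq> T" using that assms by (simp add: reach_def)
    then have "{..<l - max 0 a - max 0 b} \<subseteq> U" using assms by (simp add: reach_def)
    moreover have "max 0 (a + b) = max 0 a + max 0 b" using assms(3) by linarith
    ultimately show ?thesis by (simp add: algebra_simps)
  qed
  then show ?thesis using assms by (auto simp: reach_def)
qed

text \<open>The new site \<open>j + m\<close> was empty, hence at or above \<open>l\<close>, so the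
  vacated site \<open>j\<close> is at least \<open>l - m\<close>. For negative \<open>m\<close> the
  filled sea stays intact, which is what makes windows usable for \<Theta>.\<close>

lemma movable_reach:
  assumes "maya S" "m \<noteq> 0" "j \<in> movable m S"
  shows "insert (j + m) (S - {j}) \<in> reach m S"
proof -
  have j: "j \<in> S" "j + m \<notin> S - {j}" "j + m \<notin> S" using assms by (auto simp: movable_def)
  have "{..<l - max 0 m} \<subseteq> insert (j + m) (S - {j})" if "{..<l} \<subseteq> S" for l
  proof -
    have "\<not> j + m < l" using j that by auto
    then show ?thesis using that by auto
  qed
  then show ?thesis
    using wt_charge_insert[of "S - {j}" "j + m"] wt_charge_remove[of S j] j assms
    by (auto simp: reach_def)
qed

text \<open>Locality: at \<open>S\<close> a current reads only finitely many coefficients. This is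
  how infinite or truncated sums inside an operator are exchanged for finite ones.\<close>

lemma current_agree:
  assumes "maya S" "m \<noteq> 0" "\<And>T. T \<in> reach m S \<Longrightarrow> v T = w T"
  shows "current m v S = current m w S"
  using assms movable_reach
  by (auto simp: current_eq[OF _ _ finite_movable subset_refl] hop_eq intro!: sum.cong)

section \<open>Linearity of the currents and their commutation relations\<close>

lemma psi_sum: "psi n (\<lambda>T. \<Sum>i\<in>I. c i * v i T) S = (\<Sum>i\<in>I. c i * psi n (v i) S)"
  by (simp add: psi_def sum_distrib_left mult_ac when_def)

lemma psi_star_sum: "psi_star n (\<lambda>T. \<Sum>i\<in>I. c i * v i T) = (\<lambda>S. \<Sum>i\<in>I. c i * psi_star n (v i) S)"
  by (rule ext) (simp add: psi_star_def sum_distrib_left mult_ac when_def)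

lemma current_sum:
  assumes "maya S" "m \<noteq> 0"
  shows "current m (\<lambda>T. \<Sum>i\<in>I. c i * v i T) S = (\<Sum>i\<in>I. c i * current m (v i) S)"
proof -
  have "current m (\<lambda>T. \<Sum>i\<in>I. c i * v i T) S =
      (\<Sum>j\<in>movable m S. \<Sum>i\<in>I. c i * psi j (psi_star (j + m) (v i)) S)"
    using assms by (simp add: current_eq[OF _ _ finite_movable subset_refl] psi_star_sum psi_sum)
  then show ?thesis
    using assms by (subst (asm) sum.swap)
      (simp add: current_eq[OF _ _ finite_movable subset_refl] sum_distrib_left)
qed

lemma current_scale:
  "maya S \<Longrightarrow> m \<noteq> 0 \<Longrightarrow> current m (\<lambda>T. c * v T) S = c * current m v S"
  using current_sum[where I = "{()}" and c = "\<lambda>_. c" and v = "\<lambda>_. v"] by simp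

lemma current_zero: "m \<noteq> 0 \<Longrightarrow> current m (\<lambda>T. 0) S = 0"
  by (simp add: current_def hop_eq cong: if_cong)

lemma psi_diff: "psi n (\<lambda>T. v T - w T) S = psi n v S - psi n w S"
  by (simp add: psi_def when_def right_diff_distrib)

lemma psi_neg: "psi n (\<lambda>T. - v T) S = - psi n v S"
  by (simp add: psi_def when_def)

text \<open>This is \<open>[a\<^sub>m, \<psi>\<^sub>n] = \<psi>\<^sub>n\<^sub>-\<^sub>m\<close>:
  among the terms of the current only \<open>j = n - m\<close> fails to commute with the
  fermion.\<close>

lemma current_psi:
  assumes v: "v \<in> fock" and S: "maya S" and m: "m \<noteq> 0"
  shows "current m (psi n v) S = psi n (current m v) S + psi (n - m) v S"
proof -
  define A where "A = movable m S \<union> movable m (S - {n}) \<union> {n - m}"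
  have A: "finite A" using finite_movable[OF _ m] S by (simp add: A_def)
  have "psi j (psi_star (j + m) (psi n v)) S =
      psi n (psi j (psi_star (j + m) v)) S + (if j = n - m then psi (n - m) v S else 0)" for j
  proof -
    have e: "psi_star (j + m) (psi n v) = (\<lambda>T. (v T when n = j + m) - psi n (psi_star (j + m) v) T)"
      by (rule ext, subst eq_diff_eq, subst add.commute) (rule car_psi_psi_star[OF v])
    have "psi j (psi_star (j + m) (psi n v)) S =
        psi j (\<lambda>T. v T when n = j + m) S - psi j (psi n (psi_star (j + m) v)) S"
      unfolding e by (rule psi_diff)
    also have "psi j (psi n (psi_star (j + m) v)) S = - psi n (psi j (psi_star (j + m) v)) S"
      using car_psi_psi[OF psi_star_fock[OF v], of j n "j + m" S] by (simp add: eq_neg_iff_add_eq_0)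
    also have "psi j (\<lambda>T. v T when n = j + m) S = (if j = n - m then psi (n - m) v S else 0)"
      by (auto simp: psi_def)
    finally show ?thesis by simp
  qed
  moreover have "current m (psi n v) S = (\<Sum>j\<in>A. psi j (psi_star (j + m) (psi n v)) S)"
    by (rule current_eq[OF m S A]) (auto simp: A_def)
  moreover have "n - m \<in> A" by (simp add: A_def)
  ultimately have "current m (psi n v) S = (\<Sum>j\<in>A. psi n (psi j (psi_star (j + m) v)) S) + psi (n - m) v S"
    using A by (simp add: sum.distrib)
  also have "(\<Sum>j\<in>A. psi n (psi j (psi_star (j + m) v)) S) = psi n (current m v) S"
  proof -
    have "current m v (S - {n}) = (\<Sum>j\<in>A. psi j (psi_star (j + m) v) (S - {n}))"
      using S by (intro current_eq[OF m _ A]) (auto simp: A_def)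
    then show ?thesis by (simp add: psi_def[of n] when_def sum_distrib_left)
  qed
  finally show ?thesis .
qed

text \<open>The dual relation, where only the term \<open>j = n\<close> fails to commute.\<close>

lemma current_psi_star:
  assumes v: "v \<in> fock" and S: "maya S" and m: "m \<noteq> 0"
  shows "current m (psi_star n v) S = psi_star n (current m v) S - psi_star (n + m) v S"
proof -
  define A where "A = movable m S \<union> movable m (insert n S) \<union> {n}"
  have A: "finite A" using finite_movable[OF _ m] S by (simp add: A_def)
  have "psi j (psi_star (j + m) (psi_star n v)) S =
      psi_star n (psi j (psi_star (j + m) v)) S - (if j = n then psi_star (n + m) v S else 0)" for j
  proof -
    have e: "psi_star (j + m) (psi_star n v) = (\<lambda>T. - psi_star n (psi_star (j + m) v) T)"
      by (rule ext, subst eq_neg_iff_add_eq_0) (rule car_psi_star_psi_star[OF v])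
    have "psi j (psi_star (j + m) (psi_star n v)) S = - psi j (psi_star n (psi_star (j + m) v)) S"
      unfolding e by (rule psi_neg)
    also have "psi j (psi_star n (psi_star (j + m) v)) S =
        (psi_star (j + m) v S when j = n) - psi_star n (psi j (psi_star (j + m) v)) S"
      using car_psi_psi_star[OF psi_star_fock[OF v], of j n "j + m" S] by (simp add: eq_diff_eq)
    finally show ?thesis by simp
  qed
  moreover have "current m (psi_star n v) S = (\<Sum>j\<in>A. psi j (psi_star (j + m) (psi_star n v)) S)"
    by (rule current_eq[OF m S A]) (auto simp: A_def)
  moreover have "n \<in> A" by (simp add: A_def)
  ultimately have "current m (psi_star n v) S =
      (\<Sum>j\<in>A. psi_star n (psi j (psi_star (j + m) v)) S) - psi_star (n + m) v S"
    using A by (simp add: sum_subtractf)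
  also have "(\<Sum>j\<in>A. psi_star n (psi j (psi_star (j + m) v)) S) = psi_star n (current m v) S"
  proof -
    have "current m v (insert n S) = (\<Sum>j\<in>A. psi j (psi_star (j + m) v) (insert n S))"
      using S by (intro current_eq[OF m _ A]) (auto simp: A_def)
    then show ?thesis by (simp add: psi_star_def[of n] when_def sum_distrib_left)
  qed
  finally show ?thesis .
qed

text \<open>Moving one current through the terms of the other leaves two sums for
  \<open>a\<^sub>m\<^sub>+\<^sub>n\<close> with opposite signs and shifted ranges. For
  \<open>m + n \<noteq> 0\<close> both are effectively finite and cancel; the excluded case carries
  the central term.\<close>

lemma current_commute:
  assumes v: "v \<in> fock" and S: "maya S" and mn: "m \<noteq> 0" "n \<noteq> 0" "m + n \<noteq> 0"
  shows "current n (current m v) S = current m (current n v) S"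
proof -
  define B where "B = movable m S \<union> (\<Union>T\<in>reach n S. movable m T) \<union> movable (m + n) S"
  \<comment> \<open>Adding the translate of \<open>B\<close> ensures that \<open>A\<close> shifted
    down by \<open>n\<close> still contains every contributing index.\<close>
  define A where "A = B \<union> (\<lambda>j. j + n) ` B"
  have B: "finite B"
    using finite_movable mn S finite_reach by (auto simp: B_def reach_def)
  then have A: "finite A" by (simp add: A_def)
  have "current n (current m v) S = current n (\<lambda>T. \<Sum>j\<in>A. 1 * psi j (psi_star (j + m) v) T) S"
  proof (rule current_agree[OF S mn(2)])
    fix T assume T: "T \<in> reach n S"
    then have "maya T" by (simp add: reach_def)
    with T show "current m v T = (\<Sum>j\<in>A. 1 * psi j (psi_star (j + m) v) T)"
      using current_eq[OF mn(1) _ A, of T v] by (auto simp: A_def B_def)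
  qed
  also have "\<dots> = (\<Sum>j\<in>A. current n (psi j (psi_star (j + m) v)) S)"
    unfolding current_sum[OF S mn(2)] by simp
  also have "\<dots> = (\<Sum>j\<in>A. psi j (psi_star (j + m) (current n v)) S
     - psi j (psi_star (j + (m + n)) v) S + psi (j - n) (psi_star (j + m) v) S)"
  proof (rule sum.cong[OF refl])
    fix j
    have w: "psi_star (j + m) v \<in> fock" using v by (rule psi_star_fock)
    have "psi j (current n (psi_star (j + m) v)) S =
       psi j (\<lambda>T. psi_star (j + m) (current n v) T - psi_star (j + (m + n)) v T) S"
      using S by (auto simp: psi_def when_def current_psi_star[OF v _ mn(2)] add.assoc)
    then show "current n (psi j (psi_star (j + m) v)) S = psi j (psi_star (j + m) (current n v)) S
     - psi j (psi_star (j + (m + n)) v) S + psi (j - n) (psi_star (j + m) v) S"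
      by (simp add: current_psi[OF w S mn(2)] psi_diff)
  qed
  also have "\<dots> = (\<Sum>j\<in>A. psi j (psi_star (j + m) (current n v)) S)
     - (\<Sum>j\<in>A. psi j (psi_star (j + (m + n)) v) S) + (\<Sum>j\<in>A. psi (j - n) (psi_star (j + m) v) S)"
    by (simp add: sum.distrib sum_subtractf)
  also have "(\<Sum>j\<in>A. psi j (psi_star (j + m) (current n v)) S) = current m (current n v) S"
    by (rule current_eq[symmetric, OF mn(1) S A]) (auto simp: A_def B_def)
  also have "(\<Sum>j\<in>A. psi j (psi_star (j + (m + n)) v) S) = current (m + n) v S"
    by (rule current_eq[symmetric, OF mn(3) S A]) (auto simp: A_def B_def)
  also have "(\<Sum>j\<in>A. psi (j - n) (psi_star (j + m) v) S) =
      (\<Sum>j\<in>(\<lambda>j. j - n) ` A. psi j (psi_star (j + (m + n)) v) S)"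
    by (subst sum.reindex) (auto simp: inj_on_def algebra_simps)
  also have "\<dots> = current (m + n) v S"
  proof (rule current_eq[symmetric, OF mn(3) S])
    have "B \<subseteq> (\<lambda>j. j - n) ` A"
    proof
      fix x assume "x \<in> B"
      then have "x + n \<in> A" by (simp add: A_def)
      then show "x \<in> (\<lambda>j. j - n) ` A" by (intro image_eqI[of _ _ "x + n"]) auto
    qed
    then show "movable (m + n) S \<subseteq> (\<lambda>j. j - n) ` A" by (auto simp: B_def)
  qed (use A in auto)
  finally show ?thesis by simp
qed

section \<open>Graded exponentials of currents\<close>

definition dec :: "'m::cancel_comm_monoid_add \<Rightarrow> ('m \<times> 'm) set" where
  "dec c = {(a, b). a + b = c}"

lemma mem_dec [simp]: "(a, b) \<in> dec c \<longleftrightarrow> a + b = c"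
  by (simp add: dec_def)

lemma dec_swap: "(\<Sum>(a, b)\<in>dec c. f a b) = (\<Sum>(a, b)\<in>dec c. f b a)"
  by (rule sum.reindex_bij_witness[where i = prod.swap and j = prod.swap]) (auto simp: add.commute)

lemma sum_dec_cong:
  "(\<And>a b. a + b = c \<Longrightarrow> f a b = g a b) \<Longrightarrow> (\<Sum>(a, b)\<in>dec c. f a b) = (\<Sum>(a, b)\<in>dec c. g a b)"
  by (rule sum.cong) auto

lemma dec_sum_left: "x * (\<Sum>(a, b)\<in>dec c. f a b) = (\<Sum>(a, b)\<in>dec c. x * f a b :: 'a::semiring_0)"
  by (simp add: sum_distrib_left split_def)

lemma dec_sum_add:
  "(\<Sum>(a, b)\<in>dec c. f a b) + (\<Sum>(a, b)\<in>dec c. g a b) = (\<Sum>(a, b)\<in>dec c. f a b + g a b)"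
  by (simp add: sum.distrib split_def)

text \<open>\<open>Q\<close> is the convolution exponential of \<open>P\<close>, characterised by the Euler derivation. Instances:
  \<open>e\<^sup>\<Theta>\<close> (\<open>e = -1\<close>) and \<open>e\<^sup>-\<^sup>\<theta>\<close> (\<open>e = 1\<close>), both graded by \<open>nat\<close>, and \<open>e\<^sup>H\<close> (\<open>e = 1\<close>), graded by monomials.\<close>

locale graded =
  fixes deg :: "'m::cancel_comm_monoid_add \<Rightarrow> nat" and P Q :: "'m \<Rightarrow> scalar" and e :: int
  assumes deg_add: "deg (a + b) = deg a + deg b"
    and deg_eq_0: "deg a = 0 \<longleftrightarrow> a = 0"
    and finite_dec: "finite (dec c)"
    and P_0: "P 0 = 0"
    and Q_0: "Q 0 = 1"
    and Q_rec: "of_nat (deg c) * Q c = (\<Sum>(a, b)\<in>dec c. of_nat (deg a) * P a * Q b)"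
    and e_cases: "e = 1 \<or> e = - 1"
begin

lemma sum_dec_assoc:
  fixes z :: 'm
  shows "(\<Sum>(a, d)\<in>dec z. \<Sum>(b, c)\<in>dec d. f a b c) = (\<Sum>(d, c)\<in>dec z. \<Sum>(a, b)\<in>dec d. f a b c)"
proof -
  have "(\<Sum>(a, d)\<in>dec z. \<Sum>(b, c)\<in>dec d. f a b c) =
      (\<Sum>((a, d), (b, c))\<in>Sigma (dec z) (\<lambda>(a, d). dec d). f a b c)"
    unfolding split_def by (subst sum.Sigma) (auto simp: finite_dec split_def)
  also have "\<dots> = (\<Sum>((d, c), (a, b))\<in>Sigma (dec z) (\<lambda>(d, c). dec d). f a b c)"
    by (rule sum.reindex_bij_witness[where
        i = "\<lambda>((d, c), (a, b)). ((a, b + c), (b, c))" and j = "\<lambda>((a, d), (b, c)). ((a + b, c), (a, b))"])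
      (auto simp: add.assoc)
  also have "\<dots> = (\<Sum>(d, c)\<in>dec z. \<Sum>(a, b)\<in>dec d. f a b c)"
    unfolding split_def by (subst sum.Sigma) (auto simp: finite_dec split_def)
  finally show ?thesis .
qed

lemma sum_dec_commute:
  fixes z :: 'm
  shows "(\<Sum>(a, d)\<in>dec z. \<Sum>(b, c)\<in>dec d. f a b c) = (\<Sum>(b, d)\<in>dec z. \<Sum>(a, c)\<in>dec d. f a b c)"
proof -
  have "(\<Sum>(d, c)\<in>dec z. \<Sum>(a, b)\<in>dec d. f a b c) = (\<Sum>(d, c)\<in>dec z. \<Sum>(b, a)\<in>dec d. f a b c)"
    by (intro sum.cong refl) (auto intro: dec_swap)
  then show ?thesis
    unfolding sum_dec_assoc sum_dec_assoc[of "\<lambda>b a c. f a b c"] .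
qed

lemma deg_0 [simp]: "deg 0 = 0"
  by (simp add: deg_eq_0)

lemma e_nz: "a \<noteq> 0 \<Longrightarrow> e * int (deg a) \<noteq> 0"
  using e_cases deg_eq_0[of a] by auto

abbreviation cur :: "'m \<Rightarrow> vec \<Rightarrow> vec" where
  "cur a \<equiv> current (e * int (deg a))"

text \<open>The exponent acting on a vector-valued formal series: convolution with \<open>P\<close>,
  each degree \<open>a\<close> being paired with a current of mode
  \<open>e * int (deg a)\<close>.\<close>

definition Hop :: "('m \<Rightarrow> vec) \<Rightarrow> 'm \<Rightarrow> vec" where
  "Hop V c = (\<lambda>S. \<Sum>(a, b)\<in>dec c. P a * cur a (V b) S)"

text \<open>The commutator of the degree operator with \<open>Hop\<close>, see
  \<open>deg_Hop\<close>.\<close>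

definition Hop' :: "('m \<Rightarrow> vec) \<Rightarrow> 'm \<Rightarrow> vec" where
  "Hop' V c = (\<lambda>S. \<Sum>(a, b)\<in>dec c. (of_nat (deg a) * P a) * cur a (V b) S)"

definition Ini :: "vec \<Rightarrow> 'm \<Rightarrow> vec" where
  "Ini v c = (if c = 0 then v else (\<lambda>S. 0))"

text \<open>The degree-\<open>c\<close> part of the exponential of \<open>Hop\<close> on a constant
  series. Stopping at \<open>deg c\<close> loses nothing on Maya diagrams, because
  \<open>P 0 = 0\<close> makes each \<open>Hop\<close> raise the degree.\<close>

definition E :: "'m \<Rightarrow> vec \<Rightarrow> vec" where
  "E c v = (\<lambda>S. \<Sum>k\<le>deg c. (Hop ^^ k) (Ini v) c S / of_nat (fact k))"

lemma zero_fock: "(\<lambda>S. 0) \<in> fock"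
  by (simp add: fock_def)

lemma Ini_fock: "v \<in> fock \<Longrightarrow> Ini v c \<in> fock"
  by (simp add: Ini_def zero_fock)

lemma P_cur_fock: "v \<in> fock \<Longrightarrow> \<not> maya S \<Longrightarrow> P a * cur a v S = 0"
  using current_not_maya[OF _ _ e_nz] P_0 by (cases "a = 0") auto

lemma Hop_fock: "(\<And>c. V c \<in> fock) \<Longrightarrow> Hop V c \<in> fock"
proof -
  assume V: "\<And>c. V c \<in> fock"
  have "Hop V c S = 0" if "\<not> maya S" for S
    unfolding Hop_def by (rule sum.neutral) (auto simp: P_cur_fock[OF V that])
  then show ?thesis by (auto simp: fock_def)
qed

lemma pow_fock: "v \<in> fock \<Longrightarrow> (Hop ^^ k) (Ini v) c \<in> fock"
  by (induction k arbitrary: c) (auto simp: Ini_fock Hop_fock)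

lemma Hop_cong:
  assumes "maya S" "\<And>b T. maya T \<Longrightarrow> V b T = W b T"
  shows "Hop V c S = Hop W c S"
  unfolding Hop_def
proof (rule sum_dec_cong)
  fix a b
  show "P a * cur a (V b) S = P a * cur a (W b) S"
  proof (cases "a = 0")
    case False
    have "cur a (V b) S = cur a (W b) S"
      using assms by (intro current_agree e_nz False) (auto simp: reach_def)
    then show ?thesis by simp
  qed (simp add: P_0)
qed

lemma Hop_pow_0:
  assumes "maya S" "deg c < k"
  shows "(Hop ^^ k) (Ini v) c S = 0"
  using assms
proof (induction k arbitrary: c S)
  case (Suc k)
  have *: "P a * cur a ((Hop ^^ k) (Ini v) b) S = 0" if "a + b = c" for a b
  proof (cases "a = 0")
    case False
    then have "deg b < k" using Suc.prems that deg_eq_0[of a] by (auto simp: deg_add)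
    then have "cur a ((Hop ^^ k) (Ini v) b) S = cur a (\<lambda>S. 0) S"
      using Suc.prems by (intro current_agree e_nz False Suc.IH) (auto simp: reach_def)
    then show ?thesis by (simp add: current_zero[OF e_nz[OF False]])
  qed (simp add: P_0)
  have "Hop ((Hop ^^ k) (Ini v)) c S = 0"
    unfolding Hop_def[of "(Hop ^^ k) (Ini v)"] by (rule sum.neutral) (use * in auto)
  then show ?case by simp
qed simp

lemma E_eq:
  assumes "maya S" "deg c \<le> K"
  shows "E c v S = (\<Sum>k\<le>K. (Hop ^^ k) (Ini v) c S / of_nat (fact k))"
  unfolding E_def using assms by (intro sum.mono_neutral_left) (auto simp: Hop_pow_0)

lemma E_fock: "v \<in> fock \<Longrightarrow> E c v \<in> fock"
proof -
  assume v: "v \<in> fock"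
  have "E c v S = 0" if "\<not> maya S" for S
    using fock_zero[OF pow_fock[OF v] that] by (simp add: E_def)
  then show ?thesis by (auto simp: fock_def)
qed

lemma Hop_scale:
  assumes "maya S"
  shows "Hop (\<lambda>b T. x * V b T) c S = x * Hop V c S"
  unfolding Hop_def dec_sum_left
proof (rule sum_dec_cong)
  fix a b
  show "P a * cur a (\<lambda>T. x * V b T) S = x * (P a * cur a (V b) S)"
    using current_scale[OF assms e_nz, of a x "V b"] P_0 by (cases "a = 0") auto
qed

lemma deg_Hop:
  assumes "maya S"
  shows "of_nat (deg c) * Hop V c S = Hop (\<lambda>b T. of_nat (deg b) * V b T) c S + Hop' V c S"
  unfolding Hop_def Hop'_def dec_sum_left dec_sum_add
proof (rule sum_dec_cong)
  fix a b assume c: "a + b = c"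
  show "of_nat (deg c) * (P a * cur a (V b) S) =
    P a * cur a (\<lambda>T. of_nat (deg b) * V b T) S + of_nat (deg a) * P a * cur a (V b) S"
    using current_scale[OF assms e_nz, of a "of_nat (deg b)" "V b"] P_0
    by (cases "a = 0") (auto simp: c[symmetric] deg_add algebra_simps)
qed

text \<open>All modes have the sign of \<open>e\<close>, so two nonzero ones never sum to 0 and
  \<open>current_commute\<close> applies; a summand with a zero degree is killed by
  \<open>P 0 = 0\<close>.\<close>

lemma Hop_Hop':
  assumes V: "\<And>b. V b \<in> fock" and S: "maya S"
  shows "Hop (Hop' V) c S = Hop' (Hop V) c S"
proof -
  have lin: "x a * cur a (\<lambda>S. \<Sum>(b, d)\<in>dec d. y b * cur b (V d) S) S =
      (\<Sum>(b, d)\<in>dec d. x a * y b * cur a (cur b (V d)) S)" if "x 0 = 0" for x y a d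
  proof (cases "a = 0")
    case False
    show ?thesis
      using current_sum[OF S e_nz[OF False], of "\<lambda>p. y (fst p)" "\<lambda>p. cur (fst p) (V (snd p))" "dec d"]
      by (simp add: split_def sum_distrib_left mult.assoc)
  qed (simp add: that)
  have "Hop (Hop' V) c S =
      (\<Sum>(a, d)\<in>dec c. \<Sum>(b, d)\<in>dec d. P a * (of_nat (deg b) * P b) * cur a (cur b (V d)) S)"
    unfolding Hop_def Hop'_def
    by (intro sum_dec_cong) (auto simp: lin[of P] P_0)
  also have "\<dots> = (\<Sum>(a, d)\<in>dec c. \<Sum>(b, d)\<in>dec d. P b * (of_nat (deg a) * P a) * cur b (cur a (V d)) S)"
    by (rule sum_dec_commute)
  also have "\<dots> = (\<Sum>(a, d)\<in>dec c. \<Sum>(b, d)\<in>dec d. (of_nat (deg a) * P a) * P b * cur a (cur b (V d)) S)"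
  proof (intro sum_dec_cong)
    fix a b d
    have "cur b (cur a (V d)) S = cur a (cur b (V d)) S" if "a \<noteq> 0" "b \<noteq> 0"
      using e_cases deg_eq_0[of a] deg_eq_0[of b] that by (intro current_commute V S) auto
    then show "P b * (of_nat (deg a) * P a) * cur b (cur a (V d)) S =
      of_nat (deg a) * P a * P b * cur a (cur b (V d)) S"
      using P_0 by (cases "a = 0 \<or> b = 0") (auto simp: mult_ac)
  qed
  also have "\<dots> = Hop' (Hop V) c S"
    unfolding Hop_def Hop'_def
    by (intro sum_dec_cong) (auto simp: lin[of "\<lambda>a. of_nat (deg a) * P a"])
  finally show ?thesis .
qed

text \<open>The rule for differentiating a power; it needs the commutation of \<open>Hop\<close>
  with its derivative. For \<open>k = 0\<close> the truncated \<open>k - 1\<close> is harmless,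
  since the factor \<open>of_nat k\<close> is 0.\<close>

lemma deg_pow:
  assumes v: "v \<in> fock" and "maya S"
  shows "of_nat (deg c) * (Hop ^^ k) (Ini v) c S = of_nat k * Hop' ((Hop ^^ (k - 1)) (Ini v)) c S"
  using assms(2)
proof (induction k arbitrary: c S)
  case 0
  then show ?case by (simp add: Ini_def)
next
  case (Suc k)
  let ?W = "(Hop ^^ k) (Ini v)" and ?W' = "(Hop ^^ (k - 1)) (Ini v)"
  have "of_nat (deg c) * (Hop ^^ Suc k) (Ini v) c S =
      Hop (\<lambda>b T. of_nat (deg b) * ?W b T) c S + Hop' ?W c S"
    using deg_Hop[OF Suc.prems] by simp
  also have "Hop (\<lambda>b T. of_nat (deg b) * ?W b T) c S = Hop (\<lambda>b T. of_nat k * Hop' ?W' b T) c S"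
    by (rule Hop_cong[OF Suc.prems]) (rule Suc.IH)
  also have "\<dots> = of_nat k * Hop' (Hop ?W') c S"
    by (simp add: Hop_scale[OF Suc.prems] Hop_Hop'[OF pow_fock[OF v] Suc.prems])
  also have "\<dots> = of_nat k * Hop' ?W c S"
    by (cases k) auto
  finally show ?case by (simp add: distrib_right)
qed

text \<open>The Euler equation of an exponential, read off in degree \<open>c\<close>. In
  characteristic 0 it determines \<open>E c\<close> from lower degrees, so the properties below
  follow by induction on \<open>deg c\<close>.\<close>

lemma E_rec:
  assumes v: "v \<in> fock" and S: "maya S"
  shows "of_nat (deg c) * E c v S = (\<Sum>(a, b)\<in>dec c. (of_nat (deg a) * P a) * cur a (E b v) S)"
proof -
  let ?K = "deg c"
  \<comment> \<open>One vanishing term is added on top so that lowering \<open>k\<close> by one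
    still leaves the whole range up to \<open>?K\<close>.\<close>
  have "of_nat (deg c) * E c v S = (\<Sum>k\<le>Suc ?K. of_nat (deg c) * (Hop ^^ k) (Ini v) c S / of_nat (fact k))"
    unfolding E_eq[OF S le_SucI[OF order_refl]] by (simp only: sum_distrib_left times_divide_eq_right)
  also have "\<dots> = (\<Sum>k\<le>Suc ?K. of_nat k * Hop' ((Hop ^^ (k - 1)) (Ini v)) c S / of_nat (fact k))"
    by (simp only: deg_pow[OF v S])
  also have "\<dots> = (\<Sum>k\<le>?K. Hop' ((Hop ^^ k) (Ini v)) c S / of_nat (fact k))"
  proof -
    have "of_nat (Suc k) * Hop' ((Hop ^^ k) (Ini v)) c S / of_nat (fact (Suc k)) =
        Hop' ((Hop ^^ k) (Ini v)) c S / of_nat (fact k)" for k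
    proof -
      have "(of_nat (Suc k) :: scalar) \<noteq> 0" by (simp del: of_nat_Suc)
      then show ?thesis
        unfolding fact_Suc of_nat_id of_nat_mult by (rule nonzero_mult_divide_mult_cancel_left)
    qed
    then show ?thesis by (subst sum.atMost_Suc_shift) simp
  qed
  also have "\<dots> = (\<Sum>(a, b)\<in>dec c. \<Sum>k\<le>?K. (of_nat (deg a) * P a) * cur a ((Hop ^^ k) (Ini v) b) S / of_nat (fact k))"
    unfolding Hop'_def sum_divide_distrib split_def by (rule sum.swap)
  also have "\<dots> = (\<Sum>(a, b)\<in>dec c. (of_nat (deg a) * P a) * cur a (E b v) S)"
  proof (rule sum_dec_cong)
    fix a b assume c: "a + b = c"
    show "(\<Sum>k\<le>deg c. of_nat (deg a) * P a * cur a ((Hop ^^ k) (Ini v) b) S / of_nat (fact k)) =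
           of_nat (deg a) * P a * cur a (E b v) S"
    proof (cases "a = 0")
      case False
      have "cur a (E b v) S = cur a (\<lambda>T. \<Sum>k\<le>deg c. (1 / of_nat (fact k)) * (Hop ^^ k) (Ini v) b T) S"
        using E_eq[of _ b "deg c" v] c
        by (intro current_agree[OF S e_nz[OF False]]) (auto simp: reach_def deg_add)
      also have "\<dots> = (\<Sum>k\<le>deg c. (1 / of_nat (fact k)) * cur a ((Hop ^^ k) (Ini v) b) S)"
        by (rule current_sum[OF S e_nz[OF False]])
      finally show ?thesis by (simp add: sum_distrib_left)
    qed simp
  qed
  finally show ?thesis .
qed

lemma E_0: "E 0 v S = v S"
  by (simp add: E_def Ini_def)

lemma deg_cancel: "c \<noteq> 0 \<Longrightarrow> of_nat (deg c) * x = of_nat (deg c) * y \<Longrightarrow> x = (y :: scalar)"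
  by (simp add: deg_eq_0)

lemma deg_less: "a \<noteq> 0 \<Longrightarrow> deg b < deg (a + b)"
  using deg_eq_0[of a] by (auto simp: deg_add)

text \<open>Locality of the exponential: moves of degrees \<open>a\<close> and \<open>b\<close>
  compose to one of degree \<open>a + b\<close>, all with the same sign.\<close>

lemma E_agree:
  assumes "v \<in> fock" "w \<in> fock" "maya S" "\<And>T. T \<in> reach (e * int (deg c)) S \<Longrightarrow> v T = w T"
  shows "E c v S = E c w S"
  using assms(3,4)
proof (induction "deg c" arbitrary: c S rule: less_induct)
  case less
  show ?case
  proof (cases "c = 0")
    case True
    then show ?thesis using less.prems reach_refl[of S] by (simp add: E_0)
  next
    case c: False
    have "of_nat (deg c) * E c v S = of_nat (deg c) * E c w S"
      unfolding E_rec[OF assms(1) less.prems(1)] E_rec[OF assms(2) less.prems(1)]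
    proof (rule sum_dec_cong)
      fix a b assume ab: "a + b = c"
      show "of_nat (deg a) * P a * cur a (E b v) S = of_nat (deg a) * P a * cur a (E b w) S"
      proof (cases "a = 0")
        case False
        have "cur a (E b v) S = cur a (E b w) S"
        proof (rule current_agree[OF less.prems(1) e_nz[OF False]])
          fix T assume T: "T \<in> reach (e * int (deg a)) S"
          show "E b v T = E b w T"
          proof (rule less.hyps)
            show "deg b < deg c" using ab deg_less[OF False, of b] by simp
            show "maya T" using T by (simp add: reach_def)
            fix U assume "U \<in> reach (e * int (deg b)) T"
            then have "U \<in> reach (e * int (deg a) + e * int (deg b)) S"
              using T e_cases by (intro reach_trans) auto
            moreover have "e * int (deg a) + e * int (deg b) = e * int (deg c)"
              using ab by (auto simp: deg_add distrib_left)
            ultimately show "v U = w U" using less.prems(2)[of U] by simp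
          qed
        qed
        then show ?thesis by simp
      qed simp
    qed
    then show ?thesis by (rule deg_cancel[OF c])
  qed
qed

lemma sum_fock: "(\<And>i. i \<in> I \<Longrightarrow> v i \<in> fock) \<Longrightarrow> (\<lambda>T. \<Sum>i\<in>I. x i * v i T) \<in> fock"
proof -
  assume v: "\<And>i. i \<in> I \<Longrightarrow> v i \<in> fock"
  have "(\<Sum>i\<in>I. x i * v i S) = 0" if "\<not> maya S" for S
    by (rule sum.neutral) (use that v fock_zero in auto)
  then show ?thesis by (auto simp: fock_def)
qed

lemma E_sum:
  assumes v: "\<And>i. i \<in> I \<Longrightarrow> v i \<in> fock" and S: "maya S"
  shows "E c (\<lambda>T. \<Sum>i\<in>I. x i * v i T) S = (\<Sum>i\<in>I. x i * E c (v i) S)"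
  using S
proof (induction "deg c" arbitrary: c S rule: less_induct)
  case less
  note S = less.prems
  show ?case
  proof (cases "c = 0")
    case c: False
    have w: "(\<lambda>T. \<Sum>i\<in>I. x i * v i T) \<in> fock" using v by (rule sum_fock)
    have "of_nat (deg c) * E c (\<lambda>T. \<Sum>i\<in>I. x i * v i T) S = 
      (\<Sum>(a, b)\<in>dec c. \<Sum>i\<in>I. x i * ((of_nat (deg a) * P a) * cur a (E b (v i)) S))"
      unfolding E_rec[OF w S]
    proof (rule sum_dec_cong)
      fix a b assume ab: "a + b = c"
      show "of_nat (deg a) * P a * cur a (E b (\<lambda>T. \<Sum>i\<in>I. x i * v i T)) S =
        (\<Sum>i\<in>I. x i * (of_nat (deg a) * P a * cur a (E b (v i)) S))"
      proof (cases "a = 0")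
        case False
        have "cur a (E b (\<lambda>T. \<Sum>i\<in>I. x i * v i T)) S = cur a (\<lambda>T. \<Sum>i\<in>I. x i * E b (v i) T) S"
          using ab deg_less[OF False, of b]
          by (intro current_agree[OF S e_nz[OF False]] less.hyps) (auto simp: reach_def)
        then show ?thesis by (simp add: current_sum[OF S e_nz[OF False]] sum_distrib_left mult_ac)
      qed simp
    qed
    also have "\<dots> = (\<Sum>i\<in>I. x i * (\<Sum>(a, b)\<in>dec c. (of_nat (deg a) * P a) * cur a (E b (v i)) S))"
      by (simp add: sum_distrib_left split_def sum.swap[of _ I])
    also have "\<dots> = (\<Sum>i\<in>I. x i * (of_nat (deg c) * E c (v i) S))"
      by (intro sum.cong refl) (simp only: E_rec[OF v S])
    also have "\<dots> = of_nat (deg c) * (\<Sum>i\<in>I. x i * E c (v i) S)"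
      by (simp add: sum_distrib_left mult_ac)
    finally show ?thesis by (rule deg_cancel[OF c])
  qed (simp add: E_0)
qed

text \<open>The Euler recursion is applied to the left side and the current is moved past the
  fermion. One resulting sum is absorbed by \<open>E_rec\<close> and acquires the degree of the
  \<open>E\<close> factor, the commutator sum by \<open>Q_rec\<close> and acquires that of the
  \<open>Q\<close> factor; together they give \<open>deg c\<close>.\<close>

lemma E_psi:
  assumes v: "v \<in> fock" and S: "maya S"
  shows "E c (psi n v) S = (\<Sum>(a, b)\<in>dec c. Q a * psi (n - e * int (deg a)) (E b v) S)"
  using S
proof (induction "deg c" arbitrary: c S rule: less_induct)
  case less
  note S = less.prems
  show ?case
  proof (cases "c = 0")
    case True
    have "dec c = {(0, 0)}" using finite_dec deg_add deg_eq_0 True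
      by (auto simp: dec_def) (metis add_is_0 deg_eq_0 deg_add)+
    then show ?thesis by (simp add: True E_0 Q_0 psi_def)
  next
    case c: False
    let ?D = "\<lambda>a. of_nat (deg a) * P a"
    let ?n = "\<lambda>a. n - e * int (deg a)"
    have "of_nat (deg c) * E c (psi n v) S =
        (\<Sum>(a, d)\<in>dec c. \<Sum>(b, d)\<in>dec d. (?D a * Q b) * cur a (psi (?n b) (E d v)) S)"
      unfolding E_rec[OF psi_fock[OF v] S]
    proof (rule sum_dec_cong)
      fix a d assume ad: "a + d = c"
      show "?D a * cur a (E d (psi n v)) S = (\<Sum>(b, d)\<in>dec d. (?D a * Q b) * cur a (psi (?n b) (E d v)) S)"
      proof (cases "a = 0")
        case False
        have "cur a (E d (psi n v)) S = cur a (\<lambda>T. \<Sum>p\<in>dec d. Q (fst p) * psi (?n (fst p)) (E (snd p) v) T) S"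
        proof (rule current_agree[OF S e_nz[OF False]])
          fix T assume "T \<in> reach (e * int (deg a)) S"
          then show "E d (psi n v) T = (\<Sum>p\<in>dec d. Q (fst p) * psi (?n (fst p)) (E (snd p) v) T)"
            using less.hyps[of d T] ad deg_less[OF False, of d] by (auto simp: reach_def split_def)
        qed
        then show ?thesis
          by (simp add: current_sum[OF S e_nz[OF False]] sum_distrib_left mult_ac split_def)
      qed simp
    qed
    also have "\<dots> = (\<Sum>(a, d)\<in>dec c. \<Sum>(b, d)\<in>dec d. (?D a * Q b) *
        (psi (?n b) (cur a (E d v)) S + psi (?n (a + b)) (E d v) S))"
    proof (intro sum_dec_cong)
      fix a b d
      show "(?D a * Q b) * cur a (psi (?n b) (E d v)) S =
          (?D a * Q b) * (psi (?n b) (cur a (E d v)) S + psi (?n (a + b)) (E d v) S)"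
        using current_psi[OF E_fock[OF v] S e_nz, of a "?n b" d]
        by (cases "a = 0") (simp_all add: deg_add algebra_simps)
    qed
    also have "\<dots> = (\<Sum>(a, d)\<in>dec c. \<Sum>(b, d)\<in>dec d. (?D a * Q b) * psi (?n b) (cur a (E d v)) S)
        + (\<Sum>(a, d)\<in>dec c. \<Sum>(b, d)\<in>dec d. (?D a * Q b) * psi (?n (a + b)) (E d v) S)"
      by (simp add: distrib_left sum.distrib split_def)
    also have "(\<Sum>(a, d)\<in>dec c. \<Sum>(b, d)\<in>dec d. (?D a * Q b) * psi (?n b) (cur a (E d v)) S) =
        (\<Sum>(b, d)\<in>dec c. \<Sum>(a, d)\<in>dec d. (?D a * Q b) * psi (?n b) (cur a (E d v)) S)"
      by (rule sum_dec_commute)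
    also have "\<dots> = (\<Sum>(b, d)\<in>dec c. of_nat (deg d) * (Q b * psi (?n b) (E d v) S))"
    proof (intro sum_dec_cong)
      fix b d
      have "(\<Sum>p\<in>dec d. (?D (fst p) * Q b) * psi (?n b) (cur (fst p) (E (snd p) v)) S) =
         Q b * psi (?n b) (\<lambda>T. \<Sum>p\<in>dec d. ?D (fst p) * cur (fst p) (E (snd p) v) T) S"
        unfolding psi_sum[of _ "\<lambda>p. ?D (fst p)" "\<lambda>p. cur (fst p) (E (snd p) v)"]
        by (simp add: sum_distrib_left mult_ac)
      also have "\<dots> = Q b * psi (?n b) (\<lambda>T. of_nat (deg d) * E d v T) S"
        using S by (auto simp: psi_def E_rec[OF v] split_def)
      finally show "(\<Sum>(a, d)\<in>dec d. (?D a * Q b) * psi (?n b) (cur a (E d v)) S) =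
          of_nat (deg d) * (Q b * psi (?n b) (E d v) S)"
        by (simp add: split_def psi_def when_def mult_ac)
    qed
    also have "(\<Sum>(a, d)\<in>dec c. \<Sum>(b, d)\<in>dec d. (?D a * Q b) * psi (?n (a + b)) (E d v) S) =
        (\<Sum>(s, d)\<in>dec c. \<Sum>(a, b)\<in>dec s. (?D a * Q b) * psi (?n (a + b)) (E d v) S)"
      by (rule sum_dec_assoc)
    also have "\<dots> = (\<Sum>(s, d)\<in>dec c. of_nat (deg s) * (Q s * psi (?n s) (E d v) S))"
    proof (intro sum_dec_cong)
      fix s d
      have "(\<Sum>(a, b)\<in>dec s. (?D a * Q b) * psi (?n (a + b)) (E d v) S) =
          (\<Sum>(a, b)\<in>dec s. (?D a * Q b) * psi (?n s) (E d v) S)"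
        by (intro sum_dec_cong) auto
      also have "\<dots> = (\<Sum>(a, b)\<in>dec s. ?D a * Q b) * psi (?n s) (E d v) S"
        by (simp add: sum_distrib_right split_def)
      also have "\<dots> = of_nat (deg s) * Q s * psi (?n s) (E d v) S"
        by (simp only: Q_rec)
      finally show "(\<Sum>(a, b)\<in>dec s. (?D a * Q b) * psi (?n (a + b)) (E d v) S) =
          of_nat (deg s) * (Q s * psi (?n s) (E d v) S)" by (simp only: mult.assoc)
    qed
    also have "(\<Sum>(b, d)\<in>dec c. of_nat (deg d) * (Q b * psi (?n b) (E d v) S)) +
        (\<Sum>(s, d)\<in>dec c. of_nat (deg s) * (Q s * psi (?n s) (E d v) S)) =
        (\<Sum>(a, b)\<in>dec c. of_nat (deg c) * (Q a * psi (?n a) (E b v) S))"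
      unfolding dec_sum_add by (intro sum_dec_cong) (auto simp: deg_add algebra_simps)
    also have "\<dots> = of_nat (deg c) * (\<Sum>(a, b)\<in>dec c. Q a * psi (?n a) (E b v) S)"
      by (simp add: sum_distrib_left split_def)
    finally show ?thesis by (rule deg_cancel[OF c])
  qed
qed

lemma E_expand:
  assumes "v \<in> fock" "maya S" "finite J" "reach (e * int (deg c)) S \<subseteq> J" "\<And>T. T \<in> J \<Longrightarrow> maya T"
  shows "E c v S = (\<Sum>T\<in>J. v T * E c (ket T) S)"
proof -
  have k: "ket T \<in> fock" if "T \<in> J" for T using assms(5)[OF that] by (auto simp: ket_def fock_def)
  have "E c v S = E c (\<lambda>U. \<Sum>T\<in>J. v T * ket T U) S"
  proof (rule E_agree[OF assms(1) sum_fock assms(2)])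
    fix U assume "U \<in> reach (e * int (deg c)) S"
    then have "U \<in> J" using assms by auto
    have "(\<Sum>T\<in>J. v T * ket T U) = (\<Sum>T\<in>J. if T = U then v U else 0)"
      by (rule sum.cong) (auto simp: ket_def)
    then show "v U = (\<Sum>T\<in>J. v T * ket T U)" using \<open>U \<in> J\<close> assms(3) by simp
  qed (rule k)
  also have "\<dots> = (\<Sum>T\<in>J. v T * E c (ket T) S)"
    by (rule E_sum[OF k assms(2)])
  finally show ?thesis .
qed

lemma E_ket_reach:
  assumes "maya S" "maya T" "E c (ket T) S \<noteq> 0"
  shows "T \<in> reach (e * int (deg c)) S"
proof (rule ccontr)
  assume "T \<notin> reach (e * int (deg c)) S"
  then have "E c (ket T) S = E c (\<lambda>_. 0) S"
    using assms zero_fock by (intro E_agree) (auto simp: ket_def fock_def when_def)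
  also have "\<dots> = 0" using E_sum[of "{}" _ S c "\<lambda>_. 0"] assms by simp
  finally show False using assms by simp
qed

lemma E_nonzero:
  assumes "v \<in> fock" "maya S" "E c v S \<noteq> 0"
  shows "\<exists>T\<in>reach (e * int (deg c)) S. v T \<noteq> 0"
proof (rule ccontr)
  assume "\<not> ?thesis"
  then have "E c v S = E c (\<lambda>_. 0) S"
    using assms zero_fock by (intro E_agree) auto
  also have "\<dots> = 0" using E_sum[of "{}" _ S c "\<lambda>_. 0"] assms by simp
  finally show False using assms by simp
qed

text \<open>A filled sea cannot arise from a diagram by emptying a site and filling a higher one, so
  its coefficients under positive modes vanish.\<close>

lemma E_vac:
  assumes e: "e = 1" and S: "maya S"
  shows "E c (ket {..<l}) S = (if c = 0 then ket {..<l} S else 0)"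
  using S
proof (induction "deg c" arbitrary: c S rule: less_induct)
  case less
  show ?case
  proof (cases "c = 0")
    case c: False
    have "maya {..<l}"
      by (auto simp: maya_def intro: finite_subset[of _ "{l..<0}"] finite_subset[of _ "{0..<l}"])
    then have k: "ket {..<l} \<in> fock" by (auto simp: ket_def fock_def)
    have "of_nat (deg c) * E c (ket {..<l}) S = (\<Sum>(a, b)\<in>dec c. 0)"
      unfolding E_rec[OF k less.prems]
    proof (rule sum_dec_cong)
      fix a b assume ab: "a + b = c"
      show "of_nat (deg a) * P a * cur a (E b (ket {..<l})) S = 0"
      proof (cases "a = 0")
        case a: False
        have "cur a (E b (ket {..<l})) S = cur a (\<lambda>T. if b = 0 then ket {..<l} T else 0) S"
          using less.hyps[of b] ab deg_less[OF a, of b]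
          by (intro current_agree[OF less.prems e_nz[OF a]]) (auto simp: reach_def)
        also have "\<dots> = 0"
        proof -
          have "ket {..<l} (insert (j + int (deg a)) (S - {j})) = 0" for j
          proof -
            let ?T = "insert (j + int (deg a)) (S - {j})"
            have "j \<notin> ?T" "j + int (deg a) \<in> ?T" using a deg_eq_0[of a] by auto
            have "?T \<noteq> {..<l}"
            proof
              assume "?T = {..<l}"
              with \<open>j \<notin> ?T\<close> \<open>j + int (deg a) \<in> ?T\<close> have "j \<notin> {..<l}" "j + int (deg a) \<in> {..<l}"
                by simp_all
              then show False by simp
            qed
            then show ?thesis by (simp add: ket_def)
          qed
          moreover have "int (deg a) \<noteq> 0" using a deg_eq_0[of a] by simp
          ultimately have "current (int (deg a)) (ket {..<l}) S = 0"
            by (simp add: current_def hop_eq cong: if_cong)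
          moreover have "cur a (\<lambda>T. 0) S = 0" by (rule current_zero[OF e_nz[OF a]])
          ultimately show ?thesis by (cases "b = 0") (simp_all only: e if_True if_False mult_1_left simp_thms)
        qed
        finally show ?thesis by simp
      qed simp
    qed
    also have "\<dots> = of_nat (deg c) * 0" by simp
    finally show ?thesis unfolding if_not_P[OF c] by (rule deg_cancel[OF c])
  qed (simp add: E_0)
qed

declare deg_0 [simp del]

end

section \<open>Exponentials of currents as operators on the Fock space\<close>

lemma finite_dec_nat: "finite (dec (c::nat))"
  by (rule finite_subset[of _ "{..c} \<times> {..c}"]) (auto simp: dec_def)

lemma sum_triangle:
  "(\<Sum>n\<le>L. \<Sum>c\<le>L - n. f n c) = (\<Sum>k\<le>L. \<Sum>(n, c)\<in>dec k. f n c)" for L :: nat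
proof -
  have "(\<Sum>n\<le>L. \<Sum>c\<le>L - n. f n c) = (\<Sum>(n, c)\<in>Sigma {..L} (\<lambda>n. {..L - n}). f n c)"
    by (subst sum.Sigma) auto
  also have "\<dots> = (\<Sum>(k, (n, c))\<in>Sigma {..L} (\<lambda>k. dec k). f n c)"
    by (rule sum.reindex_bij_witness[where i = "\<lambda>(k, (n, c)). (n, c)" and j = "\<lambda>(n, c). (n + c, (n, c))"]) auto
  also have "\<dots> = (\<Sum>k\<le>L. \<Sum>(n, c)\<in>dec k. f n c)"
    by (subst sum.Sigma) (auto simp: finite_dec_nat)
  finally show ?thesis .
qed

text \<open>The vector \<open>\<psi>(r\<^sub>0) \<dots>
  \<psi>(r\<^sub>L\<^sub>-\<^sub>1)|-N\<rangle>\<close> with \<open>\<psi>(f)\<close> the sum of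
  \<open>f(n) \<psi>\<^sub>n\<close> over \<open>n \<ge> -N\<close>. Modes below \<open>-N\<close>
  vanish on the filled sea, so only the part of \<open>S\<close> above \<open>-N\<close> enters the
  minor.\<close>

definition wedge_vec :: "nat \<Rightarrow> nat \<Rightarrow> (nat \<Rightarrow> int \<Rightarrow> scalar) \<Rightarrow> vec" where
  "wedge_vec N L r S = (if {..<- int N} \<subseteq> S then wedge L r (S \<inter> {- int N..}) else 0)"

lemma maya_window:
  assumes "{..<l} \<subseteq> S"
  shows "maya S \<longleftrightarrow> finite (S \<inter> {l..})"
proof -
  have "finite ({..<0} - S)"
  proof (rule finite_subset[of _ "{l..<0}"])
    show "{..<0} - S \<subseteq> {l..<0}" using assms by (auto simp: subset_iff not_less[symmetric])
  qed simp
  moreover have "S \<inter> {0..} \<subseteq> (S \<inter> {l..}) \<union> {0..<l}" "S \<inter> {l..} \<subseteq> (S \<inter> {0..}) \<union> {l..<0}" by auto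
  ultimately show ?thesis unfolding maya_def by (meson finite_Un finite_atLeastLessThan_int finite_subset)
qed

lemma wedge_vec_fock: "wedge_vec N L r \<in> fock"
proof -
  have "maya S" if "wedge_vec N L r S \<noteq> 0" for S
  proof -
    from that have "{..<- int N} \<subseteq> S" "wedge L r (S \<inter> {- int N..}) \<noteq> 0"
      by (auto simp: wedge_vec_def split: if_splits)
    then show ?thesis using maya_window wedge_eq_0 by metis
  qed
  then show ?thesis by (auto simp: fock_def)
qed

lemma wedge_vec_0: "wedge_vec N 0 r = ket {..<- int N}"
proof
  fix S
  have "{..<- int N} \<subseteq> S \<and> S \<inter> {- int N..} = {} \<longleftrightarrow> S = {..<- int N}" by auto
  then show "wedge_vec N 0 r S = ket {..<- int N} S" by (auto simp: wedge_vec_def ket_def)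
qed

lemma psi_wedge_vec_low: "n < - int N \<Longrightarrow> psi n (wedge_vec N L r) S = 0"
  by (auto simp: psi_def wedge_vec_def when_def)

lemma wedge_vec_Suc_aux:
  assumes "n \<in> S" "- int N \<le> n" "{..<- int N} \<subseteq> S"
  shows "psi n (wedge_vec N L r) S = (- 1) ^ card {k \<in> S \<inter> {- int N..}. n < k} * wedge L r (S \<inter> {- int N..} - {n})"
proof -
  have "{k \<in> S \<inter> {- int N..}. n < k} = {k \<in> S. n < k}" "(S - {n}) \<inter> {- int N..} = S \<inter> {- int N..} - {n}"
    "{..<- int N} \<subseteq> S - {n}" using assms by auto
  then show ?thesis using assms by (simp add: psi_def wedge_vec_def above_sign_def)
qed

lemma wedge_vec_Suc:
  assumes "finite F" "S \<inter> {- int N..} \<subseteq> F" "F \<subseteq> {- int N..}"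
  shows "wedge_vec N (Suc L) r S = (\<Sum>n\<in>F. r 0 n * psi n (wedge_vec N L (\<lambda>i. r (Suc i))) S)"
proof (cases "{..<- int N} \<subseteq> S")
  case True
  have "(\<Sum>n\<in>F. r 0 n * psi n (wedge_vec N L (\<lambda>i. r (Suc i))) S) =
      (\<Sum>n\<in>S \<inter> {- int N..}. r 0 n * psi n (wedge_vec N L (\<lambda>i. r (Suc i))) S)"
    by (rule sum.mono_neutral_right) (use assms in \<open>auto simp: psi_def\<close>)
  then show ?thesis using True
    by (simp add: wedge_vec_def[of N "Suc L"] wedge_vec_Suc_aux mult_ac)
next
  case False
  then have "psi n (wedge_vec N L (\<lambda>i. r (Suc i))) S = 0" for n
    by (auto simp: psi_def wedge_vec_def when_def)
  then show ?thesis using False by (simp add: wedge_vec_def)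
qed

lemma wedge_vec_Suc_bounded:
  assumes "\<And>n. n > M \<Longrightarrow> r 0 n = 0"
  shows "wedge_vec N (Suc L) r S = (\<Sum>n\<in>{- int N..M}. r 0 n * psi n (wedge_vec N L (\<lambda>i. r (Suc i))) S)"
proof (cases "maya S")
  case True
  then obtain u where u: "S \<subseteq> {..u}" by (metis maya_bounds)
  have "wedge_vec N (Suc L) r S = (\<Sum>n\<in>{- int N..max M u}. r 0 n * psi n (wedge_vec N L (\<lambda>i. r (Suc i))) S)"
    by (rule wedge_vec_Suc) (use u in auto)
  also have "\<dots> = (\<Sum>n\<in>{- int N..M}. r 0 n * psi n (wedge_vec N L (\<lambda>i. r (Suc i))) S)"
    by (rule sum.mono_neutral_right) (use assms in auto)
  finally show ?thesis .
next
  case False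
  then show ?thesis by (simp add: fock_zero[OF wedge_vec_fock] fock_zero[OF psi_fock[OF wedge_vec_fock]])
qed

lemma psi_wedge_vec:
  assumes "- int N \<le> m"
  shows "psi m (wedge_vec N L r) = wedge_vec N (Suc L) (case_nat (\<lambda>n. 1 when n = m) r)"
proof
  fix S
  have "wedge_vec N (Suc L) (case_nat (\<lambda>n. 1 when n = m) r) S =
      (\<Sum>n\<in>{- int N..m}. (1 when n = m) * psi n (wedge_vec N L r) S)"
    by (subst wedge_vec_Suc_bounded[of m]) auto
  also have "\<dots> = (\<Sum>n\<in>{- int N..m}. if n = m then psi m (wedge_vec N L r) S else 0)"
    by (rule sum.cong) auto
  finally show "psi m (wedge_vec N L r) S = wedge_vec N (Suc L) (case_nat (\<lambda>n. 1 when n = m) r) S"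
    using assms by simp
qed

lemma finite_wedge_vec_support:
  assumes "\<And>i n. i < L \<Longrightarrow> n > M \<Longrightarrow> r i n = 0"
  shows "finite {S. wedge_vec N L r S \<noteq> 0}"
proof (rule finite_subset)
  show "{S. wedge_vec N L r S \<noteq> 0} \<subseteq> (\<lambda>X. {..<- int N} \<union> X) ` Pow {- int N..M}"
  proof
    fix S assume "S \<in> {S. wedge_vec N L r S \<noteq> 0}"
    then have S: "{..<- int N} \<subseteq> S" "wedge L r (S \<inter> {- int N..}) \<noteq> 0"
      by (auto simp: wedge_vec_def split: if_splits)
    have "S \<inter> {- int N..} \<subseteq> {- int N..M}"
    proof
      fix m assume m: "m \<in> S \<inter> {- int N..}"
      from wedge_nonzero_support[OF S(2) this] assms show "m \<in> {- int N..M}"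
        using m by (metis IntD2 atLeastAtMost_iff atLeast_iff not_le_imp_less)
    qed
    moreover have "S = {..<- int N} \<union> (S \<inter> {- int N..})" using S(1) by auto
    ultimately show "S \<in> (\<lambda>X. {..<- int N} \<union> X) ` Pow {- int N..M}" by blast
  qed
qed simp

lemma charge_subset:
  assumes "maya A" "A \<subseteq> S" "finite (S - A)"
  shows "charge S = charge A + int (card (S - A))"
proof -
  have "charge (A \<union> B) = charge A + int (card B) \<and> maya (A \<union> B)" if "finite B" "B \<inter> A = {}" for B
    using that
  proof (induction B rule: finite_induct)
    case (insert b B)
    then have "charge (insert b (A \<union> B)) = charge (A \<union> B) + 1"
      by (intro wt_charge_insert) auto
    then show ?case using insert by auto
  qed (simp add: assms)
  moreover have "(S - A) \<inter> A = {}" by auto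
  ultimately show ?thesis using assms(2,3) by (metis Un_Diff_cancel Un_absorb1)
qed

lemma maya_lessThan: "maya {..<l}"
  by (auto simp: maya_def intro: finite_subset[of _ "{l..<0}"] finite_subset[of _ "{0..<l}"])

lemma charge_eq_window:
  assumes "maya S" "{..<l} \<subseteq> S" "charge S = charge {..<l}"
  shows "S = {..<l}"
proof -
  have e: "S - {..<l} = S \<inter> {l..}" by auto
  have f: "finite (S - {..<l})" using assms maya_window[of l S] by (simp add: e)
  then have "S - {..<l} = {}" using charge_subset[OF maya_lessThan assms(2) f] assms(3) by simp
  then show ?thesis using assms(2) by auto
qed

section \<open>Summing all degrees: the exponential as an operator on the Fock space\<close>

locale ngraded = graded "\<lambda>n::nat. n" P Q e for P Q e
begin

definition A :: "vec \<Rightarrow> vec" where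
  "A v = (\<lambda>S. Sum_any (\<lambda>n. P n * current (e * int n) v S when n \<ge> 1))"

text \<open>A current of mode \<open>e * int n\<close> reads at \<open>S\<close> diagrams whose
  \<open>e * wt\<close> is larger by \<open>n\<close>. An upper bound for \<open>e * wt\<close> on
  the support therefore leaves finitely many degrees at each \<open>S\<close>, and
  \<open>Sum_any\<close> has its intended value.\<close>

definition bounded :: "int \<Rightarrow> vec \<Rightarrow> bool" where
  "bounded w v \<longleftrightarrow> v \<in> fock \<and> (\<forall>S. v S \<noteq> 0 \<longrightarrow> e * wt S \<le> w)"

text \<open>The largest degree that can contribute at \<open>S\<close> to an operator applied to a
  vector bounded by \<open>w\<close>.\<close>

definition lim :: "int \<Rightarrow> int set \<Rightarrow> nat" where
  "lim w S = nat (w - e * wt S)"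

lemma ee: "e * (e * x) = x"
  using e_cases by auto

lemma wt_reach: "T \<in> reach (e * int n) S \<Longrightarrow> maya T \<and> e * wt T = e * wt S + int n"
  by (simp add: reach_def distrib_left ee)

lemma A_cong:
  assumes "maya S" "\<And>T. maya T \<Longrightarrow> u T = v T"
  shows "A u S = A v S"
  unfolding A_def
proof (rule Sum_any.cong)
  fix n
  show "(P n * current (e * int n) u S when n \<ge> 1) = (P n * current (e * int n) v S when n \<ge> 1)"
  proof (cases "n \<ge> 1")
    case True
    then have "e * int n \<noteq> 0" using e_cases by auto
    then have "current (e * int n) u S = current (e * int n) v S"
      by (rule current_agree[OF assms(1)]) (rule assms(2), rule reach_maya)
    then show ?thesis by simp
  qed simp
qed

lemma A_fock: "v \<in> fock \<Longrightarrow> A v \<in> fock"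
proof -
  assume v: "v \<in> fock"
  have "A v S = 0" if "\<not> maya S" for S
  proof -
    have "(P n * current (e * int n) v S when n \<ge> 1) = 0" for n
      using current_not_maya[OF v that, of "e * int n"] e_cases by (cases "n \<ge> 1") auto
    then show ?thesis by (simp add: A_def)
  qed
  then show ?thesis by (auto simp: fock_def)
qed

text \<open>Passing from a graded series to its total turns \<open>Hop\<close> into
  \<open>A\<close>. The truncation depends on the diagram, so it has to be tracked through each
  current.\<close>

lemma A_total:
  assumes V: "\<And>c. V c \<in> fock" "\<And>c S. V c S \<noteq> 0 \<Longrightarrow> int c \<le> w - e * wt S" and S: "maya S"
  shows "A (\<lambda>T. \<Sum>c\<le>lim w T. V c T) S = (\<Sum>c\<le>lim w S. Hop V c S)"
proof -
  let ?L = "lim w S" and ?t = "\<lambda>T. \<Sum>c\<le>lim w T. V c T"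
  have nz: "e * int n \<noteq> 0" if "n \<ge> 1" for n using that e_cases by auto
  have "A ?t S = (\<Sum>n\<le>?L. P n * current (e * int n) ?t S when n \<ge> 1)"
    unfolding A_def
  proof (rule Sum_any.expand_superset)
    show "{n. (P n * current (e * int n) ?t S when n \<ge> 1) \<noteq> 0} \<subseteq> {..?L}"
    proof
      fix n assume n: "n \<in> {n. (P n * current (e * int n) ?t S when n \<ge> 1) \<noteq> 0}"
      show "n \<in> {..?L}"
      proof (rule ccontr)
        assume "n \<notin> {..?L}"
        then have gt: "int n > w - e * wt S" by (auto simp: lim_def)
        have n1: "n \<ge> 1" using n by (auto simp: when_def split: if_splits)
        have "current (e * int n) ?t S = current (e * int n) (\<lambda>_. 0) S"
        proof (rule current_agree[OF S nz[OF n1]])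
          fix T assume "T \<in> reach (e * int n) S"
          from wt_reach[OF this] gt have "w - e * wt T < 0" by simp
          then have "V c T = 0" for c using V(2)[of c T] by linarith
          then show "?t T = 0" by simp
        qed
        then show False using n n1 current_zero[OF nz[OF n1]] by simp
      qed
    qed
  qed simp
  also have "\<dots> = (\<Sum>n\<le>?L. \<Sum>c\<le>?L - n. P n * current (e * int n) (V c) S)"
  proof (rule sum.cong[OF refl])
    fix n assume n: "n \<in> {..?L}"
    show "(P n * current (e * int n) ?t S when n \<ge> 1) = (\<Sum>c\<le>?L - n. P n * current (e * int n) (V c) S)"
    proof (cases "n \<ge> 1")
      case True
      have "current (e * int n) ?t S = current (e * int n) (\<lambda>T. \<Sum>c\<le>?L - n. 1 * V c T) S"
      proof (rule current_agree[OF S nz[OF True]])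
        fix T assume "T \<in> reach (e * int n) S"
        \<comment> \<open>A move of degree \<open>n\<close> uses up exactly \<open>n\<close> of the
          remaining degrees.\<close>
        from wt_reach[OF this] have "lim w T = ?L - n" by (auto simp: lim_def)
        then show "?t T = (\<Sum>c\<le>?L - n. 1 * V c T)" by simp
      qed
      then show ?thesis using True
        by (simp add: current_sum[OF S nz[OF True], of "\<lambda>_. 1", simplified] sum_distrib_left)
    next
      case False
      then have "n = 0" by simp
      then show ?thesis by (simp add: P_0)
    qed
  qed
  also have "\<dots> = (\<Sum>c\<le>?L. Hop V c S)"
    unfolding sum_triangle by (simp add: Hop_def)
  finally show ?thesis .
qed

lemma Hop_bound:
  assumes V: "\<And>c. V c \<in> fock" "\<And>c S. V c S \<noteq> 0 \<Longrightarrow> int c \<le> w - e * wt S"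
    and "Hop V c S \<noteq> 0"
  shows "int c \<le> w - e * wt S"
proof (rule ccontr)
  assume gt: "\<not> int c \<le> w - e * wt S"
  have S: "maya S" using assms Hop_fock[of V c] by (auto simp: fock_def)
  have "Hop V c S = 0"
    unfolding Hop_def
  proof (rule sum.neutral, intro ballI)
    fix p assume "p \<in> dec c"
    then obtain a b where p: "p = (a, b)" and c: "c = a + b" by (cases p) auto
    have "current (e * int a) (V b) S = 0" if a: "a \<noteq> 0"
    proof -
      have "current (e * int a) (V b) S = current (e * int a) (\<lambda>_. 0) S"
      proof (rule current_agree[OF S e_nz[OF a]])
        fix T assume "T \<in> reach (e * int a) S"
        from wt_reach[OF this] gt c have "w - e * wt T < int b" by simp
        then show "V b T = 0" using V(2)[of b T] by linarith
      qed
      then show "current (e * int a) (V b) S = 0" by (simp add: current_zero[OF e_nz[OF a]])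
    qed
    then show "(case p of (a, b) \<Rightarrow> P a * current (e * int a) (V b) S) = 0"
      using P_0 by (cases "a = 0") (simp_all add: p)
  qed
  then show False using assms by simp
qed

lemma Hop_pow_bound:
  assumes v: "bounded w v"
  shows "(Hop ^^ k) (Ini v) c S \<noteq> 0 \<Longrightarrow> int c \<le> w - e * wt S"
proof (induction k arbitrary: c S)
  case 0
  then show ?case using v by (auto simp: Ini_def bounded_def split: if_splits)
next
  case (Suc k)
  have f: "v \<in> fock" using v by (simp add: bounded_def)
  show ?case
    by (rule Hop_bound[of "(Hop ^^ k) (Ini v)"]) (use Suc pow_fock[OF f] in auto)
qed

lemma A_pow:
  assumes v: "bounded w v" and S: "maya S"
  shows "(A ^^ k) v S = (\<Sum>c\<le>lim w S. (Hop ^^ k) (Ini v) c S)"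
  using S
proof (induction k arbitrary: S)
  case 0
  have "(\<Sum>c\<le>lim w S. Ini v c S) = (\<Sum>c\<le>lim w S. if c = 0 then v S else 0)"
    by (rule sum.cong) (auto simp: Ini_def)
  then show ?case by simp
next
  case (Suc k)
  have f: "v \<in> fock" using v by (simp add: bounded_def)
  have "(A ^^ Suc k) v S = A (\<lambda>T. \<Sum>c\<le>lim w T. (Hop ^^ k) (Ini v) c T) S"
    using A_cong[OF Suc.prems Suc.IH] by simp
  then show ?case
    using A_total[OF pow_fock[OF f] Hop_pow_bound[OF v] Suc.prems] by simp
qed

definition U :: "vec \<Rightarrow> vec" where "U v = op_exp A v"

text \<open>Both exponentials are finite at \<open>S\<close>, in the number of factors and in the
  degree, so the two summations may be exchanged.\<close>

lemma U_eq_aux: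
  assumes v: "bounded w v" and S: "maya S"
  shows "U v S = (\<Sum>c\<le>lim w S. E c v S)"
proof -
  let ?L = "lim w S"
  have "U v S = (\<Sum>k\<le>?L. (A ^^ k) v S / of_nat (fact k))"
    unfolding U_def op_exp_def
  proof (rule Sum_any.expand_superset)
    have "(A ^^ k) v S = 0" if "k > ?L" for k
      unfolding A_pow[OF v S] by (rule sum.neutral) (use that Hop_pow_0[OF S] in auto)
    then show "{k. (A ^^ k) v S / of_nat (fact k) \<noteq> 0} \<subseteq> {..?L}"
      by (auto simp: not_le[symmetric])
  qed simp
  also have "\<dots> = (\<Sum>c\<le>?L. \<Sum>k\<le>?L. (Hop ^^ k) (Ini v) c S / of_nat (fact k))"
    by (subst sum.swap) (simp add: A_pow[OF v S] sum_divide_distrib)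
  also have "\<dots> = (\<Sum>c\<le>?L. E c v S)"
    by (intro sum.cong refl E_eq[symmetric] S) auto
  finally show ?thesis .
qed

lemma E_bound:
  assumes v: "bounded w v" and S: "maya S" and "E c v S \<noteq> 0"
  shows "int c \<le> w - e * wt S"
proof -
  obtain T where "T \<in> reach (e * int c) S" "v T \<noteq> 0"
    using E_nonzero[of v S c] assms by (auto simp: bounded_def)
  then show ?thesis using wt_reach[of T c S] v by (force simp: bounded_def)
qed

lemma U_eq:
  assumes v: "bounded w v" and S: "maya S" and K: "w - e * wt S \<le> int K"
  shows "U v S = (\<Sum>c\<le>K. E c v S)"
  unfolding U_eq_aux[OF v S]
proof (rule sum.mono_neutral_left)
  show "\<forall>c\<in>{..K} - {..lim w S}. E c v S = 0"
  proof
    fix c assume "c \<in> {..K} - {..lim w S}"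
    then have "\<not> int c \<le> w - e * wt S" by (auto simp: lim_def le_nat_iff)
    then show "E c v S = 0" using E_bound[OF v S, of c] by auto
  qed
qed (use K in \<open>auto simp: lim_def\<close>)

lemma U_fock: "v \<in> fock \<Longrightarrow> U v \<in> fock"
proof -
  assume v: "v \<in> fock"
  have f: "(A ^^ k) v \<in> fock" for k by (induction k) (auto simp: v A_fock)
  have "U v S = 0" if "\<not> maya S" for S
    using fock_zero[OF f that] by (simp add: U_def op_exp_def)
  then show ?thesis by (auto simp: fock_def)
qed

lemma U_nonzero:
  assumes "bounded w v" "U v S \<noteq> 0"
  shows "\<exists>c. \<exists>T\<in>reach (e * int c) S. v T \<noteq> 0"
proof -
  have f: "v \<in> fock" using assms by (simp add: bounded_def)
  have S: "maya S" using U_fock[OF f] assms by (auto simp: fock_def)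
  have "\<exists>c. E c v S \<noteq> 0"
    using assms(2) unfolding U_eq_aux[OF assms(1) S] by (metis sum.neutral)
  then show ?thesis using E_nonzero[OF f S] by blast
qed

lemma U_bounded: "bounded w v \<Longrightarrow> bounded w (U v)"
proof -
  assume v: "bounded w v"
  have "e * wt S \<le> w" if U: "U v S \<noteq> 0" for S
  proof -
    obtain c T where T: "T \<in> reach (e * int c) S" "v T \<noteq> 0" using U_nonzero[OF v U] by blast
    then have "e * wt T \<le> w" using v by (auto simp: bounded_def)
    then show ?thesis using wt_reach[OF T(1)] by simp
  qed
  then show ?thesis using U_fock v by (auto simp: bounded_def)
qed

lemma psi_bounded: "bounded w v \<Longrightarrow> bounded (w + e * n) (psi n v)"
proof -
  assume v: "bounded w v"
  have f: "psi n v \<in> fock" using v psi_fock by (auto simp: bounded_def)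
  have "e * wt S \<le> w + e * n" if "psi n v S \<noteq> 0" for S
  proof -
    have S: "maya S" "n \<in> S" "v (S - {n}) \<noteq> 0" using f that by (auto simp: fock_def psi_def when_def split: if_splits)
    then have "e * wt (S - {n}) \<le> w" using v by (auto simp: bounded_def)
    then show ?thesis using wt_charge_remove(1)[OF S(1,2)] by (simp add: algebra_simps)
  qed
  then show ?thesis using f by (simp add: bounded_def)
qed

lemma U_sum:
  assumes v: "\<And>i. i \<in> I \<Longrightarrow> bounded w (v i)" and S: "maya S"
  shows "U (\<lambda>T. \<Sum>i\<in>I. x i * v i T) S = (\<Sum>i\<in>I. x i * U (v i) S)"
proof -
  have f: "v i \<in> fock" if "i \<in> I" for i using v[OF that] by (simp add: bounded_def)
  have b: "bounded w (\<lambda>T. \<Sum>i\<in>I. x i * v i T)"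
    unfolding bounded_def
  proof (intro conjI allI impI)
    show "(\<lambda>T. \<Sum>i\<in>I. x i * v i T) \<in> fock" using f by (rule sum_fock)
    fix S assume "(\<Sum>i\<in>I. x i * v i S) \<noteq> 0"
    then obtain i where "i \<in> I" "x i * v i S \<noteq> 0" by (rule sum.not_neutral_contains_not_neutral)
    then show "e * wt S \<le> w" using v by (auto simp: bounded_def)
  qed
  have "U (\<lambda>T. \<Sum>i\<in>I. x i * v i T) S = (\<Sum>c\<le>lim w S. \<Sum>i\<in>I. x i * E c (v i) S)"
    unfolding U_eq_aux[OF b S] by (intro sum.cong refl E_sum f S)
  also have "\<dots> = (\<Sum>i\<in>I. x i * U (v i) S)"
    by (subst sum.swap) (simp add: U_eq_aux[OF v S] sum_distrib_left)
  finally show ?thesis .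
qed

lemma U_psi:
  assumes v: "bounded w v" and S: "maya S" and K: "w + e * n - e * wt S \<le> int K"
  shows "U (psi n v) S = (\<Sum>k\<le>K. Q k * psi (n - e * int k) (U v) S)"
proof -
  have f: "v \<in> fock" using v by (simp add: bounded_def)
  have "U (psi n v) S = (\<Sum>c\<le>K. \<Sum>(a, b)\<in>dec c. Q a * psi (n - e * int a) (E b v) S)"
    unfolding U_eq[OF psi_bounded[OF v] S K] by (intro sum.cong refl E_psi f S)
  also have "\<dots> = (\<Sum>a\<le>K. \<Sum>b\<le>K - a. Q a * psi (n - e * int a) (E b v) S)"
    by (rule sum_triangle[symmetric])
  also have "\<dots> = (\<Sum>a\<le>K. Q a * psi (n - e * int a) (U v) S)"
  proof (rule sum.cong[OF refl])
    fix a assume a: "a \<in> {..K}"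
    let ?s = "n - e * int a"
    show "(\<Sum>b\<le>K - a. Q a * psi ?s (E b v) S) = Q a * psi ?s (U v) S"
    proof (cases "?s \<in> S")
      case True
      \<comment> \<open>Removing the site \<open>n - e * int a\<close> changes \<open>e * wt\<close>
        by \<open>e * n - a\<close>; this is exactly why degrees up to \<open>K - a\<close> are
        enough for the inner vector.\<close>
      have "w - e * wt (S - {?s}) \<le> int (K - a)"
        using K a wt_charge_remove(1)[OF S True] by (simp add: right_diff_distrib ee)
      then have "U v (S - {?s}) = (\<Sum>b\<le>K - a. E b v (S - {?s}))"
        using S by (intro U_eq[OF v]) auto
      then show ?thesis using True by (simp add: psi_def sum_distrib_left)
    qed (simp add: psi_def)
  qed
  finally show ?thesis .
qed

lemma bounded_finite:
  assumes "v \<in> fock" "finite {S. v S \<noteq> 0}"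
  obtains w where "bounded w v"
proof -
  have "bounded (Max (insert 0 ((\<lambda>S. e * wt S) ` {S. v S \<noteq> 0}))) v"
    using assms by (auto simp: bounded_def intro!: Max_ge)
  then show ?thesis by (rule that)
qed

definition qQ :: "int \<Rightarrow> scalar" where
  "qQ z = (if z \<ge> 0 then Q (nat z) else 0)"

text \<open>For \<open>e = 1\<close> this is \<open>E_vac\<close>. For \<open>e = - 1\<close> charge
  is preserved, and a diagram containing the sea with the same charge is the sea, which leaves only
  degree 0.\<close>

lemma U_vac:
  assumes S: "maya S" and ok: "e = 1 \<or> {..<l} \<subseteq> S"
  shows "U (ket {..<l}) S = ket {..<l} S"
proof -
  have k: "ket {..<l} \<in> fock" using maya_lessThan by (auto simp: ket_def fock_def)
  have "finite {S. ket {..<l} S \<noteq> 0}" by (rule finite_subset[of _ "{{..<l}}"]) (auto simp: ket_def when_def)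
  then obtain w where w: "bounded w (ket {..<l})" using bounded_finite[OF k] by blast
  have "E c (ket {..<l}) S = (if c = 0 then ket {..<l} S else 0)" for c
  proof (cases "c = 0 \<or> e = 1")
    case True
    then show ?thesis using E_vac[OF _ S] E_0 by auto
  next
    case False
    show ?thesis
    proof (rule ccontr)
      assume "\<not> ?thesis"
      then have "E c (ket {..<l}) S \<noteq> 0" using False by auto
      from E_nonzero[OF k S this] have T: "{..<l} \<in> reach (e * int c) S"
        by (auto simp: ket_def when_def split: if_splits)
      then have "charge S = charge {..<l}" by (simp add: reach_def)
      then have "S = {..<l}" using charge_eq_window[OF S] ok False by auto
      then show False using wt_reach[OF T] False by simp
    qed
  qed
  then show ?thesis unfolding U_eq_aux[OF w S] by simp
qed

text \<open>Each fermion is conjugated by the exponential, so each row is convolved with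
  \<open>Q\<close>. For \<open>e = - 1\<close> the window condition is needed because the
  exponential does change \<open>|-N\<rangle>\<close> at diagrams with deeper holes.\<close>

lemma U_wedge_vec:
  assumes r: "\<And>i n. i < L \<Longrightarrow> n > M \<Longrightarrow> r i n = 0"
    and S: "maya S" and ok: "e = 1 \<or> {..<- int N} \<subseteq> S"
  shows "U (wedge_vec N L r) S = wedge_vec N L (\<lambda>i s. \<Sum>n\<in>{- int N..M}. r i n * qQ (e * (n - s))) S"
  using r S ok
proof (induction L arbitrary: r S)
  case 0
  then show ?case unfolding wedge_vec_0 by (intro U_vac)
next
  case (Suc L)
  let ?r = "\<lambda>i. r (Suc i)"
  let ?t = "\<lambda>a s. \<Sum>n\<in>{- int N..M}. a n * qQ (e * (n - s))"
  let ?W = "wedge_vec N L ?r" and ?W' = "wedge_vec N L (\<lambda>i. ?t (?r i))"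
  let ?F = "S \<inter> {- int N..}"
  have F: "finite ?F"
  proof -
    obtain u where "S \<subseteq> {..u}" using maya_bounds[OF Suc.prems(2)] by metis
    then have "?F \<subseteq> {- int N..u}" by auto
    then show ?thesis using finite_subset by blast
  qed
  obtain w0 where w0: "bounded w0 ?W"
    using bounded_finite[OF wedge_vec_fock finite_wedge_vec_support[of L M ?r]] Suc.prems(1) by (metis Suc_less_eq)
  \<comment> \<open>The range reaches up to \<open>max M 0\<close> so that the maximum is over a
    nonempty set.\<close>
  define w where "w = Max ((\<lambda>n. w0 + e * n) ` {- int N..max M 0})"
  have w: "bounded w (psi n ?W)" if "n \<in> {- int N..M}" for n
  proof -
    have "w0 + e * n \<le> w" unfolding w_def by (rule Max_ge) (use that in auto)
    then show ?thesis using psi_bounded[OF w0, of n] by (force simp: bounded_def)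
  qed
  have psi: "psi s (U ?W) S = psi s ?W' S" if "- int N \<le> s \<or> e = 1" for s
  proof (cases "s \<in> S")
    case True
    have "U ?W (S - {s}) = ?W' (S - {s})"
      using Suc.prems that by (intro Suc.IH) auto
    then show ?thesis by (simp add: psi_def)
  qed (simp add: psi_def)
  have one: "U (psi n ?W) S = (\<Sum>s\<in>?F. qQ (e * (n - s)) * psi s ?W' S)" if n: "n \<in> {- int N..M}" for n
  proof -
    \<comment> \<open>The first summand meets the degree bound of \<open>U_psi\<close>; the second
      makes every site of \<open>?F\<close> on the relevant side of \<open>n\<close> reachable as
      \<open>n - e * int k\<close> with \<open>k \<le> K\<close>.\<close>
    define K where "K = nat (w0 + e * n - e * wt S) + (\<Sum>s\<in>?F. nat \<bar>n - s\<bar>)"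
    have K: "nat \<bar>n - s\<bar> \<le> K" if "s \<in> ?F" for s
      using member_le_sum[of s ?F "\<lambda>s. nat \<bar>n - s\<bar>"] F that by (simp add: K_def)
    have "U (psi n ?W) S = (\<Sum>k\<le>K. Q k * psi (n - e * int k) (U ?W) S)"
      by (rule U_psi[OF w0 Suc.prems(2)]) (unfold K_def of_nat_add, linarith)
    also have "\<dots> = (\<Sum>k\<le>K. Q k * psi (n - e * int k) ?W' S)"
    proof (rule sum.cong[OF refl])
      fix k
      have "- int N \<le> n - e * int k \<or> e = 1" using n e_cases by auto
      then show "Q k * psi (n - e * int k) (U ?W) S = Q k * psi (n - e * int k) ?W' S"
        by (simp only: psi)
    qed
    also have "\<dots> = (\<Sum>s\<in>?F. qQ (e * (n - s)) * psi s ?W' S)"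
    \<comment> \<open>The substitution is \<open>s = n - e * int k\<close>. Values outside
      \<open>?F\<close> contribute nothing, and sites on the wrong side of \<open>n\<close> are
      killed by \<open>qQ\<close>.\<close>
    proof (rule sum.reindex_bij_witness_not_neutral[where i = "\<lambda>s. nat (e * (n - s))" and j = "\<lambda>k. n - e * int k"
        and S' = "{k \<in> {..K}. n - e * int k \<notin> ?F}" and T' = "{s \<in> ?F. e * (n - s) < 0}"])
      show "finite {k \<in> {..K}. n - e * int k \<notin> ?F}" by simp
      show "finite {s \<in> ?F. e * (n - s) < 0}" by (rule finite_subset[OF _ F]) auto
    next
      fix k assume "k \<in> {..K} - {k \<in> {..K}. n - e * int k \<notin> ?F}"
      then show "nat (e * (n - (n - e * int k))) = k" "n - e * int k \<in> ?F - {s \<in> ?F. e * (n - s) < 0}"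
        by (auto simp: ee)
    next
      fix s assume s: "s \<in> ?F - {s \<in> ?F. e * (n - s) < 0}"
      then have z: "e * (n - s) \<ge> 0" by auto
      then show "n - e * int (nat (e * (n - s))) = s" by (simp add: ee)
      then show "nat (e * (n - s)) \<in> {..K} - {k \<in> {..K}. n - e * int k \<notin> ?F}"
        using K[of s] s e_cases by auto
    next
      fix k assume "k \<in> {k \<in> {..K}. n - e * int k \<notin> ?F}"
      then show "Q k * psi (n - e * int k) ?W' S = 0"
        using psi_wedge_vec_low[of "n - e * int k" N] by (cases "n - e * int k \<in> S") (auto simp: psi_def not_le)
    next
      fix s assume "s \<in> {s \<in> ?F. e * (n - s) < 0}"
      then show "qQ (e * (n - s)) * psi s ?W' S = 0" by (simp add: qQ_def)
    next
      fix k
      show "qQ (e * (n - (n - e * int k))) * psi (n - e * int k) ?W' S = Q k * psi (n - e * int k) ?W' S"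
        by (simp add: qQ_def ee)
    qed
    finally show ?thesis .
  qed
  have "wedge_vec N (Suc L) r = (\<lambda>S. \<Sum>n\<in>{- int N..M}. r 0 n * psi n ?W S)"
    using Suc.prems(1) by (intro ext wedge_vec_Suc_bounded) auto
  then have "U (wedge_vec N (Suc L) r) S = (\<Sum>n\<in>{- int N..M}. r 0 n * U (psi n ?W) S)"
    by (simp only:) (rule U_sum[OF w Suc.prems(2)])
  also have "\<dots> = (\<Sum>n\<in>{- int N..M}. \<Sum>s\<in>?F. r 0 n * (qQ (e * (n - s)) * psi s ?W' S))"
    by (intro sum.cong refl) (simp add: one sum_distrib_left)
  also have "\<dots> = (\<Sum>s\<in>?F. ?t (r 0) s * psi s ?W' S)"
    by (subst sum.swap) (simp add: sum_distrib_right mult.assoc)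
  also have "\<dots> = wedge_vec N (Suc L) (\<lambda>i. ?t (r i)) S"
    by (rule wedge_vec_Suc[symmetric]) (use F in auto)
  finally show ?case .
qed

end

section \<open>Partitions and Maya diagrams\<close>

definition beta_num :: "nat list \<Rightarrow> nat \<Rightarrow> int" where
  "beta_num p i = int (part p i) - int (Suc i)"

definition dgm :: "nat list \<Rightarrow> int set" where
  "dgm p = range (beta_num p)"

lemma part_antimono: "is_partition p \<Longrightarrow> i \<le> j \<Longrightarrow> part p j \<le> part p i"
  by (cases "i = j") (auto simp: is_partition_def part_def sorted_wrt_iff_nth_less)

lemma part_nonzero: "is_partition p \<Longrightarrow> part p i \<noteq> 0 \<longleftrightarrow> i < length p"
  using nth_mem[of i p] by (cases "p ! i = 0") (auto simp: is_partition_def part_def)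

lemma beta_num_less: "is_partition p \<Longrightarrow> i < j \<Longrightarrow> beta_num p j < beta_num p i"
  using part_antimono[of p i j] by (simp add: beta_num_def)

lemma beta_num_eq_iff: "is_partition p \<Longrightarrow> beta_num p i = beta_num p j \<longleftrightarrow> i = j"
  using beta_num_less[of p i j] beta_num_less[of p j i] by (cases i j rule: linorder_cases) auto

lemma beta_num_ge: "i < N \<Longrightarrow> - int N \<le> beta_num p i"
  by (simp add: beta_num_def)

lemma beta_num_tail: "length p \<le> i \<Longrightarrow> beta_num p i = - int (Suc i)"
  by (simp add: beta_num_def part_def)

lemma dgm_window:
  assumes "length p \<le> N"
  shows "{..<- int N} \<subseteq> dgm p" "dgm p \<inter> {- int N..} = beta_num p ` {..<N}"
proof -
  show "{..<- int N} \<subseteq> dgm p"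
  proof
    fix x assume "x \<in> {..<- int N}"
    then have "beta_num p (nat (- x - 1)) = x"
      using assms by (subst beta_num_tail) auto
    then show "x \<in> dgm p" unfolding dgm_def by (metis rangeI)
  qed
  have "beta_num p i < - int N" if "\<not> i < N" for i
    using that assms by (subst beta_num_tail) auto
  then show "dgm p \<inter> {- int N..} = beta_num p ` {..<N}"
    using beta_num_ge[of _ N p] by (fastforce simp: dgm_def)
qed

lemma charge_lessThan: "charge {..<- int N} = - int N"
proof -
  have "charge {..<0} = charge {..<- int N} + int (card ({..<0} - {..<- int N}))"
    by (rule charge_subset[OF maya_lessThan]) (auto intro: finite_subset[of _ "{- int N..<0}"])
  moreover have "{..<0} - {..<- int N} = {- int N..<0}" "{..<0::int} \<inter> {0..} = {}" by auto
  ultimately show ?thesis by (simp add: charge_def[of "{..<0}"])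
qed

lemma charge_window:
  assumes "{..<- int N} \<subseteq> S" "finite (S \<inter> {- int N..})"
  shows "charge S = int (card (S \<inter> {- int N..})) - int N"
proof -
  have "S - {..<- int N} = S \<inter> {- int N..}" by auto
  then show ?thesis
    using charge_subset[OF maya_lessThan assms(1)] assms(2) by (simp add: charge_lessThan)
qed

lemma maya_dgm: "maya (dgm p)"
  using dgm_window[OF order_refl, of p] maya_window[of "- int (length p)" "dgm p"] by simp

lemma wt_dgm:
  assumes p: "is_partition p" and N: "length p \<le> N"
  shows "wt (dgm p) = wt {..<- int N} + (\<Sum>i<N. beta_num p i)"
proof -
  have "wt ({..<- int N} \<union> beta_num p ` {..<k}) = wt {..<- int N} + (\<Sum>i<k. beta_num p i)" if "k \<le> N" for k
    using that
  proof (induction k)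
    case (Suc k)
    have "maya ({..<- int N} \<union> beta_num p ` {..<k})"
    proof -
      have "{..<- int N} \<inter> {- int N..} = {}" by auto
      then show ?thesis
        using maya_window[of "- int N" "{..<- int N} \<union> beta_num p ` {..<k}"] by (simp add: Int_Un_distrib2)
    qed
    moreover have "beta_num p k \<notin> {..<- int N} \<union> beta_num p ` {..<k}"
      using beta_num_ge[of k N p] Suc.prems beta_num_eq_iff[OF p] by auto
    ultimately show ?case using Suc wt_charge_insert(1) by (simp add: lessThan_Suc)
  qed simp
  moreover have "dgm p = {..<- int N} \<union> (dgm p \<inter> {- int N..})"
    using dgm_window(1)[OF N] by auto
  ultimately show ?thesis
    using dgm_window(2)[OF N] by simp
qed

text \<open>A strictly decreasing sequence is determined by its range, hence the beta numbers by the
  diagram, and dropping zero parts makes the list unique.\<close>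

lemma dgm_inj:
  assumes p: "is_partition p" and q: "is_partition q" and eq: "dgm p = dgm q"
  shows "p = q"
proof -
  have le: "beta_num a i \<le> beta_num b i"
    if a: "is_partition a" and b: "is_partition b" and "dgm a = dgm b"
      and below: "\<And>j. j < i \<Longrightarrow> beta_num a j = beta_num b j" for a b i
  proof -
    obtain j where j: "beta_num a i = beta_num b j"
      using \<open>dgm a = dgm b\<close> by (auto simp: dgm_def)
    have "\<not> j < i" using below[of j] j beta_num_eq_iff[OF a, of i j] by auto
    then show ?thesis using j beta_num_less[OF b, of i j] by (cases "i = j") auto
  qed
  have b: "beta_num p i = beta_num q i" for i
  proof (induction i rule: less_induct)
    case (less i)
    have "beta_num p i \<le> beta_num q i" by (rule le[OF p q eq]) (rule less.IH)
    moreover have "beta_num q i \<le> beta_num p i" by (rule le[OF q p eq[symmetric]]) (simp add: less.IH)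
    ultimately show ?case by simp
  qed
  then have part: "part p i = part q i" for i
    using b[of i] by (simp add: beta_num_def)

  have len_iff: "i < length p \<longleftrightarrow> i < length q" for i using part_nonzero[OF p, of i] part_nonzero[OF q, of i] part[of i] by simp
  have len: "length p = length q" using len_iff[of "length p"] len_iff[of "length q"] by simp
  have "p ! i = q ! i" if "i < length p" for i
    using part[of i] that len by (simp add: part_def)
  then show ?thesis by (rule nth_equalityI[OF len])
qed

text \<open>Charge 0 means that exactly \<open>N\<close> sites at or above \<open>-N\<close> are
  occupied, so their decreasing enumeration \<open>f\<close> satisfies
  \<open>f i \<ge> - int (Suc i)\<close> and yields nonnegative parts.\<close>

lemma dgm_surj:
  assumes S: "maya S" and c: "charge S = 0"
  obtains p where "is_partition p" "dgm p = S"
proof -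
  obtain l where l: "{..<l} \<subseteq> S" using maya_bounds[OF S] by metis
  define N where "N = nat (- l)"
  have w: "{..<- int N} \<subseteq> S" using l by (auto simp: N_def)
  define Y where "Y = S \<inter> {- int N..}"
  have Y: "finite Y" using S maya_window[OF w] by (simp add: Y_def)
  have card: "card Y = N" using charge_window[OF w] Y c by (simp add: Y_def)
  define f where "f i = rev (sorted_list_of_set Y) ! i" for i
  have len: "length (sorted_list_of_set Y) = N" using card by simp
  have dec: "f j < f i" if "i < j" "j < N" for i j
    using that len strict_sorted_list_of_set[of Y]
    by (auto simp: f_def rev_nth sorted_wrt_iff_nth_less)
  have fY: "f ` {..<N} = Y"
  proof -
    have "f ` {..<N} = set (rev (sorted_list_of_set Y))"
      unfolding set_conv_nth f_def using len by auto
    then show ?thesis using Y by simp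
  qed
  have gap: "f (i + d) + int d \<le> f i" if "i + d < N" for i d
    using that
  proof (induction d)
    case (Suc d)
    then show ?case using dec[of "i + d" "i + Suc d"] by simp
  qed simp
  have ge: "f i + int (Suc i) \<ge> 0" if "i < N" for i
  proof -
    have "f (N - 1) \<in> Y" using imageI[of "N - 1" "{..<N}" f] that fY by auto
    then have "f (N - 1) \<ge> - int N" by (simp add: Y_def)
    then show ?thesis using gap[of i "N - 1 - i"] that by simp
  qed
  define q where "q i = nat (f i + int (Suc i))" for i
  have q: "int (q i) = f i + int (Suc i)" if "i < N" for i using ge[OF that] by (simp add: q_def)
  have anti: "q j \<le> q i" if "i \<le> j" "j < N" for i j
    using gap[of i "j - i"] that q[of i] q[of j] by simp
  \<comment> \<open>The parts decrease weakly, so cutting at the first zero removes precisely the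
    zero parts.\<close>
  define p where "p = takeWhile (\<lambda>x. x \<noteq> 0) (map q [0..<N])"
  have lp: "length p \<le> N" unfolding p_def by (metis length_map length_takeWhile_le length_upt minus_nat.diff_0)
  have pn: "p ! i = q i" if "i < length p" for i
    using that lp by (simp add: p_def takeWhile_nth)
  have part: "part p i = q i" if "i < N" for i
  proof (cases "i < length p")
    case False
    then have L: "length p < N" "length p \<le> i" using that by auto
    then have "q (length p) = 0"
      using nth_length_takeWhile[of "\<lambda>x. x \<noteq> 0" "map q [0..<N]"] by (simp add: p_def)
    then show ?thesis using anti[OF L(2) that] False by (simp add: part_def)
  qed (simp add: part_def pn)
  have "is_partition p"
    unfolding is_partition_def
  proof
    show "sorted_wrt (\<ge>) p" unfolding sorted_wrt_iff_nth_less using pn anti lp by auto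
    show "0 \<notin> set p" unfolding p_def by (auto dest: set_takeWhileD)
  qed
  moreover have "dgm p = S"
  proof -
    have "beta_num p i = f i" if "i < N" for i
      using part[OF that] q[OF that] by (simp add: beta_num_def)
    then have "beta_num p ` {..<N} = f ` {..<N}"
      by (intro image_cong refl) simp
    then have "dgm p \<inter> {- int N..} = S \<inter> {- int N..}"
      using dgm_window[OF lp] fY by (simp add: Y_def)
    moreover have "T = {..<- int N} \<union> (T \<inter> {- int N..})" if "{..<- int N} \<subseteq> T" for T
      using that by auto
    ultimately show ?thesis using dgm_window(1)[OF lp] w by metis
  qed
  ultimately show thesis by (rule that)
qed

lemma sign_above_lessThan: "{k \<in> {..<a}. b < k} = {}" if "a \<le> b + 1" for a b :: int
  using that by auto

lemma psi_star_ket_lessThan: "psi_star a (ket {..<a + 1}) = ket {..<a}"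
proof -
  have "psi_star a (\<lambda>T. 1 * ket {..<a + 1} T) = (\<lambda>T. above_sign a {..<a + 1} * 1 * ket ({..<a + 1} - {a}) T)"
    by (rule psi_star_ket) simp
  moreover have "{..<a + 1} - {a} = {..<a}" by auto
  ultimately show ?thesis
    unfolding above_sign_def by (subst (asm) sign_above_lessThan) simp_all
qed

lemma psi_ket_lessThan: "psi a (ket {..<a}) = ket {..<a + 1}"
proof -
  have "psi a (\<lambda>T. 1 * ket {..<a} T) = (\<lambda>T. above_sign a {..<a} * 1 * ket (insert a {..<a}) T)"
    by (rule psi_ket) simp
  moreover have "insert a {..<a} = {..<a + 1}" by auto
  ultimately show ?thesis
    unfolding above_sign_def by (subst (asm) sign_above_lessThan) simp_all
qed

lemma cket_eq: "cket r = ket {..<- int r}"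
proof (induction r)
  case 0
  then show ?case by (simp add: cket_def vac_def)
next
  case (Suc r)
  have "[- int (Suc r)..- 1] = (- int (Suc r)) # [- int r..- 1]"
    by (subst upto_rec1) auto
  then have "cket (Suc r) = psi_star (- int (Suc r)) (cket r)" by (simp add: cket_def)
  then show ?case using psi_star_ket_lessThan[of "- int (Suc r)"] by (simp add: Suc)
qed

lemma ket_fock: "maya S \<Longrightarrow> ket S \<in> fock"
  by (auto simp: ket_def fock_def when_def)



section \<open>Powers of the generating series, and fermions alternating with exponentials\<close>

definition fps_nth_int :: "scalar fps \<Rightarrow> int \<Rightarrow> scalar" where
  "fps_nth_int F z = (if z \<ge> 0 then fps_nth F (nat z) else 0)"

text \<open>The summation set may be any finite set that omits only vanishing terms; this lets the
  windows forced by the diagrams stand in for the natural range.\<close>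

lemma fps_nth_int_conv:
  assumes "finite I" "\<And>u. b \<le> u \<Longrightarrow> u \<le> a \<Longrightarrow> u \<notin> I \<Longrightarrow> fps_nth_int F (a - u) * fps_nth_int H (u - b) = 0"
  shows "(\<Sum>u\<in>I. fps_nth_int F (a - u) * fps_nth_int H (u - b)) = fps_nth_int (F * H) (a - b)"
proof -
  have "(\<Sum>u\<in>I. fps_nth_int F (a - u) * fps_nth_int H (u - b)) = (\<Sum>u\<in>{b..a}. fps_nth_int F (a - u) * fps_nth_int H (u - b))"
    by (rule sum.mono_neutral_cong) (use assms in \<open>auto simp: fps_nth_int_def\<close>)
  also have "\<dots> = fps_nth_int (F * H) (a - b)"
  proof (cases "b \<le> a")
    case True
    have e: "nat (a - int j - b) = nat (a - b) - j" for j by linarith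
    have "fps_nth_int (F * H) (a - b) = (\<Sum>j=0..nat (a - b). fps_nth F j * fps_nth H (nat (a - b) - j))"
      using True by (simp add: fps_nth_int_def fps_mult_nth)
    also have "\<dots> = (\<Sum>u\<in>{b..a}. fps_nth_int F (a - u) * fps_nth_int H (u - b))"
      by (rule sum.reindex_bij_witness[where i = "\<lambda>u. nat (a - u)" and j = "\<lambda>j. a - int j"])
        (use True in \<open>auto simp: fps_nth_int_def e\<close>)
    finally show ?thesis ..
  qed (simp add: fps_nth_int_def)
  finally show ?thesis .
qed

context ngraded
begin

text \<open>A fermion standing to the right of \<open>i\<close> exponentials is convolved
  \<open>i\<close> times with \<open>Q\<close>, hence the \<open>i\<close>-th power.\<close>

definition cf :: "nat \<Rightarrow> int \<Rightarrow> scalar" where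
  "cf i = fps_nth_int (Abs_fps Q ^ i)"

lemma cf_0: "cf 0 z = (1 when z = 0)"
  by (auto simp: cf_def fps_nth_int_def)

lemma cf_Suc:
  assumes I: "finite I" "\<And>n. 0 \<le> e * (m - n) \<Longrightarrow> 0 \<le> e * (n - s) \<Longrightarrow> n \<notin> I \<Longrightarrow> cf i (e * (m - n)) = 0"
  shows "(\<Sum>n\<in>I. cf i (e * (m - n)) * qQ (e * (n - s))) = cf (Suc i) (e * (m - s))"
proof -
  have q: "qQ z = fps_nth_int (Abs_fps Q) z" for z by (simp add: qQ_def fps_nth_int_def)
  show ?thesis
    using e_cases
  proof
    assume e: "e = 1"
    have "(\<Sum>n\<in>I. fps_nth_int (Abs_fps Q ^ i) (m - n) * fps_nth_int (Abs_fps Q) (n - s)) = fps_nth_int (Abs_fps Q ^ i * Abs_fps Q) (m - s)"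
      by (rule fps_nth_int_conv[OF I(1)]) (use I(2) in \<open>simp add: e cf_def\<close>)
    then show ?thesis by (simp add: e cf_def q mult.commute)
  next
    assume e: "e = - 1"
    have "(\<Sum>n\<in>I. fps_nth_int (Abs_fps Q) (s - n) * fps_nth_int (Abs_fps Q ^ i) (n - m)) = fps_nth_int (Abs_fps Q * Abs_fps Q ^ i) (s - m)"
      by (rule fps_nth_int_conv[OF I(1)]) (use I(2) in \<open>simp add: e cf_def\<close>)
    then show ?thesis by (simp add: e cf_def q mult.commute)
  qed
qed

lemma bounded_mono: "bounded w v \<Longrightarrow> w \<le> w' \<Longrightarrow> bounded w' v"
  by (force simp: bounded_def)

lemma bounded_ket: "maya S \<Longrightarrow> bounded (e * wt S) (ket S)"
proof -
  assume S: "maya S"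
  have "T = S" if "ket S T \<noteq> 0" for T using that by (auto simp: ket_def when_def split: if_splits)
  then show ?thesis using ket_fock[OF S] by (auto simp: bounded_def)
qed

lemma U_agree:
  assumes v: "bounded w v" and u: "bounded w u" and S: "maya S" and ok: "e = 1 \<or> {..<l} \<subseteq> S"
    and eq: "\<And>T. maya T \<Longrightarrow> e = 1 \<or> {..<l} \<subseteq> T \<Longrightarrow> v T = u T"
  shows "U v S = U u S"
  unfolding U_eq_aux[OF v S] U_eq_aux[OF u S]
proof (rule sum.cong[OF refl], rule E_agree)
  fix c T assume T: "T \<in> reach (e * int c) S"
  have "e = 1 \<or> {..<l} \<subseteq> T"
  proof (cases "e = 1")
    case False
    then have "max 0 (e * int c) = 0" "{..<l} \<subseteq> S" using e_cases ok by auto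
    then show ?thesis using T by (auto simp: reach_def)
  qed simp
  then show "v T = u T" by (rule eq[OF reach_maya[OF T]])
qed (use v u S in \<open>auto simp: bounded_def\<close>)

text \<open>The common shape of \<open>ket_G\<close> and \<open>ket_g\<close>, truncated to the
  factors from \<open>k\<close> on so that induction can add one fermion at the left.\<close>

definition fold_psi :: "(nat \<Rightarrow> int) \<Rightarrow> nat \<Rightarrow> nat \<Rightarrow> vec" where
  "fold_psi m N k = foldr (\<lambda>i v. psi (m i) (U v)) [k..<N] (ket {..<- int N})"

lemma fold_psi_simps:
  "fold_psi m N N = ket {..<- int N}"
  "k < N \<Longrightarrow> fold_psi m N k = psi (m k) (U (fold_psi m N (Suc k)))"
  by (simp_all add: fold_psi_def upt_conv_Cons)

lemma fold_psi_bounded: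
  "k \<le> N \<Longrightarrow> bounded (e * (wt {..<- int N} + (\<Sum>i=k..<N. m i))) (fold_psi m N k)"
proof (induction rule: inc_induct)
  case base
  show ?case by (simp add: fold_psi_simps bounded_ket maya_lessThan)
next
  case (step k)
  from psi_bounded[OF U_bounded[OF step.IH], of "m k"] show ?case
    using step.hyps by (simp add: fold_psi_simps sum.atLeast_Suc_lessThan algebra_simps)
qed

text \<open>By downward induction on \<open>k\<close>: a further exponential raises the power in
  every row by one, and the new fermion enters as a delta row with power 0. The bound
  \<open>M\<close> keeps all rows finitely supported above.\<close>

lemma fold_psi_eq_wedge_vec:
  assumes M: "\<And>i j n. i < N \<Longrightarrow> j < N \<Longrightarrow> n > M \<Longrightarrow> cf i (e * (m j - n)) = 0"
    and m: "\<And>j. j < N \<Longrightarrow> - int N \<le> m j"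
    and k: "k \<le> N" and S: "maya S" and ok: "e = 1 \<or> {..<- int N} \<subseteq> S"
  shows "fold_psi m N k S = wedge_vec N (N - k) (\<lambda>i s. cf i (e * (m (k + i) - s))) S"
  using k S ok
proof (induction k arbitrary: S rule: inc_induct)
  case base
  show ?case by (simp add: fold_psi_simps wedge_vec_0)
next
  case (step k)
  let ?v = "fold_psi m N (Suc k)" and ?r = "\<lambda>i s. cf i (e * (m (Suc k + i) - s))"
  let ?W = "wedge_vec N (N - Suc k) ?r"
  have r: "?r i n = 0" if "i < N - Suc k" "n > M" for i n
    using that by (intro M) auto
  have fin: "finite {S. ?W S \<noteq> 0}"
    by (rule finite_wedge_vec_support[of _ M]) (rule r)
  obtain w1 where w1: "bounded w1 ?W"
    by (rule bounded_finite[OF wedge_vec_fock fin])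
  define w2 where "w2 = e * (wt {..<- int N} + (\<Sum>i=Suc k..<N. m i))"
  have w2: "bounded w2 ?v" unfolding w2_def by (rule fold_psi_bounded) (use step.hyps in simp)
  have U: "U ?v T = wedge_vec N (N - Suc k) (\<lambda>i s. cf (Suc i) (e * (m (Suc k + i) - s))) T"
    if T: "maya T" "e = 1 \<or> {..<- int N} \<subseteq> T" for T
  proof -
    have "U ?v T = U ?W T"
      by (rule U_agree[OF bounded_mono[OF w2 max.cobounded1] bounded_mono[OF w1 max.cobounded2] T])
        (rule step.IH)
    also have "\<dots> = wedge_vec N (N - Suc k) (\<lambda>i s. \<Sum>n\<in>{- int N..M}. ?r i n * qQ (e * (n - s))) T"
      by (rule U_wedge_vec[OF r T]) auto
    also have "\<dots> = wedge_vec N (N - Suc k) (\<lambda>i s. cf (Suc i) (e * (m (Suc k + i) - s))) T"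
    proof -
      have "(\<Sum>n\<in>{- int N..M}. ?r i n * qQ (e * (n - s))) = cf (Suc i) (e * (m (Suc k + i) - s))"
        if i: "i < N - Suc k" and s: "s \<in> T \<inter> {- int N..}" for i s
      proof (rule cf_Suc)
        fix n assume n: "0 \<le> e * (m (Suc k + i) - n)" "0 \<le> e * (n - s)" "n \<notin> {- int N..M}"
        \<comment> \<open>No term below the window is lost: for \<open>e = 1\<close> it would have
          to lie above \<open>s\<close>, for \<open>e = - 1\<close> above the mode itself, and both
          are at least \<open>- int N\<close>.\<close>
        have "- int N \<le> n"
          using e_cases
        proof
          assume "e = 1"
          then show ?thesis using n(2) s by auto
        next
          assume "e = - 1"
          moreover have "- int N \<le> m (Suc k + i)" by (rule m) (use i in simp)
          ultimately show ?thesis using n(1) by simp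
        qed
        then show "cf i (e * (m (Suc k + i) - n)) = 0" using r[OF i] n(3) by auto
      qed simp
      then have "wedge (N - Suc k) (\<lambda>i s. \<Sum>n\<in>{- int N..M}. ?r i n * qQ (e * (n - s))) (T \<inter> {- int N..}) =
          wedge (N - Suc k) (\<lambda>i s. cf (Suc i) (e * (m (Suc k + i) - s))) (T \<inter> {- int N..})"
        by (rule wedge_cong)
      then show ?thesis by (simp only: wedge_vec_def)
    qed
    finally show ?thesis .
  qed
  have mk: "- int N \<le> m k" using m step.hyps by simp
  have "psi (m k) (U ?v) S = psi (m k) (wedge_vec N (N - Suc k) (\<lambda>i s. cf (Suc i) (e * (m (Suc k + i) - s)))) S"
  proof -
    have "e = 1 \<or> {..<- int N} \<subseteq> S - {m k}" using step.prems mk by auto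
    then show ?thesis using U[of "S - {m k}"] step.prems by (simp add: psi_def)
  qed
  also have "\<dots> = wedge_vec N (Suc (N - Suc k))
      (case_nat (\<lambda>n. 1 when n = m k) (\<lambda>i s. cf (Suc i) (e * (m (Suc k + i) - s)))) S"
    unfolding psi_wedge_vec[OF mk] ..
  also have "case_nat (\<lambda>n. 1 when n = m k) (\<lambda>i s. cf (Suc i) (e * (m (Suc k + i) - s))) =
      (\<lambda>i s. cf i (e * (m (k + i) - s)))"
  proof (intro ext)
    fix i s
    have "e * (m k - s) = 0 \<longleftrightarrow> s = m k" using e_cases by auto
    then show "case_nat (\<lambda>n. 1 when n = m k) (\<lambda>i s. cf (Suc i) (e * (m (Suc k + i) - s))) i s =
        cf i (e * (m (k + i) - s))"
      by (cases i) (simp_all add: cf_0)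
  qed
  finally show ?case using step.hyps(2) by (simp only: fold_psi_simps(2) Suc_diff_Suc)
qed

end

section \<open>The vectors \<open>|\<lambda>\<rangle>\<^sup>G\<close> and \<open>|\<mu>\<rangle>\<^sup>g\<close>\<close>

text \<open>The coefficients of \<open>log(1 + \<beta> t)\<close>; accordingly \<open>QG\<close> and
  \<open>Qg\<close> are those of \<open>1 + \<beta> t\<close> and of its inverse.\<close>

definition logP :: "nat \<Rightarrow> scalar" where
  "logP n = (if n = 0 then 0 else (- 1) ^ (n - 1) * \<beta> ^ n / of_nat n)"

definition QG :: "nat \<Rightarrow> scalar" where
  "QG n = (if n = 0 then 1 else if n = 1 then \<beta> else 0)"

definition Qg :: "nat \<Rightarrow> scalar" where
  "Qg n = (- \<beta>) ^ n"

lemma sum_dec_nat: "(\<Sum>(a, b)\<in>dec (c::nat). f a b) = (\<Sum>a\<le>c. f a (c - a))"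
  by (rule sum.reindex_bij_witness[where i = "\<lambda>a. (a, c - a)" and j = fst]) auto

lemma deg_logP: "of_nat n * logP n = (if n = 0 then 0 else (- 1) ^ (n - 1) * \<beta> ^ n)"
  by (simp add: logP_def)

interpretation G: ngraded logP QG "- 1"
proof unfold_locales
  fix c :: nat
  show "of_nat c * QG c = (\<Sum>(a, b)\<in>dec c. of_nat a * logP a * QG b)"
  proof (cases "c \<le> 1")
    case True
    then consider "c = 0" | "c = 1" by linarith
    then show ?thesis by cases (simp_all add: sum_dec_nat QG_def logP_def)
  next
    case False
    then obtain m where c: "c = Suc (Suc m)" by (metis One_nat_def Suc_le_mono le0 not0_implies_Suc)
    \<comment> \<open>Only \<open>b = 0\<close> and \<open>b = 1\<close> contribute, and the two
      terms cancel.\<close>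
    have "(\<Sum>(a, b)\<in>dec c. of_nat a * logP a * QG b) = (\<Sum>a\<in>{Suc m, c}. of_nat a * logP a * QG (c - a))"
      unfolding sum_dec_nat by (rule sum.mono_neutral_right) (auto simp: QG_def c)
    also have "\<dots> = 0"
    proof -
      have "of_nat (Suc m) * logP (Suc m) = (- 1) ^ m * \<beta> ^ Suc m"
        "of_nat c * logP c = (- 1) ^ Suc m * \<beta> ^ Suc (Suc m)"
        unfolding deg_logP by (simp_all add: c)
      moreover have "of_nat (Suc 0) = (1 :: scalar)" by simp
      ultimately show ?thesis by (simp add: c QG_def del: of_nat_Suc)
    qed
    finally show ?thesis using False by (simp add: QG_def)
  qed
qed (auto simp: finite_dec_nat logP_def QG_def)

interpretation g: ngraded "\<lambda>n. - logP n" Qg 1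
proof unfold_locales
  fix c :: nat
  \<comment> \<open>Each of the \<open>c\<close> terms with \<open>a > 0\<close> equals
    \<open>(- \<beta>) ^ c\<close>.\<close>
  have "(\<Sum>(a, b)\<in>dec c. of_nat a * - logP a * Qg b) = (\<Sum>a\<le>c. if a = 0 then 0 else (- \<beta>) ^ c)"
    unfolding sum_dec_nat
  proof (rule sum.cong[OF refl])
    fix a assume a: "a \<in> {..c}"
    show "of_nat a * - logP a * Qg (c - a) = (if a = 0 then 0 else (- \<beta>) ^ c)"
    proof (cases a)
      case (Suc b)
      have "of_nat a * - logP a = (- \<beta>) ^ a"
        using deg_logP[of a] Suc by (simp add: power_minus[of \<beta>])
      moreover have "(- \<beta>) ^ c = (- \<beta>) ^ a * (- \<beta>) ^ (c - a)"
        using a by (simp flip: power_add)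
      ultimately show ?thesis using Suc by (simp only: Qg_def) simp
    qed simp
  qed
  also have "\<dots> = of_nat c * Qg c"
    by (simp add: sum.atMost_shift Qg_def)
  finally show "of_nat c * Qg c = (\<Sum>(a, b)\<in>dec c. of_nat a * - logP a * Qg b)" ..
qed (auto simp: finite_dec_nat logP_def Qg_def)

lemma G_U: "G.U = op_exp Theta"
proof -
  have "G.A v S = Theta v S" for v S
    unfolding G.A_def Theta_def by (rule Sum_any.cong) (simp add: logP_def when_def)
  then have "G.A = Theta" by (intro ext)
  then show ?thesis by (intro ext) (simp only: G.U_def)
qed

lemma Sum_any_neg: "Sum_any (\<lambda>n. - f n) = - Sum_any (f :: _ \<Rightarrow> scalar)"
  by (simp add: Sum_any.expand_set sum_negf)

lemma g_U: "g.U = op_exp (\<lambda>u S. - theta u S)"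
proof -
  have "g.A v S = - theta v S" for v S
    unfolding g.A_def theta_def Sum_any_neg[symmetric]
    by (rule Sum_any.cong) (simp add: logP_def when_def)
  then have "g.A = (\<lambda>u S. - theta u S)" by (intro ext)
  then show ?thesis by (intro ext) (simp only: g.U_def)
qed

lemma ket_G_fold: "ket_G r p = G.fold_psi (beta_num p) r 0"
  by (simp add: ket_G_def G.fold_psi_def G_U cket_eq beta_num_def)

lemma ket_g_fold: "ket_g r p = g.fold_psi (beta_num p) r 0"
  by (simp add: ket_g_def g.fold_psi_def g_U cket_eq beta_num_def)

lemma G_U_psi:
  assumes v: "G.bounded w v" and S: "maya S"
  shows "G.U (psi n v) S = psi n (G.U v) S + \<beta> * psi (n + 1) (G.U v) S"
proof -
  define K where "K = Suc (nat (w - n + wt S))"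
  have "G.U (psi n v) S = (\<Sum>k\<le>K. QG k * psi (n - (- 1) * int k) (G.U v) S)"
    by (rule G.U_psi[OF v S]) (simp add: K_def)
  also have "\<dots> = (\<Sum>k\<in>{0, 1}. QG k * psi (n - (- 1) * int k) (G.U v) S)"
    by (rule sum.mono_neutral_right) (auto simp: QG_def K_def)
  finally show ?thesis by (simp add: QG_def)
qed

lemma psi_agree: "(n \<in> S \<Longrightarrow> v (S - {n}) = w (S - {n})) \<Longrightarrow> psi n v S = psi n w S"
  by (simp add: psi_def when_def)

text \<open>This gives independence of \<open>r\<close>. The exponential does alter the sea, but
  writing the sea as \<open>\<psi>\<^sub>a\<^sub>-\<^sub>1\<close> on a lower one produces
  \<open>\<psi>\<^sub>a\<^sub>-\<^sub>1 + \<beta> \<psi>\<^sub>a\<close>, whose second term is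
  killed by the outer fermion. Descending repeatedly passes below all holes of \<open>S\<close>,
  where \<open>G.U_vac\<close> applies.\<close>

lemma G_absorb: "psi a (G.U (ket {..<a})) = ket {..<a + 1}"
proof
  fix S
  have main: "psi a (G.U (ket {..<a})) S = psi a (ket {..<a}) S"
    if "maya S" "{..<a - int d} \<subseteq> S" for d a S
    using that
  proof (induction d arbitrary: a S)
    case 0
    show ?case
      by (rule psi_agree, rule G.U_vac) (use 0 in auto)
  next
    case (Suc d)
    let ?k = "ket {..<a - 1}"
    have k: "G.bounded (- 1 * wt {..<a - 1}) ?k" by (rule G.bounded_ket[OF maya_lessThan])
    have "psi a (G.U (ket {..<a})) S = psi a (\<lambda>T. psi (a - 1) (G.U ?k) T + \<beta> * psi a (G.U ?k) T) S"
    proof (rule psi_agree)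
      show "G.U (ket {..<a}) (S - {a}) = psi (a - 1) (G.U ?k) (S - {a}) + \<beta> * psi a (G.U ?k) (S - {a})"
        using G_U_psi[OF k, of "S - {a}" "a - 1"] Suc.prems psi_ket_lessThan[of "a - 1"] by simp
    qed
    also have "\<dots> = psi a (psi (a - 1) (G.U ?k)) S"
      by (rule psi_agree) (simp add: psi_def)
    also have "\<dots> = psi a (ket {..<a}) S"
    proof (rule psi_agree)
      have "psi (a - 1) (G.U ?k) (S - {a}) = psi (a - 1) ?k (S - {a})"
        by (rule Suc.IH) (use Suc.prems in auto)
      then show "psi (a - 1) (G.U ?k) (S - {a}) = ket {..<a} (S - {a})"
        using psi_ket_lessThan[of "a - 1"] by simp
    qed
    finally show ?case .
  qed
  show "psi a (G.U (ket {..<a})) S = ket {..<a + 1} S"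
  proof (cases "maya S")
    case True
    then obtain l where "{..<l} \<subseteq> S" by (metis maya_bounds)
    then have "{..<a - int (nat (a - l))} \<subseteq> S" by auto
    then show ?thesis using main[OF True] psi_ket_lessThan by metis
  next
    case False
    then show ?thesis
      using fock_zero[OF psi_fock[OF G.U_fock[OF ket_fock[OF maya_lessThan]]] False]
        fock_zero[OF ket_fock[OF maya_lessThan] False] by metis
  qed
qed

lemma g_absorb: "psi a (g.U (ket {..<a})) = ket {..<a + 1}"
proof -
  have "g.U (ket {..<a}) S = ket {..<a} S" for S
  proof (cases "maya S")
    case True
    then show ?thesis by (rule g.U_vac) simp
  next
    case False
    then show ?thesis
      using fock_zero[OF g.U_fock[OF ket_fock[OF maya_lessThan]] False]
        fock_zero[OF ket_fock[OF maya_lessThan] False] by metis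
  qed
  then have "g.U (ket {..<a}) = ket {..<a}" ..
  then show ?thesis by (simp add: psi_ket_lessThan)
qed

lemma ket_G_indep: "length p \<le> r \<Longrightarrow> ket_G r p = ket_G (length p) p"
proof (induction rule: dec_induct)
  case (step r)
  have "ket_G (Suc r) p = ket_G r p"
    using G_absorb[of "- int (Suc r)"] beta_num_tail[OF step.hyps(1)]
    by (simp add: ket_G_fold G.fold_psi_def)
  then show ?case using step.IH by simp
qed simp

lemma ket_g_indep: "length p \<le> r \<Longrightarrow> ket_g r p = ket_g (length p) p"
proof (induction rule: dec_induct)
  case (step r)
  have "ket_g (Suc r) p = ket_g r p"
    using g_absorb[of "- int (Suc r)"] beta_num_tail[OF step.hyps(1)]
    by (simp add: ket_g_fold g.fold_psi_def)
  then show ?case using step.IH by simp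
qed simp

definition ketG :: "nat list \<Rightarrow> vec" where "ketG p = ket_G (length p) p"
definition ketg :: "nat list \<Rightarrow> vec" where "ketg p = ket_g (length p) p"

lemma ket_G_eq: "length p \<le> r \<Longrightarrow> ket_G r p = ketG p"
  unfolding ketG_def by (rule ket_G_indep)

lemma ket_g_eq: "length p \<le> r \<Longrightarrow> ket_g r p = ketg p"
  unfolding ketg_def by (rule ket_g_indep)

definition FG :: "scalar fps" where "FG = 1 + fps_const \<beta> * fps_X"
definition Fg :: "scalar fps" where "Fg = Abs_fps Qg"

lemma FG_eq: "Abs_fps QG = FG"
  by (rule fps_ext) (simp add: FG_def QG_def fps_X_def)

lemma FG_Fg: "Fg * FG = 1"
proof (rule fps_ext)
  fix n
  have "fps_nth (Fg * FG) n = fps_nth (Fg + fps_const \<beta> * (Fg * fps_X)) n"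
    by (simp add: FG_def algebra_simps)
  also have "\<dots> = fps_nth 1 n"
    by (cases n) (simp_all add: Fg_def Qg_def)
  finally show "fps_nth (Fg * FG) n = fps_nth 1 n" .
qed

lemma FG_pow_nth: "i < n \<Longrightarrow> fps_nth (FG ^ i) n = 0"
proof (induction i arbitrary: n)
  case (Suc i)
  have "FG ^ Suc i = FG ^ i + fps_const \<beta> * (fps_X * FG ^ i)"
    by (simp add: FG_def algebra_simps)
  then show ?case using Suc by (cases n) (simp_all del: power_Suc)
qed simp

lemma fps_nth_int_FG_pow: "int i < z \<Longrightarrow> fps_nth_int (FG ^ i) z = 0"
  using FG_pow_nth[of i "nat z"] by (simp add: fps_nth_int_def)

lemma G_cf: "G.cf i z = fps_nth_int (FG ^ i) z"
  by (simp add: G.cf_def FG_eq)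

lemma g_cf: "g.cf i z = fps_nth_int (Fg ^ i) z"
  by (simp add: g.cf_def Fg_def)

text \<open>The window restriction is real: at a diagram with a hole below \<open>- int N\<close>
  the coefficient may be nonzero and needs a larger \<open>N\<close>.\<close>

lemma ketG_window:
  assumes "length p \<le> N" "maya S" "{..<- int N} \<subseteq> S"
  shows "ketG p S = wedge N (\<lambda>i s. fps_nth_int (FG ^ i) (s - beta_num p i)) (S \<inter> {- int N..})"
proof -
  \<comment> \<open>A crude bound: \<open>FG ^ i\<close> has degree \<open>i < N\<close>, so no row
    reaches further above its beta number.\<close>
  define M where "M = int N + (\<Sum>j<N. \<bar>beta_num p j\<bar>)"
  have "ketG p S = G.fold_psi (beta_num p) N 0 S"
    using assms by (simp add: ket_G_eq[symmetric] ket_G_fold)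
  also have "\<dots> = wedge_vec N (N - 0) (\<lambda>i s. G.cf i (- 1 * (beta_num p (0 + i) - s))) S"
  proof (rule G.fold_psi_eq_wedge_vec[of N M])
    fix i j n assume i: "i < N" and j: "j < N" and n: "M < n"
    have "\<bar>beta_num p j\<bar> \<le> (\<Sum>j<N. \<bar>beta_num p j\<bar>)"
      by (rule member_le_sum) (use j in auto)
    then have "int i < n - beta_num p j" using i n by (simp add: M_def)
    then show "G.cf i (- 1 * (beta_num p j - n)) = 0" by (simp add: G_cf fps_nth_int_FG_pow)
  qed (use assms beta_num_ge in auto)
  also have "\<dots> = wedge N (\<lambda>i s. fps_nth_int (FG ^ i) (s - beta_num p i)) (S \<inter> {- int N..})"
    using assms by (simp add: wedge_vec_def G_cf)
  finally show ?thesis .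
qed

text \<open>Here no window condition on \<open>S\<close> appears, since positive modes leave the sea
  unchanged.\<close>

lemma ketg_wedge_vec:
  assumes p: "is_partition p" and N: "length p \<le> N" and S: "maya S"
  shows "ketg p S = wedge_vec N N (\<lambda>i s. fps_nth_int (Fg ^ i) (beta_num p i - s)) S"
proof -
  have "ketg p S = g.fold_psi (beta_num p) N 0 S"
    using assms by (simp add: ket_g_eq[symmetric] ket_g_fold)
  also have "\<dots> = wedge_vec N (N - 0) (\<lambda>i s. g.cf i (1 * (beta_num p (0 + i) - s))) S"
  proof (rule g.fold_psi_eq_wedge_vec[of N "beta_num p 0"])
    fix i j n assume n: "beta_num p 0 < n"
    have "beta_num p j \<le> beta_num p 0" using beta_num_less[OF p, of 0 j] by (cases j) auto
    then show "g.cf i (1 * (beta_num p j - n)) = 0" using n by (simp add: g_cf fps_nth_int_def)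
  qed (use S beta_num_ge in auto)
  finally show ?thesis by (simp add: g_cf)
qed

lemma ketG_fock: "ketG p \<in> fock"
  using G.fold_psi_bounded[of 0 "length p" "beta_num p"] by (simp add: G.bounded_def ketG_def ket_G_fold)

lemma ketg_fock: "ketg p \<in> fock"
  using g.fold_psi_bounded[of 0 "length p" "beta_num p"] by (simp add: g.bounded_def ketg_def ket_g_fold)

lemma wedge_charge:
  assumes "wedge N r (S \<inter> {- int N..}) \<noteq> 0" "{..<- int N} \<subseteq> S"
  shows "charge S = 0"
proof -
  have "finite (S \<inter> {- int N..})" "card (S \<inter> {- int N..}) = N"
    using wedge_eq_0 assms(1) by blast+
  then show ?thesis using charge_window[OF assms(2)] by simp
qed

text \<open>Together with the opposite inequality for \<open>ketg\<close> this is the triangularity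
  of the two families. Each Maya diagram gets a window of its own to compute the charge.\<close>

lemma ketG_support:
  assumes p: "is_partition p" and nz: "ketG p S \<noteq> 0"
  shows "maya S \<and> charge S = 0 \<and> wt (dgm p) \<le> wt S"
proof -
  have S: "maya S" using nz ketG_fock by (auto simp: fock_def)
  obtain l where l: "{..<l} \<subseteq> S" using maya_bounds[OF S] by metis
  define N where "N = max (nat (- l)) (length p)"
  have N: "{..<- int N} \<subseteq> S" "length p \<le> N" using l by (auto simp: N_def)
  have "charge S = 0"
    using nz unfolding ketG_window[OF N(2) S N(1)] by (rule wedge_charge[OF _ N(1)])
  moreover have "wt (dgm p) \<le> wt S"
    using G.fold_psi_bounded[of 0 "length p" "beta_num p"] nz wt_dgm[OF p order_refl]
    by (force simp: G.bounded_def ketG_def ket_G_fold atLeast0LessThan)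
  ultimately show ?thesis using S by simp
qed

lemma ketg_support:
  assumes p: "is_partition p" and nz: "ketg p S \<noteq> 0"
  shows "maya S \<and> charge S = 0 \<and> wt S \<le> wt (dgm p)"
proof -
  have S: "maya S" using nz ketg_fock by (auto simp: fock_def)
  have "wedge_vec (length p) (length p) (\<lambda>i s. fps_nth_int (Fg ^ i) (beta_num p i - s)) S \<noteq> 0"
    using nz ketg_wedge_vec[OF p order_refl S] by simp
  then have "charge S = 0" by (auto simp: wedge_vec_def intro: wedge_charge split: if_splits)
  moreover have "wt S \<le> wt (dgm p)"
    using g.fold_psi_bounded[of 0 "length p" "beta_num p"] nz wt_dgm[OF p order_refl]
    by (simp add: g.bounded_def ketg_def ket_g_fold atLeast0LessThan)
  ultimately show ?thesis using S by simp
qed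

text \<open>The powers of \<open>FG\<close> are polynomials, so a fixed depth of holes also bounds
  the particles from above. This is the finiteness required by \<open>Lambda_hat\<close>.\<close>

lemma finite_ketG_window: "finite {S. {..<- int N} \<subseteq> S \<and> ketG p S \<noteq> 0}"
proof -
  define K where "K = max N (length p)"
  define M where "M = int K + (\<Sum>j<K. \<bar>beta_num p j\<bar>)"
  have "{S. {..<- int N} \<subseteq> S \<and> ketG p S \<noteq> 0} \<subseteq> (\<lambda>X. {..<- int K} \<union> X) ` Pow {- int K..M}"
  proof
    fix S assume "S \<in> {S. {..<- int N} \<subseteq> S \<and> ketG p S \<noteq> 0}"
    then have S: "{..<- int K} \<subseteq> S" "ketG p S \<noteq> 0" by (auto simp: K_def)
    then have "maya S" using ketG_fock by (auto simp: fock_def)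
    then have w: "wedge K (\<lambda>i s. fps_nth_int (FG ^ i) (s - beta_num p i)) (S \<inter> {- int K..}) \<noteq> 0"
      using ketG_window[of p K S] S by (simp add: K_def)
    have "S \<inter> {- int K..} \<subseteq> {- int K..M}"
    proof
      fix m assume m: "m \<in> S \<inter> {- int K..}"
      obtain i where i: "i < K" "fps_nth_int (FG ^ i) (m - beta_num p i) \<noteq> 0"
        using wedge_nonzero_support[OF w m] by auto
      then have "m - beta_num p i \<le> int i" using fps_nth_int_FG_pow[of i "m - beta_num p i"] by linarith
      moreover have "\<bar>beta_num p i\<bar> \<le> (\<Sum>j<K. \<bar>beta_num p j\<bar>)"
        by (rule member_le_sum) (use i in auto)
      ultimately show "m \<in> {- int K..M}" using m i by (simp add: M_def)
    qed
    moreover have "S = {..<- int K} \<union> (S \<inter> {- int K..})" using S(1) by auto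
    ultimately show "S \<in> (\<lambda>X. {..<- int K} \<union> X) ` Pow {- int K..M}" by blast
  qed
  then show ?thesis by (rule finite_subset) simp
qed

lemma FgFG_pow: "Fg ^ i * FG ^ j = (if i \<le> j then FG ^ (j - i) else Fg ^ (i - j))"
proof -
  have c: "Fg ^ k * FG ^ k = 1" for k by (simp add: FG_Fg flip: power_mult_distrib)
  show ?thesis
  proof (cases "i \<le> j")
    case True
    then have "FG ^ j = FG ^ i * FG ^ (j - i)" by (simp flip: power_add)
    then show ?thesis using True c[of i] by (simp add: mult.assoc[symmetric])
  next
    case False
    then have "Fg ^ i = Fg ^ (i - j) * Fg ^ j" by (simp flip: power_add)
    then show ?thesis using False c[of j] by (simp add: mult.assoc)
  qed
qed

text \<open>By Cauchy--Binet the pairing is the determinant of the pairings of the rows; for distinct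
  partitions that matrix has a vanishing block too large for a nonzero determinant.\<close>

lemma omega_ketg_ketG:
  assumes p: "is_partition p" and q: "is_partition q"
  shows "omega (ketg q) (ketG p) = (if p = q then 1 else 0)"
proof -
  define N where "N = max (length p) (length q)"
  have N: "length p \<le> N" "length q \<le> N" by (simp_all add: N_def)
  define M where "M = beta_num q 0"
  let ?U = "{- int N..M}"
  let ?rg = "\<lambda>i s. fps_nth_int (Fg ^ i) (beta_num q i - s)" and ?rG = "\<lambda>i s. fps_nth_int (FG ^ i) (s - beta_num p i)"
  have M: "beta_num q i \<le> M" for i using beta_num_less[OF q, of 0 i] by (cases i) (auto simp: M_def)
  let ?S = "\<lambda>X. {..<- int N} \<union> X"
  have int: "?S X \<inter> {- int N..} = X" "{..<- int N} \<subseteq> ?S X" if "X \<in> Pow ?U" for X using that by auto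
  have m: "maya (?S X)" if "X \<in> Pow ?U" for X
    using maya_window[OF int(2)[OF that]] int(1)[OF that] that finite_subset[of X ?U] by auto
  have supp: "{S. ketg q S * ketG p S \<noteq> 0} \<subseteq> ?S ` Pow ?U"
  proof
    fix S assume "S \<in> {S. ketg q S * ketG p S \<noteq> 0}"
    then have nz: "ketg q S \<noteq> 0" by auto
    then have "maya S" using ketg_fock by (auto simp: fock_def)
    then have "wedge_vec N N ?rg S \<noteq> 0" using ketg_wedge_vec[OF q N(2)] nz by simp
    then have S: "{..<- int N} \<subseteq> S" and w: "wedge N ?rg (S \<inter> {- int N..}) \<noteq> 0"
      by (auto simp: wedge_vec_def split: if_splits)
    have "S \<inter> {- int N..} \<subseteq> ?U"
    proof
      fix m assume m: "m \<in> S \<inter> {- int N..}"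
      obtain i where i: "fps_nth_int (Fg ^ i) (beta_num q i - m) \<noteq> 0"
        using wedge_nonzero_support[OF w m] by auto
      then have "m \<le> beta_num q i" by (auto simp: fps_nth_int_def split: if_splits)
      then show "m \<in> ?U" using m M[of i] by auto
    qed
    moreover have "S = ?S (S \<inter> {- int N..})" using S by auto
    ultimately show "S \<in> ?S ` Pow ?U" by blast
  qed
  have inj: "inj_on ?S (Pow ?U)" by (rule inj_onI) (metis int(1))
  have "omega (ketg q) (ketG p) = (\<Sum>S\<in>?S ` Pow ?U. ketg q S * ketG p S)"
    unfolding omega_def by (rule Sum_any.expand_superset[OF _ supp]) simp
  also have "\<dots> = (\<Sum>X\<in>Pow ?U. ketg q (?S X) * ketG p (?S X))"
    by (simp add: sum.reindex[OF inj])
  also have "\<dots> = (\<Sum>X\<in>Pow ?U. wedge N ?rg X * wedge N ?rG X)"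
    by (rule sum.cong[OF refl])
      (simp add: ketg_wedge_vec[OF q N(2) m] ketG_window[OF N(1) m int(2)] wedge_vec_def int)
  also have "\<dots> = det (mat N N (\<lambda>(i, j). \<Sum>u\<in>?U. ?rg i u * ?rG j u))"
    by (rule cauchy_binet) simp
  also have "mat N N (\<lambda>(i, j). \<Sum>u\<in>?U. ?rg i u * ?rG j u) =
      mat N N (\<lambda>(i, j). fps_nth_int (Fg ^ i * FG ^ j) (beta_num q i - beta_num p j))" (is "_ = ?D")
  proof (rule cong_mat)
    fix i j assume "i < N" "j < N"
    have "{beta_num p j..beta_num q i} \<subseteq> ?U" using beta_num_ge[OF \<open>j < N\<close>, of p] M[of i] by auto
    then have "(\<Sum>u\<in>?U. ?rg i u * ?rG j u) = fps_nth_int (Fg ^ i * FG ^ j) (beta_num q i - beta_num p j)"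
      by (intro fps_nth_int_conv) auto
    then show "(case (i, j) of (i, j) \<Rightarrow> \<Sum>u\<in>?U. ?rg i u * ?rG j u) =
        (case (i, j) of (i, j) \<Rightarrow> fps_nth_int (Fg ^ i * FG ^ j) (beta_num q i - beta_num p j))" by simp
  qed simp_all
  also have "det ?D = (if p = q then 1 else 0)"
  proof (cases "p = q")
    case True
    have "det ?D = prod_list (diag_mat ?D)"
    proof (rule det_upper_triangular)
      show "upper_triangular ?D"
        unfolding upper_triangular_def
      proof (intro allI impI)
        fix i j assume "i < dim_row ?D" "j < i"
        then show "?D $$ (i, j) = 0"
          using beta_num_less[OF p, of j i] True by (simp add: fps_nth_int_def)
      qed
    qed auto
    also have "\<dots> = 1"
      using True by (simp add: prod_list_diag_prod FgFG_pow fps_nth_int_def)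
    finally show ?thesis using True by simp
  next
    case False
    obtain k where k: "part p k \<noteq> part q k"
    proof -
      have "dgm p \<noteq> dgm q" using dgm_inj[OF p q] False by auto
      then have "beta_num p \<noteq> beta_num q" by (auto simp: dgm_def)
      then show thesis using that by (auto simp: beta_num_def fun_eq_iff)
    qed
    have kN: "k < N"
    proof (rule ccontr)
      assume "\<not> k < N"
      then show False using k N by (simp add: part_def)
    qed
    have "det ?D = 0"
    proof (cases "part p k < part q k")
      case True
      show ?thesis
      \<comment> \<open>On this block \<open>FG ^ (j - i)\<close> is evaluated beyond its degree.
        The block has \<open>k + 1\<close> rows and \<open>N - k\<close> columns, one too many in
        total.\<close>
      proof (rule det_zero_block[of _ N "{..k}" "{k..<N}"])
        fix i j assume ij: "i \<in> {..k}" "j \<in> {k..<N}"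
        have "part p j \<le> part p k" "part q k \<le> part q i" using part_antimono[OF p] part_antimono[OF q] ij by auto
        then have "int (j - i) < beta_num q i - beta_num p j" using True ij by (simp add: beta_num_def)
        then show "?D $$ (i, j) = 0" using ij kN by (simp add: FgFG_pow fps_nth_int_FG_pow)
      qed (use kN in auto)
    next
      case False
      then have lt: "part q k < part p k" using k by simp
      show ?thesis
      \<comment> \<open>In the opposite case the complementary corner vanishes because the
        coefficient index is negative.\<close>
      proof (rule det_zero_block[of _ N "{k..<N}" "{..k}"])
        fix i j assume ij: "i \<in> {k..<N}" "j \<in> {..k}"
        have "part p k \<le> part p j" "part q i \<le> part q k" using part_antimono[OF p] part_antimono[OF q] ij by auto
        then have "beta_num q i - beta_num p j < 0" using lt ij by (simp add: beta_num_def)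
        then show "?D $$ (i, j) = 0" using ij kN by (simp add: fps_nth_int_def)
      qed (use kN in auto)
    qed
    then show ?thesis using False by simp
  qed
  finally show ?thesis .
qed

section \<open>Truncation by weight and completeness\<close>

definition parts :: "int \<Rightarrow> nat list set" where
  "parts d = {p. is_partition p \<and> wt (dgm p) \<le> d}"

lemma inj_dgm: "inj_on dgm {p. is_partition p}"
  using dgm_inj by (auto simp: inj_on_def)

lemma finite_parts: "finite (parts d)"
proof (rule finite_imageD)
  show "finite (dgm ` parts d)"
    by (rule finite_subset[OF _ finite_maya_wt[of d]]) (auto simp: parts_def maya_dgm)
  show "inj_on dgm (parts d)" using inj_dgm by (rule inj_on_subset) (auto simp: parts_def)
qed

lemma omega_ketg:
  assumes "q \<in> parts d"
  shows "omega (ketg q) w = (\<Sum>p\<in>parts d. ketg q (dgm p) * w (dgm p))"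
proof -
  have inj: "inj_on dgm (parts d)" using inj_dgm by (rule inj_on_subset) (auto simp: parts_def)
  have "omega (ketg q) w = (\<Sum>S\<in>dgm ` parts d. ketg q S * w S)"
    unfolding omega_def
  proof (rule Sum_any.expand_superset)
    show "{S. ketg q S * w S \<noteq> 0} \<subseteq> dgm ` parts d"
    proof
      fix S assume "S \<in> {S. ketg q S * w S \<noteq> 0}"
      then have "maya S \<and> charge S = 0 \<and> wt S \<le> wt (dgm q)"
        using ketg_support[of q S] assms by (auto simp: parts_def)
      moreover from this obtain p where "is_partition p" "dgm p = S" using dgm_surj by metis
      ultimately show "S \<in> dgm ` parts d" using assms by (auto simp: parts_def)
    qed
  qed (simp add: finite_parts)
  then show ?thesis by (simp add: sum.reindex[OF inj])
qed

text \<open>Duality says that one square matrix over the finite set \<open>parts d\<close> is a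
  right inverse of another, hence also a left inverse. The cutoff is legitimate since
  \<open>ketg q\<close> lives in weights at most that of \<open>q\<close>.\<close>

lemma ketg_ketG_dual:
  assumes p: "p \<in> parts d" and p': "p' \<in> parts d"
  shows "(\<Sum>q\<in>parts d. ketg q (dgm p) * ketG q (dgm p')) = (if p = p' then 1 else 0)"
proof -
  define n where "n = card (parts d)"
  obtain f where f: "bij_betw f {0..<n} (parts d)"
    using ex_bij_betw_nat_finite[OF finite_parts] by (auto simp: n_def)
  have fin: "f i \<in> parts d" if "i < n" for i using bij_betwE[OF f] that by simp
  have fp: "is_partition (f i)" if "i < n" for i using fin[OF that] by (simp add: parts_def)
  have feq: "f i = f j \<longleftrightarrow> i = j" if "i < n" "j < n" for i j
    using bij_betw_imp_inj_on[OF f] that by (auto simp: inj_on_def)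
  have sum: "(\<Sum>q\<in>parts d. h q) = (\<Sum>i = 0..<n. h (f i))" for h :: "nat list \<Rightarrow> scalar"
    using sum.reindex_bij_betw[OF f, of h] by simp
  define C where "C = mat n n (\<lambda>(i, j). ketG (f i) (dgm (f j)))"
  define D where "D = mat n n (\<lambda>(i, j). ketg (f j) (dgm (f i)))"
  have "C * D = 1\<^sub>m n"
  proof (rule eq_matI)
    fix i k assume ik: "i < dim_row (1\<^sub>m n)" "k < dim_col (1\<^sub>m n)"
    then have "(C * D) $$ (i, k) = (\<Sum>j = 0..<n. ketG (f i) (dgm (f j)) * ketg (f k) (dgm (f j)))"
      by (simp add: C_def D_def scalar_prod_def)
    also have "\<dots> = omega (ketg (f k)) (ketG (f i))"
      using ik by (simp add: omega_ketg[OF fin] sum mult.commute)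
    also have "\<dots> = 1\<^sub>m n $$ (i, k)" using ik fp feq by (simp add: omega_ketg_ketG)
    finally show "(C * D) $$ (i, k) = 1\<^sub>m n $$ (i, k)" .
  qed (simp_all add: C_def D_def)
  then have DC: "D * C = 1\<^sub>m n"
    by (rule mat_mult_left_right_inverse[rotated 2]) (simp_all add: C_def D_def)
  have "f ` {0..<n} = parts d" using f by (simp add: bij_betw_def)
  with p p' obtain i k where ik: "i < n" "k < n" "p = f i" "p' = f k"
    by (metis atLeastLessThan_iff imageE)
  have "(\<Sum>q\<in>parts d. ketg q (dgm p) * ketG q (dgm p')) = (D * C) $$ (i, k)"
    using ik by (simp add: sum C_def D_def scalar_prod_def)
  also have "\<dots> = (if p = p' then 1 else 0)" using ik feq by (simp add: DC)
  finally show ?thesis .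
qed

text \<open>Resolution of the identity at one diagram, for an arbitrary vector \<open>w\<close>; the
  sum is finite by the weight cutoff.\<close>

lemma completeness:
  assumes p: "p \<in> parts d"
  shows "w (dgm p) = (\<Sum>q\<in>parts d. ketG q (dgm p) * omega (ketg q) w)"
proof -
  have "(\<Sum>q\<in>parts d. ketG q (dgm p) * omega (ketg q) w) =
      (\<Sum>q\<in>parts d. \<Sum>p'\<in>parts d. w (dgm p') * (ketg q (dgm p') * ketG q (dgm p)))"
    by (rule sum.cong[OF refl]) (simp add: omega_ketg sum_distrib_left mult_ac)
  also have "\<dots> = (\<Sum>p'\<in>parts d. w (dgm p') * (\<Sum>q\<in>parts d. ketg q (dgm p') * ketG q (dgm p)))"
    by (subst sum.swap) (simp add: sum_distrib_left)
  also have "\<dots> = (\<Sum>p'\<in>parts d. if p' = p then w (dgm p) else 0)"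
    by (rule sum.cong[OF refl]) (simp add: ketg_ketG_dual[OF _ p])
  also have "\<dots> = w (dgm p)" using p finite_parts by simp
  finally show ?thesis ..
qed

section \<open>The operator \<open>e\<^sup>H\<^sup>(\<^sup>x\<^sup>)\<close>\<close>

abbreviation lookup :: "('a \<Rightarrow>\<^sub>0 'b::zero) \<Rightarrow> 'a \<Rightarrow> 'b" where
  "lookup \<equiv> Poly_Mapping.lookup"

abbreviation keys :: "('a \<Rightarrow>\<^sub>0 'b::zero) \<Rightarrow> 'a set" where
  "keys \<equiv> Poly_Mapping.keys"

abbreviation single :: "'a \<Rightarrow> 'b \<Rightarrow> ('a \<Rightarrow>\<^sub>0 'b::zero)" where
  "single \<equiv> Poly_Mapping.single"

definition mdeg :: "mono \<Rightarrow> nat" where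
  "mdeg a = (\<Sum>i\<in>keys a. lookup a i)"

lemma mdeg_add: "mdeg (a + b) = mdeg a + mdeg b"
  unfolding mdeg_def by (rule setsum_keys_plus_distrib) auto

lemma mdeg_eq_0: "mdeg a = 0 \<longleftrightarrow> a = 0"
  by (auto simp: mdeg_def in_keys_iff intro!: poly_mapping_eqI)

lemma mdeg_0 [simp]: "mdeg 0 = 0"
  by (simp add: mdeg_eq_0)

lemma mdeg_single [simp]: "mdeg (single i n) = n"
  by (cases "n = 0") (simp_all add: mdeg_def)

lemma lookup_le_mdeg: "lookup a i \<le> mdeg a"
proof (cases "i \<in> keys a")
  case True
  then show ?thesis unfolding mdeg_def by (intro member_le_sum) auto
qed (simp add: in_keys_iff)

lemma finite_mono_bounded:
  "finite I \<Longrightarrow> finite {a :: mono. keys a \<subseteq> I \<and> mdeg a \<le> n}"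
proof (rule finite_imageD[of lookup])
  assume I: "finite I"
  show "finite (lookup ` {a :: mono. keys a \<subseteq> I \<and> mdeg a \<le> n})"
  proof (rule finite_subset)
    show "lookup ` {a :: mono. keys a \<subseteq> I \<and> mdeg a \<le> n}
        \<subseteq> {f. \<forall>x. (x \<in> I \<longrightarrow> f x \<in> {..n}) \<and> (x \<notin> I \<longrightarrow> f x = 0)}"
      by (auto simp: in_keys_iff intro: order.trans[OF lookup_le_mdeg])
  qed (rule finite_set_of_finite_funs[OF I], simp)
qed (simp add: inj_on_def)

lemma keys_dec: "a + b = (c :: mono) \<Longrightarrow> keys a \<subseteq> keys c \<and> keys b \<subseteq> keys c"
  by (auto simp: in_keys_iff lookup_add)

lemma finite_dec_mono: "finite (dec (c :: mono))"
proof (rule finite_subset)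
  let ?A = "{a :: mono. keys a \<subseteq> keys c \<and> mdeg a \<le> mdeg c}"
  show "dec c \<subseteq> ?A \<times> ?A" using keys_dec by (auto simp: dec_def mdeg_add)
  show "finite (?A \<times> ?A)" using finite_mono_bounded[of "keys c"] by auto
qed

text \<open>The coefficients of the sum of \<open>p\<^sub>n(x)/n\<close>, whose exponential is the
  sum of all monomials; this is why \<open>Q\<close> is constantly 1 in the interpretation.\<close>

definition logX :: "mono \<Rightarrow> scalar" where
  "logX a = (1 / of_nat (mdeg a) when a \<noteq> 0 \<and> (\<exists>i. a = single i (mdeg a)))"

text \<open>The Euler identity becomes a count: the degree of \<open>c\<close> is the number of ways
  to split off a positive power of a single variable, a choice of \<open>i\<close> and of an
  exponent in \<open>{1..lookup c i}\<close>.\<close>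

interpretation X: graded mdeg logX "\<lambda>_. 1" 1
proof unfold_locales
  fix c :: mono
  let ?good = "\<lambda>a :: mono. a \<noteq> 0 \<and> (\<exists>i. a = single i (mdeg a))"
  let ?D = "{(a, b). (a, b) \<in> dec c \<and> ?good a}"
  let ?I = "Sigma (keys c) (\<lambda>i. {1..lookup c i})"
  let ?f = "\<lambda>(i, n). (single i n, c - single i n)"
  have "(\<Sum>(a, b)\<in>dec c. of_nat (mdeg a) * logX a * 1) = (\<Sum>p\<in>dec c. if p \<in> ?D then 1 else 0)"
    by (rule sum.cong) (auto simp: logX_def mdeg_eq_0 when_def split: if_splits)
  also have "\<dots> = of_nat (card ?D)"
  proof -
    have "dec c \<inter> ?D = ?D" by auto
    then show ?thesis by (simp add: sum.If_cases finite_dec_mono)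
  qed
  also have "card ?D = card ?I"
  proof (rule bij_betw_same_card[of ?f, symmetric])
    show "bij_betw ?f ?I ?D"
    proof (rule bij_betwI[where g = "\<lambda>(a, b). (THE i. i \<in> keys a, mdeg a)"])
      show "?f \<in> ?I \<rightarrow> ?D"
      proof
        fix p assume "p \<in> ?I"
        then obtain i n where p: "p = (i, n)" "1 \<le> n" "n \<le> lookup c i" by auto
        have "single i n + (c - single i n) = c"
          by (rule poly_mapping_eqI) (use p in \<open>auto simp: lookup_add lookup_minus lookup_single when_def\<close>)
        moreover have "single i n \<noteq> 0" using p mdeg_single[of i n] by (metis mdeg_0 not_one_le_zero)
        ultimately show "?f p \<in> ?D" using p by auto
      qed
      show "(\<lambda>(a, b). (THE i. i \<in> keys a, mdeg a)) \<in> ?D \<rightarrow> ?I"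
      proof
        fix p assume "p \<in> ?D"
        then obtain a b i where p: "p = (a, b)" "a + b = c" "a \<noteq> 0" "a = single i (mdeg a)" by auto
        then have n: "mdeg a \<noteq> 0" by (simp add: mdeg_eq_0)
        have k: "keys a = {i}" by (subst p(4)) (simp add: n)
        have "lookup a i = mdeg a" by (subst p(4)) simp
        then have "lookup c i \<ge> mdeg a" by (simp flip: p(2) add: lookup_add)
        then show "(\<lambda>(a, b). (THE i. i \<in> keys a, mdeg a)) p \<in> ?I"
        proof -
          have "i \<in> keys c"
            using n \<open>mdeg a \<le> lookup c i\<close> by (simp add: in_keys_iff)
          then show ?thesis using n \<open>mdeg a \<le> lookup c i\<close> by (simp add: p(1) k)
        qed
      qed
      show "(\<lambda>(a, b). (THE i. i \<in> keys a, mdeg a)) (?f p) = p" if "p \<in> ?I" for p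
        using that by auto
      show "?f ((\<lambda>(a, b). (THE i. i \<in> keys a, mdeg a)) p) = p" if "p \<in> ?D" for p
      proof -
        from that obtain a b i where p: "p = (a, b)" "a + b = c" "a \<noteq> 0" "a = single i (mdeg a)" by auto
        then have n: "mdeg a \<noteq> 0" by (simp add: mdeg_eq_0)
        have "keys a = {i}" by (subst p(4)) (simp add: n)
        then show ?thesis using p(4)[symmetric] p(2) by (auto simp: p(1))
      qed
    qed
  qed
  also have "card ?I = mdeg c"
    by (simp add: mdeg_def)
  finally show "of_nat (mdeg c) * 1 = (\<Sum>(a, b)\<in>dec c. of_nat (mdeg a) * logX a * 1)" by simp
qed (auto simp: mdeg_add mdeg_eq_0 finite_dec_mono logX_def)

declare mdeg_0 [simp]

text \<open>The separate sum over \<open>n\<close> collapses, because a monomial of the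
  \<open>n\<close>-th power sum has degree \<open>n\<close>.\<close>

lemma Hx_Hop: "Hx V (a, S) = X.Hop (\<lambda>c T. V (c, T)) a S"
proof -
  let ?t = "\<lambda>n d c. (power_sum n d / of_nat n * current (int n) (\<lambda>T. V (c, T)) S when n \<ge> 1)"
  have inner: "Sum_any (\<lambda>(d, c). power_sum n d / of_nat n * current (int n) (\<lambda>T. V (c, T)) S when d + c = a)
      = (\<Sum>(d, c)\<in>dec a. power_sum n d / of_nat n * current (int n) (\<lambda>T. V (c, T)) S)" for n
  proof -
    have "Sum_any (\<lambda>(d, c). power_sum n d / of_nat n * current (int n) (\<lambda>T. V (c, T)) S when d + c = a) =
        (\<Sum>(d, c)\<in>dec a. power_sum n d / of_nat n * current (int n) (\<lambda>T. V (c, T)) S when d + c = a)"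
      by (rule Sum_any.expand_superset[OF finite_dec_mono]) (auto simp: when_def split: if_splits)
    also have "\<dots> = (\<Sum>(d, c)\<in>dec a. power_sum n d / of_nat n * current (int n) (\<lambda>T. V (c, T)) S)"
      by (rule sum_dec_cong) simp
    finally show ?thesis .
  qed
  have ps: "n = mdeg d" if "power_sum n d \<noteq> 0" for n d
    using that by (auto simp: power_sum_def when_def split: if_splits)
  have "Hx V (a, S) = Sum_any (\<lambda>n. \<Sum>(d, c)\<in>dec a. ?t n d c)"
    unfolding Hx_def prod.case inner by (rule Sum_any.cong) (simp add: when_def split_def)
  also have "\<dots> = (\<Sum>n\<le>mdeg a. \<Sum>(d, c)\<in>dec a. ?t n d c)"
  proof (rule Sum_any.expand_superset)
    show "{n. (\<Sum>(d, c)\<in>dec a. ?t n d c) \<noteq> 0} \<subseteq> {..mdeg a}"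
    proof
      fix n assume "n \<in> {n. (\<Sum>(d, c)\<in>dec a. ?t n d c) \<noteq> 0}"
      then have "(\<Sum>(d, c)\<in>dec a. ?t n d c) \<noteq> 0" by simp
      then obtain p where "p \<in> dec a" "(case p of (d, c) \<Rightarrow> ?t n d c) \<noteq> 0"
        by (rule sum.not_neutral_contains_not_neutral)
      then obtain d c where "d + c = a" "power_sum n d \<noteq> 0" by (cases p) auto
      then show "n \<in> {..mdeg a}" using ps[of n d] by (auto simp: mdeg_add)
    qed
  qed simp
  also have "\<dots> = (\<Sum>(d, c)\<in>dec a. \<Sum>n\<le>mdeg a. ?t n d c)"
    by (subst sum.swap) (simp add: split_def)
  also have "\<dots> = X.Hop (\<lambda>c T. V (c, T)) a S"
    unfolding X.Hop_def
  proof (rule sum_dec_cong)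
    fix d c assume dc: "d + c = a"
    have "(\<Sum>n\<le>mdeg a. ?t n d c) = (\<Sum>n\<in>{mdeg d}. ?t n d c)"
      by (rule sum.mono_neutral_right) (use dc ps[of _ d] in \<open>auto simp: mdeg_add when_def split: if_splits\<close>)
    also have "\<dots> = logX d * X.cur d (\<lambda>T. V (c, T)) S"
      using mdeg_eq_0[of d] by (cases "mdeg d = 0") (auto simp: logX_def power_sum_def when_def)
    finally show "(\<Sum>n\<le>mdeg a. ?t n d c) = logX d * X.cur d (\<lambda>T. V (c, T)) S" .
  qed
  finally show ?thesis .
qed

lemma exp_Hx_eq:
  assumes v: "v \<in> fock"
  shows "exp_Hx v a = X.E a v"
proof
  fix S
  have pow: "(Hx ^^ k) (\<lambda>(c, T). v T when c = 0) (b, T) = (X.Hop ^^ k) (X.Ini v) b T" for k b T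
  proof (induction k arbitrary: b T)
    case 0
    then show ?case by (simp add: X.Ini_def when_def)
  next
    case (Suc k)
    have "(\<lambda>c T. (Hx ^^ k) (\<lambda>(c, T). v T when c = 0) (c, T)) = (X.Hop ^^ k) (X.Ini v)"
      by (intro ext) (rule Suc)
    then show ?case by (simp add: Hx_Hop)
  qed
  show "exp_Hx v a S = X.E a v S"
  proof (cases "maya S")
    case True
    have "exp_Hx v a S = (\<Sum>k\<le>mdeg a. (X.Hop ^^ k) (X.Ini v) a S / of_nat (fact k))"
      unfolding exp_Hx_def op_exp_def pow
    proof (rule Sum_any.expand_superset)
      show "{k. (X.Hop ^^ k) (X.Ini v) a S / of_nat (fact k) \<noteq> 0} \<subseteq> {..mdeg a}"
        using X.Hop_pow_0[OF True, of a] by (force simp: not_le[symmetric])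
    qed simp
    then show ?thesis by (simp add: X.E_def)
  next
    case False
    then show ?thesis
      using fock_zero[OF X.pow_fock[OF v] False] by (simp add: exp_Hx_def op_exp_def pow X.E_def)
  qed
qed

lemma maya_eqI:
  assumes "u \<in> fock" "v \<in> fock" "\<And>S. maya S \<Longrightarrow> u S = v S"
  shows "u = v"
proof
  fix S
  show "u S = v S"
    using assms(3) fock_zero[OF assms(1)] fock_zero[OF assms(2)] by (cases "maya S") auto
qed

section \<open>Commutation of the coefficients of \<open>e\<^sup>H\<close>, and the exponential for
  two joined alphabets\<close>

lemma E_psi_fun:
  assumes "v \<in> fock"
  shows "X.E c (psi n v) = (\<lambda>S. \<Sum>p\<in>dec c. 1 * psi (n - int (mdeg (fst p))) (X.E (snd p) v) S)"
proof (rule maya_eqI)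
  show "(\<lambda>S. \<Sum>p\<in>dec c. 1 * psi (n - int (mdeg (fst p))) (X.E (snd p) v) S) \<in> fock"
    by (intro X.sum_fock psi_fock X.E_fock assms)
  show "X.E c (psi n v) \<in> fock" by (intro X.E_fock psi_fock assms)
  show "X.E c (psi n v) S = (\<Sum>p\<in>dec c. 1 * psi (n - int (mdeg (fst p))) (X.E (snd p) v) S)" if "maya S" for S
    using X.E_psi[OF assms that, of c n] by (simp add: split_def)
qed

lemma E_E_psi:
  assumes v: "v \<in> fock" and S: "maya S"
  shows "X.E a (X.E c (psi n v)) S = (\<Sum>(x, y)\<in>dec a. \<Sum>(x', y')\<in>dec c.
    psi (n - int (mdeg x + mdeg x')) (X.E y (X.E y' v)) S)"
proof -
  have "X.E a (X.E c (psi n v)) S =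
      (\<Sum>q\<in>dec c. 1 * X.E a (psi (n - int (mdeg (fst q))) (X.E (snd q) v)) S)"
    unfolding E_psi_fun[OF v, of c] by (rule X.E_sum[OF psi_fock[OF X.E_fock[OF v]] S])
  also have "\<dots> = (\<Sum>q\<in>dec c. \<Sum>p\<in>dec a.
      psi (n - int (mdeg (fst q)) - int (mdeg (fst p))) (X.E (snd p) (X.E (snd q) v)) S)"
    by (rule sum.cong[OF refl]) (simp add: E_psi_fun[OF X.E_fock[OF v]])
  also have "\<dots> = (\<Sum>p\<in>dec a. \<Sum>q\<in>dec c.
      psi (n - int (mdeg (fst p) + mdeg (fst q))) (X.E (snd p) (X.E (snd q) v)) S)"
    by (subst sum.swap) (simp add: algebra_simps)
  finally show ?thesis by (simp add: split_def)
qed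

lemma E_zero: "X.E c (\<lambda>_. 0) S = 0"
proof (cases "maya S")
  case True
  then show ?thesis using X.E_sum[of "{}" _ S c "\<lambda>_. 0"] by simp
next
  case False
  then show ?thesis using fock_zero[OF X.E_fock[OF X.zero_fock]] by metis
qed

lemma E_scale:
  assumes "v \<in> fock"
  shows "X.E c (\<lambda>T. x * v T) = (\<lambda>S. x * X.E c v S)"
proof (rule maya_eqI)
  show "(\<lambda>S. x * X.E c v S) \<in> fock" "X.E c (\<lambda>T. x * v T) \<in> fock"
    using X.sum_fock[of "{()}" "\<lambda>_. X.E c v" "\<lambda>_. x"] X.E_fock
      X.sum_fock[of "{()}" "\<lambda>_. v" "\<lambda>_. x"] assms by simp_all
  show "X.E c (\<lambda>T. x * v T) S = x * X.E c v S" if "maya S" for S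
    using X.E_sum[of "{()}" "\<lambda>_. v" S c "\<lambda>_. x"] assms that by simp
qed

lemma E_ket_lessThan: "X.E c (ket {..<l}) = (if c = 0 then ket {..<l} else (\<lambda>_. 0))"
proof (rule maya_eqI)
  show "X.E c (ket {..<l}) \<in> fock" "(if c = 0 then ket {..<l} else (\<lambda>_. 0)) \<in> fock"
    using ket_fock[OF maya_lessThan] X.zero_fock by (auto intro: X.E_fock)
  show "X.E c (ket {..<l}) S = (if c = 0 then ket {..<l} else (\<lambda>_. 0)) S" if "maya S" for S
    using X.E_vac[OF refl that, of c l] by simp
qed

lemma psi_ket_insert:
  assumes "n \<notin> S"
  shows "ket (insert n S) = (\<lambda>T. above_sign n S * psi n (ket S) T)"
  using psi_ket[OF assms, of 1] by (simp add: fun_eq_iff flip: mult.assoc)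

text \<open>Every Maya diagram is some filled sea plus finitely many particles. Seas of all depths,
  hence all charges, occur as starting points.\<close>

lemma maya_induct [consumes 1, case_names lessThan insert]:
  assumes "maya S" "\<And>l. R {..<l}" "\<And>n S. maya S \<Longrightarrow> n \<notin> S \<Longrightarrow> R S \<Longrightarrow> R (insert n S)"
  shows "R S"
proof -
  obtain l where l: "{..<l} \<subseteq> S" using maya_bounds[OF assms(1)] by metis
  have "maya ({..<l} \<union> X) \<and> R ({..<l} \<union> X)" if "finite X" "X \<inter> {..<l} = {}" for X
    using that
  proof (induction X rule: finite_induct)
    case (insert x X)
    then show ?case using assms(3)[of "{..<l} \<union> X" x] by auto
  qed (simp add: assms(2) maya_lessThan)
  moreover have "finite (S \<inter> {l..})" using maya_window[OF l] assms(1) by simp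
  moreover have "S = {..<l} \<union> (S \<inter> {l..})" using l by auto
  moreover have "S \<inter> {l..} \<inter> {..<l} = {}" by auto
  ultimately show ?thesis by metis
qed

definition reach2 :: "mono \<Rightarrow> mono \<Rightarrow> int set \<Rightarrow> int set set" where
  "reach2 a c S = (\<Union>T\<in>reach (int (mdeg a)) S. reach (int (mdeg c)) T)"

lemma reach2_maya: "T \<in> reach2 a c S \<Longrightarrow> maya T"
  using reach_maya by (auto simp: reach2_def)

lemma finite_reach2: "finite (reach2 a c S)"
  by (simp add: reach2_def finite_reach)

text \<open>Two successive exponentials still read finitely many coefficients, so identities checked
  on basis vectors extend to infinite combinations.\<close>

lemma E_finitary:
  assumes v: "v \<in> fock" and S: "maya S"
  shows "X.E a (X.E c v) S = (\<Sum>T\<in>reach2 a c S. v T * X.E a (X.E c (ket T)) S)"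
    (is "_ = (\<Sum>T\<in>?J. _)")
proof -
  have m: "maya T" if "T \<in> ?J" for T using that by (rule reach2_maya)
  have k: "X.E c (ket T) \<in> fock" if "T \<in> ?J" for T using m[OF that] by (intro X.E_fock ket_fock)
  have "X.E a (X.E c v) S = X.E a (\<lambda>U. \<Sum>T\<in>?J. v T * X.E c (ket T) U) S"
  proof (rule X.E_agree[OF X.E_fock[OF v] X.sum_fock[OF k] S])
    fix U assume U: "U \<in> reach (1 * int (mdeg a)) S"
    then show "X.E c v U = (\<Sum>T\<in>?J. v T * X.E c (ket T) U)"
      by (intro X.E_expand[OF v reach_maya[OF U]] m finite_reach2) (auto simp: reach2_def)
  qed
  also have "\<dots> = (\<Sum>T\<in>?J. v T * X.E a (X.E c (ket T)) S)"
    by (rule X.E_sum[OF k S])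
  finally show ?thesis .
qed

lemma E_E_ket_eq_0:
  assumes "maya S" "maya T" "T \<notin> reach2 a c S"
  shows "X.E a (X.E c (ket T)) S = 0"
  unfolding E_finitary[OF ket_fock[OF assms(2)] assms(1)]
proof (rule sum.neutral, intro ballI)
  fix U assume "U \<in> reach2 a c S"
  then have "U \<noteq> T" using assms(3) by blast
  then show "ket T U * X.E a (X.E c (ket U)) S = 0" by (simp add: ket_def)
qed

text \<open>On a sea both sides are trivial. A fermion passes through both exponentials with a shift
  by the sum of the two degrees, which is symmetric in the two monomials.\<close>

lemma E_commute_ket:
  assumes "maya T"
  shows "maya S \<Longrightarrow> X.E a (X.E c (ket T)) S = X.E c (X.E a (ket T)) S"
  using assms
proof (induction T arbitrary: S a c rule: maya_induct)
  case (lessThan l)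
  then show ?case by (simp add: E_ket_lessThan E_zero)
next
  case (insert n T)
  have k: "ket T \<in> fock" "psi n (ket T) \<in> fock" using insert.hyps by (auto intro: ket_fock psi_fock)
  have "X.E a (X.E c (psi n (ket T))) S = X.E c (X.E a (psi n (ket T))) S"
  proof -
    have "X.E a (X.E c (psi n (ket T))) S = (\<Sum>(x, y)\<in>dec a. \<Sum>(x', y')\<in>dec c.
        psi (n - int (mdeg x + mdeg x')) (X.E y (X.E y' (ket T))) S)"
      by (rule E_E_psi[OF k(1) insert.prems])
    also have "\<dots> = (\<Sum>(x, y)\<in>dec a. \<Sum>(x', y')\<in>dec c.
        psi (n - int (mdeg x' + mdeg x)) (X.E y' (X.E y (ket T))) S)"
    proof (intro sum_dec_cong)
      fix x y x' y'
      have "X.E y (X.E y' (ket T)) (S - {m}) = X.E y' (X.E y (ket T)) (S - {m})" for m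
        by (rule insert.IH) (simp add: insert.prems)
      then show "psi (n - int (mdeg x + mdeg x')) (X.E y (X.E y' (ket T))) S =
          psi (n - int (mdeg x' + mdeg x)) (X.E y' (X.E y (ket T))) S"
        by (simp add: psi_def add.commute)
    qed
    also have "\<dots> = (\<Sum>(x', y')\<in>dec c. \<Sum>(x, y)\<in>dec a.
        psi (n - int (mdeg x' + mdeg x)) (X.E y' (X.E y (ket T))) S)"
      unfolding split_def by (rule sum.swap)
    also have "\<dots> = X.E c (X.E a (psi n (ket T))) S"
      by (rule E_E_psi[OF k(1) insert.prems, symmetric])
    finally show ?thesis .
  qed
  then show ?case
    unfolding psi_ket_insert[OF insert.hyps(2)] E_scale[OF k(2)] E_scale[OF X.E_fock[OF k(2)]] by simp
qed

lemma E_commute: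
  assumes v: "v \<in> fock" and S: "maya S"
  shows "X.E a (X.E c v) S = X.E c (X.E a v) S"
proof -
  let ?J = "reach2 a c S \<union> reach2 c a S"
  have "X.E a (X.E c v) S = (\<Sum>T\<in>?J. v T * X.E a (X.E c (ket T)) S)"
    unfolding E_finitary[OF v S]
    by (rule sum.mono_neutral_left) (use finite_reach2 E_E_ket_eq_0[OF S] reach2_maya in auto)
  also have "\<dots> = (\<Sum>T\<in>?J. v T * X.E c (X.E a (ket T)) S)"
  proof (rule sum.cong[OF refl])
    fix T assume "T \<in> ?J"
    then have "maya T" using reach2_maya by auto
    then show "v T * X.E a (X.E c (ket T)) S = v T * X.E c (X.E a (ket T)) S"
      by (simp only: E_commute_ket[OF _ S])
  qed
  also have "\<dots> = X.E c (X.E a v) S"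
    unfolding E_finitary[OF v S]
    by (rule sum.mono_neutral_right) (use finite_reach2 E_E_ket_eq_0[OF S] reach2_maya in auto)
  finally show ?thesis .
qed

lemma lookup_interleave:
  "lookup (interleave a c) i =
    (if even i then lookup a (i div 2) else lookup c (i div 2))"
  by (simp add: interleave.rep_eq)

lemma interleave_add: "interleave (a + a') (c + c') = interleave a c + interleave a' c'"
  by (rule poly_mapping_eqI) (simp add: lookup_interleave lookup_add)

lemma interleave_inj: "interleave a c = interleave a' c' \<longleftrightarrow> a = a' \<and> c = c'"
proof
  assume eq: "interleave a c = interleave a' c'"
  have "lookup a i = lookup a' i"
    "lookup c i = lookup c' i" for i
    using arg_cong[OF eq, of "\<lambda>p. lookup p (2 * i)"]
      arg_cong[OF eq, of "\<lambda>p. lookup p (2 * i + 1)"] by (simp_all add: lookup_interleave)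
  then show "a = a' \<and> c = c'" by (auto intro: poly_mapping_eqI)
qed auto

lemma interleave_surj: "\<exists>a c. z = interleave a c"
proof -
  have i: "inj (\<lambda>i::nat. 2 * i)" "inj (\<lambda>i::nat. Suc (2 * i))" by (auto simp: inj_def)
  have "z = interleave (Poly_Mapping.map_key (\<lambda>i. 2 * i) z) (Poly_Mapping.map_key (\<lambda>i. Suc (2 * i)) z)"
    by (rule poly_mapping_eqI)
      (auto simp: lookup_interleave Poly_Mapping.map_key.rep_eq[OF i(1)] Poly_Mapping.map_key.rep_eq[OF i(2)]
       elim!: oddE evenE)
  then show ?thesis by blast
qed

lemma interleave_eq_0: "interleave a c = 0 \<longleftrightarrow> a = 0 \<and> c = 0"
proof -
  have "interleave 0 0 = 0" by (rule poly_mapping_eqI) (simp add: lookup_interleave)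
  then show ?thesis using interleave_inj[of a c 0 0] by simp
qed

lemma mdeg_interleave: "mdeg (interleave a c) = mdeg a + mdeg c"
proof -
  let ?K = "(\<lambda>i. 2 * i) ` keys a" and ?L = "(\<lambda>i. 2 * i + 1) ` keys c"
  have keys: "keys (interleave a c) = ?K \<union> ?L"
  proof (intro equalityI subsetI)
    fix i assume i: "i \<in> keys (interleave a c)"
    show "i \<in> ?K \<union> ?L"
    proof (cases "even i")
      case True
      then have "i = 2 * (i div 2)" "i div 2 \<in> keys a" using i by (auto simp: in_keys_iff lookup_interleave)
      then show ?thesis by (intro UnI1 image_eqI)
    next
      case False
      then have "i = 2 * (i div 2) + 1" "i div 2 \<in> keys c" using i by (auto simp: in_keys_iff lookup_interleave)
      then show ?thesis by (intro UnI2 image_eqI)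
    qed
  qed (auto simp: in_keys_iff lookup_interleave)
  have "?K \<inter> ?L = {}" by auto presburger
  then have "mdeg (interleave a c) = (\<Sum>i\<in>?K. lookup (interleave a c) i) + (\<Sum>i\<in>?L. lookup (interleave a c) i)"
    unfolding mdeg_def keys by (intro sum.union_disjoint) auto
  also have "\<dots> = mdeg a + mdeg c"
    by (simp add: sum.reindex inj_on_def lookup_interleave mdeg_def)
  finally show ?thesis .
qed

lemma sum_dec_interleave:
  "(\<Sum>(z, w)\<in>dec (interleave a c). f z w) =
    (\<Sum>(x, y)\<in>dec a. \<Sum>(x', y')\<in>dec c. f (interleave x x') (interleave y y'))"
proof -
  let ?g = "\<lambda>((x, y), (x', y')). (interleave x x', interleave y y')"
  have "?g ` (dec a \<times> dec c) = dec (interleave a c)"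
  proof (intro equalityI subsetI)
    fix p assume "p \<in> dec (interleave a c)"
    then obtain z w where p: "p = (z, w)" "z + w = interleave a c" by (cases p) auto
    obtain x x' y y' where zw: "z = interleave x x'" "w = interleave y y'" using interleave_surj by metis
    then have "x + y = a" "x' + y' = c" using p(2) by (auto simp flip: interleave_add simp: interleave_inj)
    then show "p \<in> ?g ` (dec a \<times> dec c)" using p zw by (intro image_eqI[of _ _ "((x, y), (x', y'))"]) auto
  qed (auto simp flip: interleave_add)
  moreover have "inj_on ?g (dec a \<times> dec c)" by (auto simp: inj_on_def interleave_inj)
  ultimately have "(\<Sum>(z, w)\<in>dec (interleave a c). f z w) = (\<Sum>p\<in>dec a \<times> dec c. case ?g p of (z, w) \<Rightarrow> f z w)"
    by (metis (no_types, lifting) sum.reindex_cong)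
  also have "\<dots> = (\<Sum>(x, y)\<in>dec a. \<Sum>(x', y')\<in>dec c. f (interleave x x') (interleave y y'))"
    by (simp add: sum.cartesian_product split_def)
  finally show ?thesis .
qed

text \<open>The same induction applies: decompositions of an interleaved monomial are pairs of
  decompositions, and degrees add, so both sides shift the fermion alike.\<close>

lemma E_interleave_ket:
  assumes "maya T"
  shows "maya S \<Longrightarrow> X.E (interleave a c) (ket T) S = X.E a (X.E c (ket T)) S"
  using assms
proof (induction T arbitrary: S a c rule: maya_induct)
  case (lessThan l)
  then show ?case by (auto simp: E_ket_lessThan E_zero interleave_eq_0)
next
  case (insert n T)
  have k: "ket T \<in> fock" "psi n (ket T) \<in> fock" using insert.hyps by (auto intro: ket_fock psi_fock)
  have "X.E (interleave a c) (psi n (ket T)) S = X.E a (X.E c (psi n (ket T))) S"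
  proof -
    have "X.E (interleave a c) (psi n (ket T)) S = (\<Sum>(x, y)\<in>dec a. \<Sum>(x', y')\<in>dec c.
        1 * psi (n - 1 * int (mdeg (interleave x x'))) (X.E (interleave y y') (ket T)) S)"
      unfolding X.E_psi[OF k(1) insert.prems] by (rule sum_dec_interleave)
    also have "\<dots> = (\<Sum>(x, y)\<in>dec a. \<Sum>(x', y')\<in>dec c.
        psi (n - int (mdeg x + mdeg x')) (X.E y (X.E y' (ket T))) S)"
    proof (intro sum_dec_cong)
      fix x y x' y'
      have "X.E (interleave y y') (ket T) (S - {m}) = X.E y (X.E y' (ket T)) (S - {m})" for m
        by (rule insert.IH) (simp add: insert.prems)
      then show "1 * psi (n - 1 * int (mdeg (interleave x x'))) (X.E (interleave y y') (ket T)) S =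
          psi (n - int (mdeg x + mdeg x')) (X.E y (X.E y' (ket T))) S"
        by (simp add: psi_def mdeg_interleave)
    qed
    also have "\<dots> = X.E a (X.E c (psi n (ket T))) S"
      by (rule E_E_psi[OF k(1) insert.prems, symmetric])
    finally show ?thesis .
  qed
  then show ?case
    unfolding psi_ket_insert[OF insert.hyps(2)] E_scale[OF k(2)] E_scale[OF X.E_fock[OF k(2)]] by simp
qed

lemma E_interleave:
  assumes v: "v \<in> fock" and S: "maya S"
  shows "X.E (interleave a c) v S = X.E a (X.E c v) S"
proof -
  let ?R = "reach (1 * int (mdeg (interleave a c))) S"
  let ?J = "reach2 a c S \<union> ?R"
  have m: "maya T" if "T \<in> ?J" for T using that reach_maya reach2_maya by auto
  have fin: "finite ?J" by (simp add: finite_reach finite_reach2)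
  have "X.E (interleave a c) v S = (\<Sum>T\<in>?J. v T * X.E (interleave a c) (ket T) S)"
    by (rule X.E_expand[OF v S fin _ m]) auto
  also have "\<dots> = (\<Sum>T\<in>?J. v T * X.E a (X.E c (ket T)) S)"
    by (rule sum.cong[OF refl]) (simp only: E_interleave_ket[OF m S])
  also have "\<dots> = X.E a (X.E c v) S"
    unfolding E_finitary[OF v S]
    by (rule sum.mono_neutral_right) (use fin E_E_ket_eq_0[OF S] m in auto)
  finally show ?thesis .
qed

section \<open>Schur and Grothendieck polynomials in finitely many variables\<close>

lemma lookup_mult_dec:
  fixes f g :: mpol
  shows "lookup (f * g) a =
    (\<Sum>(x, y)\<in>dec a. lookup f x * lookup g y)"
proof -
  have "lookup (f * g) a =
      Sum_any (\<lambda>(x, y). lookup f x * lookup g y when a = x + y)"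
    unfolding times_poly_mapping.rep_eq by (rule prod_fun_unfold_prod) auto
  also have "\<dots> = (\<Sum>(x, y)\<in>dec a. lookup f x * lookup g y when a = x + y)"
    by (rule Sum_any.expand_superset[OF finite_dec_mono]) (auto simp: when_def split: if_splits)
  also have "\<dots> = (\<Sum>(x, y)\<in>dec a. lookup f x * lookup g y)"
    by (rule sum_dec_cong) auto
  finally show ?thesis .
qed

lemma lookup_sign_mult:
  "lookup ((- 1) ^ k * f) a = (- 1) ^ k * lookup (f :: mpol) a"
  by (cases "even k") simp_all

text \<open>The complete homogeneous polynomial in \<open>n\<close> variables; the integer index
  lets it vanish in negative degree.\<close>

definition hpol :: "nat \<Rightarrow> int \<Rightarrow> mpol" where
  "hpol n k = (\<Sum>d\<in>{d. keys d \<subseteq> {..<n} \<and> int (mdeg d) = k}. single d 1)"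

lemma finite_hpol: "finite {d. keys d \<subseteq> {..<n} \<and> int (mdeg d) = k}"
  by (rule finite_subset[OF _ finite_mono_bounded[of "{..<n}" "nat k"]]) auto

lemma lookup_hpol:
  "lookup (hpol n k) a = (1 when keys a \<subseteq> {..<n} \<and> int (mdeg a) = k)"
proof -
  let ?D = "{d. keys d \<subseteq> {..<n} \<and> int (mdeg d) = k}"
  have "lookup (hpol n k) a = (\<Sum>d\<in>?D. if d = a then 1 else 0)"
    unfolding hpol_def lookup_sum by (rule sum.cong) (auto simp: lookup_single when_def)
  also have "\<dots> = (1 when keys a \<subseteq> {..<n} \<and> int (mdeg a) = k)"
    using finite_hpol[of n k] by (simp add: when_def)
  finally show ?thesis .
qed

lemma hpol_neg: "k < 0 \<Longrightarrow> hpol n k = 0"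
  by (rule poly_mapping_eqI) (auto simp: lookup_hpol)

lemma hpol_0: "hpol n 0 = 1"
  by (rule poly_mapping_eqI) (auto simp: lookup_hpol lookup_one mdeg_eq_0 when_def)

definition in_vars :: "nat \<Rightarrow> mpol \<Rightarrow> bool" where
  "in_vars n f \<longleftrightarrow> (\<forall>a. lookup f a \<noteq> 0 \<longrightarrow> keys a \<subseteq> {..<n})"

lemma in_vars_sum: "(\<And>i. i \<in> I \<Longrightarrow> in_vars n (f i)) \<Longrightarrow> in_vars n (\<Sum>i\<in>I. f i)"
  unfolding in_vars_def lookup_sum by (metis sum.not_neutral_contains_not_neutral)

lemma in_vars_mult:
  assumes "in_vars n f" "in_vars n g"
  shows "in_vars n (f * g)"
  unfolding in_vars_def
proof (intro allI impI)
  fix a assume "lookup (f * g) a \<noteq> 0"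
  then obtain p where "p \<in> dec a"
    "(case p of (x, y) \<Rightarrow> lookup f x * lookup g y) \<noteq> 0"
    unfolding lookup_mult_dec by (rule sum.not_neutral_contains_not_neutral)
  then obtain x y where xy: "x + y = a" "lookup f x \<noteq> 0" "lookup g y \<noteq> 0"
    by (cases p) auto
  then have "keys x \<subseteq> {..<n}" "keys y \<subseteq> {..<n}"
    using assms by (auto simp: in_vars_def)
  then show "keys a \<subseteq> {..<n}" using keys_add[of x y] xy(1) by blast
qed

lemma in_vars_wedge:
  "(\<And>i s. in_vars n (r i s)) \<Longrightarrow> in_vars n (wedge L r M)"
proof (induction L arbitrary: r M)
  case 0
  then show ?case by (auto simp: in_vars_def lookup_one when_def)
next
  case (Suc L)
  have sgn: "in_vars n ((- 1) ^ k * f)" if "in_vars n f" for k f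
    using that by (simp add: in_vars_def lookup_sign_mult)
  show ?case unfolding wedge.simps mult.assoc
    by (rule in_vars_sum, rule sgn, rule in_vars_mult, rule Suc.prems, rule Suc.IH, rule Suc.prems)
qed

lemma in_vars_hpol: "in_vars n (hpol n k)"
  by (simp add: in_vars_def lookup_hpol)

fun word :: "nat \<Rightarrow> nat \<Rightarrow> (nat \<Rightarrow> int) \<Rightarrow> vec" where
  "word N 0 b = ket {..<- int N}"
| "word N (Suc L) b = psi (b 0) (word N L (\<lambda>i. b (Suc i)))"

lemma word_fock: "word N L b \<in> fock"
  by (induction L arbitrary: b) (auto intro: psi_fock ket_fock maya_lessThan)

text \<open>Each fermion is replaced by a row of complete homogeneous polynomials; at the vacuum
  this is the Jacobi-Trudi determinant. General \<open>S\<close> is needed for the induction on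
  \<open>L\<close>.\<close>

lemma E_word:
  assumes a: "keys a \<subseteq> {..<n}" and S: "maya S"
  shows "X.E a (word N L b) S = (if {..<- int N} \<subseteq> S
    then lookup (wedge L (\<lambda>i s. hpol n (b i - s)) (S \<inter> {- int N..})) a else 0)"
  using a S
proof (induction L arbitrary: a b S)
  case 0
  have iff: "{..<- int N} \<subseteq> S \<and> S \<inter> {- int N..} = {} \<longleftrightarrow> S = {..<- int N}" by auto
  have "X.E a (word N 0 b) S = (1 when a = 0 \<and> S = {..<- int N})"
    unfolding word.simps E_ket_lessThan by (simp add: ket_def when_def)
  then show ?case
    unfolding iff[symmetric] wedge.simps(1)
    by (cases "S \<inter> {- int N..} = {}") (simp_all add: lookup_one when_def)
next
  case (Suc L)
  let ?b = "\<lambda>i. b (Suc i)" and ?F = "S \<inter> {- int N..}"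
  let ?r = "\<lambda>i s. hpol n (?b i - s)"
  have F: "finite ?F" if "{..<- int N} \<subseteq> S" using maya_window[OF that] Suc.prems by simp
  have low: "psi s (X.E y (word N L ?b)) S = 0"
    if "keys y \<subseteq> {..<n}" "\<not> ({..<- int N} \<subseteq> S \<and> - int N \<le> s)" for y s
  proof (cases "s \<in> S")
    case True
    have "\<not> {..<- int N} \<subseteq> S - {s}"
    proof
      assume sub: "{..<- int N} \<subseteq> S - {s}"
      then have "s \<notin> {..<- int N}" "{..<- int N} \<subseteq> S" by blast+
      then show False using that(2) by simp
    qed
    then have "X.E y (word N L ?b) (S - {s}) = 0"
      using Suc.IH[OF that(1), of "S - {s}" ?b] Suc.prems(2) by simp
    then show ?thesis by (simp add: psi_def)
  qed (simp add: psi_def)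
  have "X.E a (word N (Suc L) b) S = (\<Sum>(x, y)\<in>dec a. psi (b 0 - int (mdeg x)) (X.E y (word N L ?b)) S)"
    using X.E_psi[OF word_fock Suc.prems(2), of a "b 0" N L ?b] by simp
  also have "\<dots> = (if {..<- int N} \<subseteq> S
    then lookup (wedge (Suc L) (\<lambda>i s. hpol n (b i - s)) ?F) a else 0)"
  proof (cases "{..<- int N} \<subseteq> S")
    case True
    have "lookup (wedge (Suc L) (\<lambda>i s. hpol n (b i - s)) ?F) a =
        (\<Sum>s\<in>?F. \<Sum>(x, y)\<in>dec a. (- 1) ^ card {k \<in> ?F. s < k} *
          (lookup (hpol n (b 0 - s)) x * lookup (wedge L ?r (?F - {s})) y))"
      unfolding wedge.simps lookup_sum mult.assoc lookup_sign_mult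
      unfolding lookup_mult_dec dec_sum_left ..
    also have "\<dots> = (\<Sum>(x, y)\<in>dec a. \<Sum>s\<in>?F. (- 1) ^ card {k \<in> ?F. s < k} *
          (lookup (hpol n (b 0 - s)) x * lookup (wedge L ?r (?F - {s})) y))"
      by (subst sum.swap) (simp add: split_def)
    also have "\<dots> = (\<Sum>(x, y)\<in>dec a. psi (b 0 - int (mdeg x)) (X.E y (word N L ?b)) S)"
    proof (rule sum_dec_cong)
      fix x y assume xy: "x + y = a"
      have kx: "keys x \<subseteq> {..<n}" and ky: "keys y \<subseteq> {..<n}"
        using keys_dec[OF xy] Suc.prems(1) by auto
      let ?m = "b 0 - int (mdeg x)"
      \<comment> \<open>Every monomial \<open>x\<close> in these variables occurs with coefficient 1
        in just one \<open>hpol\<close>, so only the site \<open>b 0 - int (mdeg x)\<close>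
        remains.\<close>
      have "(\<Sum>s\<in>?F. (- 1) ^ card {k \<in> ?F. s < k} *
          (lookup (hpol n (b 0 - s)) x * lookup (wedge L ?r (?F - {s})) y)) =
        (\<Sum>s\<in>?F. if s = ?m then (- 1) ^ card {k \<in> ?F. ?m < k} * lookup (wedge L ?r (?F - {?m})) y else 0)"
        by (rule sum.cong) (auto simp: lookup_hpol kx when_def)
      also have "\<dots> = psi ?m (X.E y (word N L ?b)) S"
      proof (cases "?m \<in> ?F")
        case m: True
        have e: "{k \<in> ?F. ?m < k} = {k \<in> S. ?m < k}" "(S - {?m}) \<inter> {- int N..} = ?F - {?m}"
          "{..<- int N} \<subseteq> S - {?m}" using m True by auto
        have "X.E y (word N L ?b) (S - {?m}) = lookup (wedge L ?r (?F - {?m})) y"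
          using Suc.IH[OF ky, of "S - {?m}" ?b] Suc.prems(2) e by simp
        then show ?thesis using m F[OF True] e(1) by (simp add: psi_def above_sign_def)
      next
        case False
        then have "psi ?m (X.E y (word N L ?b)) S = 0"
          using low[OF ky, of ?m] by (cases "?m \<in> S") (auto simp: psi_def)
        moreover have "(\<Sum>s\<in>?F. if s = ?m then (- 1) ^ card {k \<in> ?F. ?m < k} *
            lookup (wedge L ?r (?F - {?m})) y else 0) = 0"
          by (rule sum.neutral) (use False in auto)
        ultimately show ?thesis by simp
      qed
      finally show "(\<Sum>s\<in>?F. (- 1) ^ card {k \<in> ?F. s < k} *
          (lookup (hpol n (b 0 - s)) x * lookup (wedge L ?r (?F - {s})) y)) =
          psi ?m (X.E y (word N L ?b)) S" .
    qed
    finally show ?thesis using True by simp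
  next
    case False
    have "(\<Sum>(x, y)\<in>dec a. psi (b 0 - int (mdeg x)) (X.E y (word N L ?b)) S) = (\<Sum>(x, y)\<in>dec a. 0)"
      by (rule sum_dec_cong) (use low False keys_dec Suc.prems(1) in blast)
    then show ?thesis using False by (simp add: split_def)
  qed
  finally show ?case .
qed

lemma ket_dgm_word:
  assumes p: "is_partition p" and N: "length p \<le> N"
  shows "ket (dgm p) = word N N (beta_num p)"
proof -
  have "word N L (\<lambda>i. beta_num p (k + i)) = ket ({..<- int N} \<union> beta_num p ` {k..<k + L})" if "k + L = N" for k L
    using that
  proof (induction L arbitrary: k)
    case (Suc L)
    let ?T = "{..<- int N} \<union> beta_num p ` {Suc k..<Suc k + L}"
    have lt: "j < beta_num p k" if "j \<in> ?T" for j
      using that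
    proof
      assume "j \<in> {..<- int N}"
      then show ?thesis using beta_num_ge[of k N p] Suc.prems by simp
    next
      assume "j \<in> beta_num p ` {Suc k..<Suc k + L}"
      then show ?thesis using beta_num_less[OF p] by auto
    qed
    have nin: "beta_num p k \<notin> ?T" using lt by blast
    have above: "{j \<in> ?T. beta_num p k < j} = {}" using lt by fastforce
    have sgn: "above_sign (beta_num p k) ?T = 1" unfolding above_sign_def above by simp
    have "word N (Suc L) (\<lambda>i. beta_num p (k + i)) = psi (beta_num p k) (ket ?T)"
      using Suc.IH[of "Suc k"] Suc.prems by simp
    also have "\<dots> = ket (insert (beta_num p k) ?T)"
      using psi_ket[OF nin, of 1] unfolding sgn by simp
    also have "insert (beta_num p k) ?T = {..<- int N} \<union> beta_num p ` {k..<k + Suc L}"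
    proof -
      have "{k..<k + Suc L} = insert k {Suc k..<Suc k + L}" by auto
      then show ?thesis by simp
    qed
    finally show ?case .
  qed simp
  from this[of 0 N] have "word N N (beta_num p) = ket ({..<- int N} \<union> beta_num p ` {..<N})"
    by (simp add: atLeast0LessThan)
  moreover have "dgm p = {..<- int N} \<union> (dgm p \<inter> {- int N..})"
    using dgm_window(1)[OF N] by auto
  ultimately show ?thesis using dgm_window(2)[OF N] by simp
qed

definition schur_dgm :: "int set \<Rightarrow> series" where
  "schur_dgm T = (\<lambda>a. X.E a (ket T) {..<0})"

definition spol :: "nat \<Rightarrow> nat \<Rightarrow> nat list \<Rightarrow> mpol" where
  "spol n N p = wedge N (\<lambda>i s. hpol n (beta_num p i - s)) {- int N..<0}"

lemma schur_dgm_spol: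
  assumes "is_partition p" "length p \<le> N" "keys a \<subseteq> {..<n}"
  shows "schur_dgm (dgm p) a = lookup (spol n N p) a"
proof -
  have "{..<0} \<inter> {- int N..} = {- int N..<0}" "{..<- int N} \<subseteq> {..<0}" by auto
  then show ?thesis
    using E_word[OF assms(3) maya_lessThan[of 0], of N N "beta_num p"]
    by (simp add: schur_dgm_def ket_dgm_word[OF assms(1,2)] spol_def)
qed

lemma restricts_to_schur_dgm:
  assumes "is_partition p" "length p \<le> n"
  shows "restricts_to n (schur_dgm (dgm p)) (spol n n p)"
proof -
  have "in_vars n (spol n n p)"
    unfolding spol_def by (intro in_vars_wedge in_vars_hpol)
  then show ?thesis
    using schur_dgm_spol[OF assms] by (auto simp: restricts_to_def in_vars_def when_def)
qed

subsection \<open>The Jacobi--Trudi and bialternant formulas\<close>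

lemma lookup_X_mult:
  "lookup (X n * f) a =
    (if n \<in> keys a then lookup f (a - single n 1) else 0)"
proof -
  have "lookup (X n * f) a =
      (\<Sum>(x, y)\<in>dec a. if x = single n 1 then lookup f y else 0)"
    unfolding lookup_mult_dec by (rule sum_dec_cong) (simp add: X_def lookup_single when_def)
  also have "\<dots> = (\<Sum>(x, y)\<in>{(x, y)\<in>dec a. x = single n 1}. lookup f y)"
    by (rule sum.mono_neutral_cong_right) (auto simp: finite_dec_mono split: if_splits)
  also have "{(x, y)\<in>dec a. x = single n 1} =
      (if n \<in> keys a then {(single n 1, a - single n 1)} else {})"
  proof (cases "n \<in> keys a")
    case True
    have "single n 1 + (a - single n 1) = a"
      by (rule poly_mapping_eqI) (use True in \<open>auto simp: in_keys_iff lookup_add lookup_minus lookup_single when_def\<close>)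
    then show ?thesis using True by auto
  next
    case False
    have "single n 1 + y \<noteq> a" for y
      using keys_dec[of "single n 1" y a] False by auto
    then show ?thesis using False by auto
  qed
  finally show ?thesis by simp
qed

lemma hpol_Suc: "hpol (Suc n) k = X n * hpol (Suc n) (k - 1) + hpol n k"
proof (rule poly_mapping_eqI)
  fix a
  show "lookup (hpol (Suc n) k) a = lookup (X n * hpol (Suc n) (k - 1) + hpol n k) a"
  proof (cases "n \<in> keys a")
    case True
    let ?b = "a - single n 1"
    have a: "single n 1 + ?b = a"
      by (rule poly_mapping_eqI) (use True in \<open>auto simp: in_keys_iff lookup_add lookup_minus lookup_single when_def\<close>)
    have "mdeg a = Suc (mdeg ?b)" using mdeg_add[of "single n 1" ?b] a by simp
    moreover have "keys a \<subseteq> {..<Suc n} \<longleftrightarrow> keys ?b \<subseteq> {..<Suc n}"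
      using keys_dec[OF a] keys_add[of "single n 1" ?b] a by auto
    ultimately show ?thesis using True by (auto simp: lookup_add lookup_X_mult lookup_hpol when_def)
  next
    case False
    then have "keys a \<subseteq> {..<Suc n} \<longleftrightarrow> keys a \<subseteq> {..<n}"
      by (auto simp: less_Suc_eq)
    then show ?thesis using False by (simp add: lookup_add lookup_X_mult lookup_hpol)
  qed
qed

definition lin_factor :: "nat \<Rightarrow> mpol fps" where
  "lin_factor l = 1 - fps_const (X l) * fps_X"

definition h_series :: "nat \<Rightarrow> mpol fps" where
  "h_series n = Abs_fps (\<lambda>k. hpol n (int k))"

lemma h_series_Suc: "lin_factor n * h_series (Suc n) = h_series n"
proof (rule fps_ext)
  fix k
  have "fps_nth (lin_factor n * h_series (Suc n)) k = hpol (Suc n) (int k) - (X n * hpol (Suc n) (int k - 1))"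
    by (cases k) (simp_all add: lin_factor_def h_series_def left_diff_distrib mult.assoc hpol_neg)
  then show "fps_nth (lin_factor n * h_series (Suc n)) k = fps_nth (h_series n) k"
    using hpol_Suc[of n "int k"] by (simp add: h_series_def)
qed

lemma h_series_0: "h_series 0 = 1"
  by (rule fps_ext, rule poly_mapping_eqI)
    (auto simp: h_series_def lookup_hpol lookup_one mdeg_eq_0 when_def)

lemma h_series_prod: "(\<Prod>l<n. lin_factor l) * h_series n = 1"
proof (induction n)
  case (Suc n)
  then show ?case using h_series_Suc[of n] by (simp add: mult.assoc)
qed (simp add: h_series_0)

lemma fps_nth_prod_lin_factor: "finite L \<Longrightarrow> card L < k \<Longrightarrow> fps_nth (\<Prod>l\<in>L. lin_factor l) k = 0"
proof (induction L arbitrary: k rule: finite_induct)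
  case (insert l L)
  then obtain k' where "k = Suc k'" "card L < k'" by (cases k) auto
  then show ?case using insert by (simp add: lin_factor_def left_diff_distrib mult.assoc)
qed simp

lemma fps_nth_prod_lin_factor_0: "finite L \<Longrightarrow> fps_nth (\<Prod>l\<in>L. lin_factor l) 0 = 1"
  by (induction L rule: finite_induct) (simp_all add: lin_factor_def)

text \<open>The signed elementary symmetric polynomial of degree \<open>k\<close> in all variables
  but \<open>X i\<close>.\<close>

definition ecoef :: "nat \<Rightarrow> nat \<Rightarrow> nat \<Rightarrow> mpol" where
  "ecoef n i k = fps_nth (\<Prod>l\<in>{..<n} - {i}. lin_factor l) k"

text \<open>Multiplying the product of all \<open>1/(1 - x\<^sub>l t)\<close> by the factors with
  \<open>l \<noteq> i\<close> leaves the geometric series of \<open>x\<^sub>i\<close>.\<close>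

lemma ecoef_hpol:
  assumes i: "i < n"
  shows "(\<Sum>k<n. ecoef n i k * hpol n (int m - int k)) = X i ^ m"
proof -
  let ?E = "\<Prod>l\<in>{..<n} - {i}. lin_factor l"
  let ?G = "Abs_fps (\<lambda>k. X i ^ k)"
  have "lin_factor i * ?G = 1"
  proof (rule fps_ext)
    fix k
    show "fps_nth (lin_factor i * ?G) k = fps_nth 1 k"
      by (cases k) (simp_all add: lin_factor_def left_diff_distrib mult.assoc)
  qed
  moreover have "lin_factor i * (?E * h_series n) = 1"
    using h_series_prod[of n] i prod.remove[of "{..<n}" i lin_factor] by (simp add: mult.assoc)
  ultimately have "?E * h_series n = ?G"
    by (metis (no_types, lifting) mult.assoc mult.commute mult_1_left)
  then have "X i ^ m = fps_nth (?E * h_series n) m" by simp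
  also have "\<dots> = (\<Sum>k=0..m. ecoef n i k * hpol n (int m - int k))"
    by (simp add: fps_mult_nth ecoef_def h_series_def of_nat_diff)
  also have "\<dots> = (\<Sum>k<n. ecoef n i k * hpol n (int m - int k))"
  proof (rule sum.mono_neutral_cong)
    fix k assume "k \<in> {0..m} - {..<n}"
    then have "card ({..<n} - {i}) < k" using i by auto
    then show "ecoef n i k * hpol n (int m - int k) = 0" by (simp add: ecoef_def fps_nth_prod_lin_factor)
  next
    fix k assume "k \<in> {..<n} - {0..m}"
    then show "ecoef n i k * hpol n (int m - int k) = 0" by (simp add: hpol_neg)
  qed auto
  finally show ?thesis ..
qed

lemma spol_det:
  "spol n N p = det (mat N N (\<lambda>(k, j). hpol n (beta_num p j + int (Suc k))))"
proof -
  have im: "(\<lambda>k. - int (Suc k)) ` {..<N} = {- int N..<0}"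
  proof (intro equalityI subsetI)
    fix x assume "x \<in> {- int N..<0}"
    then show "x \<in> (\<lambda>k. - int (Suc k)) ` {..<N}" by (intro image_eqI[of _ _ "nat (- x - 1)"]) auto
  qed auto
  have "spol n N p = det (mat N N (\<lambda>(i, j). hpol n (beta_num p i - (- int (Suc j)))))"
    unfolding spol_def im[symmetric] by (rule wedge_det) simp
  also have "\<dots> = det (transpose_mat (mat N N (\<lambda>(i, j). hpol n (beta_num p i + int (Suc j)))))"
    unfolding diff_minus_eq_add by (rule det_transpose[of _ N, symmetric]) simp
  also have "transpose_mat (mat N N (\<lambda>(i, j). hpol n (beta_num p i + int (Suc j)))) =
      mat N N (\<lambda>(k, j). hpol n (beta_num p j + int (Suc k)))"
    by (rule eq_matI) auto
  finally show ?thesis .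
qed

definition vander :: "nat \<Rightarrow> mpol" where
  "vander n = (\<Prod>(i, j) \<in> {(i, j). i < j \<and> j < n}. X i - X j)"

definition alternant :: "nat \<Rightarrow> nat list \<Rightarrow> mpol" where
  "alternant n p = det (mat n n (\<lambda>(i, j). X i ^ (part p j + n - Suc j)))"

text \<open>One matrix \<open>?E\<close> turns every Jacobi-Trudi matrix into the alternant matrix.
  Its determinant is found from the empty partition, where the Jacobi-Trudi matrix is unitriangular
  and the alternant is the Vandermonde product.\<close>

lemma alternant_spol: "spol n n p * vander n = alternant n p"
proof -
  let ?E = "mat n n (\<lambda>(i, k). ecoef n i (n - Suc k))"
  let ?J = "\<lambda>p. mat n n (\<lambda>(k, j). hpol n (beta_num p j + int (Suc k)))"
  have EJ: "?E * ?J p = mat n n (\<lambda>(i, j). X i ^ (part p j + n - Suc j))" for p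
  proof (rule eq_matI)
    fix i j assume "i < dim_row (mat n n (\<lambda>(i, j). X i ^ (part p j + n - Suc j)))"
      "j < dim_col (mat n n (\<lambda>(i, j). X i ^ (part p j + n - Suc j)))"
    then have ij: "i < n" "j < n" by auto
    let ?m = "part p j + n - Suc j"
    have "(?E * ?J p) $$ (i, j) = (\<Sum>k<n. ecoef n i (n - Suc k) * hpol n (beta_num p j + int (Suc k)))"
      using ij by (simp add: scalar_prod_def atLeast0LessThan)
    also have "\<dots> = (\<Sum>k<n. ecoef n i k * hpol n (int ?m - int k))"
      by (rule sum.reindex_bij_witness[where i = "\<lambda>k. n - Suc k" and j = "\<lambda>k. n - Suc k"])
        (use ij in \<open>auto simp: beta_num_def of_nat_diff algebra_simps\<close>)
    also have "\<dots> = X i ^ ?m" by (rule ecoef_hpol[OF ij(1)])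
    finally show "(?E * ?J p) $$ (i, j) = mat n n (\<lambda>(i, j). X i ^ (part p j + n - Suc j)) $$ (i, j)"
      using ij by simp
  qed auto
  have mult: "det ?E * det (?J p) = alternant n p" for p
    unfolding alternant_def EJ[symmetric] by (rule det_mult[symmetric]) auto
  have "det (?J []) = 1"
  proof -
    have "det (?J []) = prod_list (diag_mat (?J []))"
      by (rule det_lower_triangular[of n]) (auto simp: beta_num_def part_def hpol_neg)
    also have "\<dots> = 1" by (simp add: prod_list_diag_prod beta_num_def part_def hpol_0)
    finally show ?thesis .
  qed
  moreover have "alternant n [] = vander n"
    unfolding alternant_def vander_def det_vandermonde[symmetric] by (simp add: part_def)
  ultimately have "det ?E = vander n" using mult[of "[]"] by simp
  then show ?thesis using mult[of p] spol_det[of n n p] by (simp add: mult.commute)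
qed

lemma vander_nonzero: "vander n \<noteq> 0"
proof -
  have "X i - X j \<noteq> 0" if "i < j" for i j
  proof
    assume "X i - X j = 0"
    then have "lookup (X i) (single i 1) = lookup (X j) (single i 1)" by simp
    moreover have "single j 1 \<noteq> (single i 1 :: mono)"
    proof
      assume "single j 1 = (single i 1 :: mono)"
      from arg_cong[OF this, of keys] show False using that by simp
    qed
    ultimately show False by (simp add: X_def lookup_single when_def)
  qed
  moreover have "finite {(i, j). i < j \<and> j < n}"
    by (rule finite_subset[of _ "{..<n} \<times> {..<n}"]) auto
  ultimately show ?thesis unfolding vander_def by (auto simp: prod_zero_iff)
qed

text \<open>With fewer variables than parts the Jacobi-Trudi matrix has a kernel vector made of the
  coefficients of the product of all \<open>1 - x\<^sub>l t\<close>. Its pairing with row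
  \<open>i\<close> is a coefficient of the series 1 at a positive index, positive because
  \<open>part p i\<close> is nonzero.\<close>

lemma schur_dgm_eq_0:
  assumes p: "is_partition p" and n: "n < length p" and a: "keys a \<subseteq> {..<n}"
  shows "schur_dgm (dgm p) a = 0"
proof -
  define N where "N = length p"
  let ?J = "mat N N (\<lambda>(i, j). hpol n (beta_num p i + int (Suc j)))"
  let ?e = "\<lambda>k. fps_nth (\<Prod>l<n. lin_factor l) k"
  define v where "v = vec N (\<lambda>k. ?e (N - Suc k))"
  have "?J *\<^sub>v v = 0\<^sub>v N"
  proof (rule eq_vecI)
    fix i assume "i < dim_vec (0\<^sub>v N)"
    then have i: "i < N" by simp
    define m where "m = part p i + (N - Suc i)"
    have m: "int m = beta_num p i + int N" using i by (simp add: m_def beta_num_def of_nat_diff)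
    have "part p i \<noteq> 0" using part_nonzero[OF p, of i] i by (simp add: N_def)
    then have "m \<noteq> 0" by (simp add: m_def)
    have "(?J *\<^sub>v v) $ i = (\<Sum>k<N. hpol n (beta_num p i + int (Suc k)) * ?e (N - Suc k))"
      using i by (simp add: v_def scalar_prod_def atLeast0LessThan)
    also have "\<dots> = (\<Sum>k<N. ?e k * hpol n (int m - int k))"
      by (rule sum.reindex_bij_witness[where i = "\<lambda>k. N - Suc k" and j = "\<lambda>k. N - Suc k"])
        (auto simp: m of_nat_diff algebra_simps)
    also have "\<dots> = (\<Sum>k=0..m. ?e k * hpol n (int m - int k))"
    proof (rule sum.mono_neutral_cong)
      fix k assume "k \<in> {0..m} - {..<N}"
      then have "card {..<n} < k" using n by (simp add: N_def)
      then show "?e k * hpol n (int m - int k) = 0" using fps_nth_prod_lin_factor[of "{..<n}" k] by simp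
    qed (auto simp: hpol_neg)
    also have "\<dots> = fps_nth ((\<Prod>l<n. lin_factor l) * h_series n) m"
      by (simp add: fps_mult_nth h_series_def of_nat_diff)
    also have "\<dots> = 0" using \<open>m \<noteq> 0\<close> by (simp add: h_series_prod)
    finally show "(?J *\<^sub>v v) $ i = 0\<^sub>v N $ i" using i by simp
  qed simp
  moreover have "v \<noteq> 0\<^sub>v N"
  proof
    assume "v = 0\<^sub>v N"
    \<comment> \<open>The last entry is the constant coefficient of the product, which is 1, so the
      vector is nonzero.\<close>
    then have "v $ (N - 1) = 0" using n by (simp add: N_def)
    moreover have "v $ (N - 1) = ?e 0"
    proof -
      have "N - Suc (N - 1) = 0" "N - 1 < N" using n by (simp_all add: N_def)
      then show ?thesis by (simp only: v_def index_vec)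
    qed
    ultimately show False using fps_nth_prod_lin_factor_0[of "{..<n}"] by simp
  qed
  moreover have "v \<in> carrier_vec N" by (simp add: v_def)
  ultimately have "det ?J = 0"
    by (subst det_0_iff_vec_prod_zero[of _ N]) (rule mat_carrier, blast)
  moreover have "det ?J = spol n N p"
  proof -
    have "det ?J = det (transpose_mat ?J)" by (rule det_transpose[of _ N, symmetric]) simp
    also have "transpose_mat ?J = mat N N (\<lambda>(k, j). hpol n (beta_num p j + int (Suc k)))"
      by (rule eq_matI) auto
    finally show ?thesis by (simp add: spol_det)
  qed
  ultimately show ?thesis using schur_dgm_spol[OF p _ a, of N] by (simp add: N_def)
qed

lemma restricts_to_cancel:
  assumes P: "restricts_to n f P" and P': "restricts_to n g P'" and eq: "P * vander n = P' * vander n"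
    and a: "keys a \<subseteq> {..<n}"
  shows "f a = g a"
proof -
  have "P = P'" using eq vander_nonzero by simp
  then have "lookup P a = lookup P' a" by simp
  then show ?thesis using P P' a by (simp add: restricts_to_def)
qed

text \<open>Each monomial lies in finitely many variables, and polynomials form an integral domain,
  so the Vandermonde factor can be cancelled.\<close>

lemma bialternant_unique:
  assumes "bialternant b p f" "bialternant b p g"
  shows "f = g"
proof
  fix a :: mono
  obtain u where u: "keys a \<subseteq> {..<u}"
    using finite_nat_iff_bounded[of "keys a"] by auto
  define n where "n = max u (length p)"
  have n: "length p \<le> n" "keys a \<subseteq> {..<n}" using u by (auto simp: n_def)
  let ?d = "det (mat n n (\<lambda>(i, j). X i ^ (part p j + n - Suc j) * (1 + Const b * X i) ^ j))"
  have ex: "\<exists>P. restricts_to n h P \<and> P * vander n = ?d" if "bialternant b p h" for h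
    using that n(1) unfolding bialternant_def vander_def by simp
  obtain P where P: "restricts_to n f P" "P * vander n = ?d" using ex[OF assms(1)] by (elim exE conjE)
  obtain P' where P': "restricts_to n g P'" "P' * vander n = ?d" using ex[OF assms(2)] by (elim exE conjE)
  show "f a = g a"
    by (rule restricts_to_cancel[OF P(1) P'(1) _ n(2)]) (simp only: P P')
qed

lemma bialternant_schur_dgm: "is_partition p \<Longrightarrow> bialternant 0 p (schur_dgm (dgm p))"
  unfolding bialternant_def
proof (intro allI impI)
  fix n assume p: "is_partition p" and n: "n \<ge> length p"
  have "Const 0 = 0" by (simp add: Const_def)
  then have "det (mat n n (\<lambda>(i, j). X i ^ (part p j + n - Suc j) * (1 + Const 0 * X i) ^ j)) = alternant n p"
    by (simp add: alternant_def)
  then show "\<exists>P. restricts_to n (schur_dgm (dgm p)) P \<and> P * (\<Prod>(i, j) \<in> {(i, j). i < j \<and> j < n}. X i - X j) =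
        det (mat n n (\<lambda>(i, j). X i ^ (part p j + n - Suc j) * (1 + Const 0 * X i) ^ j))"
    using restricts_to_schur_dgm[OF p n] alternant_spol[of n p] by (auto simp: vander_def)
qed

lemma schur_eq: "is_partition p \<Longrightarrow> schur p = schur_dgm (dgm p)"
  unfolding schur_def using bialternant_schur_dgm bialternant_unique by blast

lemma wt_vac: "wt {..<0} = 0" and charge_vac: "charge {..<0} = 0"
proof -
  have "{..<0::int} \<inter> {0..} = {}" by auto
  then show "wt {..<0} = 0" "charge {..<0} = 0" by (simp_all add: wt_def charge_def)
qed

lemma schur_dgm_homogeneous:
  assumes "maya T" "schur_dgm T a \<noteq> 0"
  shows "wt T = int (mdeg a) \<and> charge T = 0"
proof -
  have "T \<in> reach (1 * int (mdeg a)) {..<0}"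
    using X.E_ket_reach[OF maya_lessThan assms(1)] assms(2) by (simp add: schur_dgm_def)
  then show ?thesis by (simp add: reach_def wt_vac charge_vac)
qed

text \<open>For a vector of the Fock space, the vacuum coefficient of \<open>e\<^sup>H\<^sup>(\<^sup>x\<^sup>)\<close> is its image under the
  boson--fermion correspondence.\<close>

lemma E_vac_expand:
  assumes w: "w \<in> fock" and d: "int (mdeg a) \<le> d"
  shows "X.E a w {..<0} = (\<Sum>p\<in>parts d. w (dgm p) * schur_dgm (dgm p) a)"
proof -
  have inj: "inj_on dgm (parts d)" using inj_dgm by (rule inj_on_subset) (auto simp: parts_def)
  have "X.E a w {..<0} = (\<Sum>T\<in>dgm ` parts d. w T * X.E a (ket T) {..<0})"
  proof (rule X.E_expand[OF w maya_lessThan])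
    show "reach (1 * int (mdeg a)) {..<0} \<subseteq> dgm ` parts d"
    proof
      fix T assume "T \<in> reach (1 * int (mdeg a)) {..<0}"
      then have T: "maya T" "wt T \<le> d" "charge T = 0"
        using d by (auto simp: reach_def wt_vac charge_vac)
      then obtain p where "is_partition p" "dgm p = T" using dgm_surj by metis
      then show "T \<in> dgm ` parts d" using T by (auto simp: parts_def)
    qed
  qed (auto simp: finite_parts maya_dgm)
  then show ?thesis by (simp add: sum.reindex[OF inj] schur_dgm_def)
qed

lemma E_vac_Sum_any:
  assumes w: "w \<in> fock"
  shows "X.E a w {..<0} = Sum_any (\<lambda>p. w (dgm p) * schur p a when is_partition p)"
proof -
  have "Sum_any (\<lambda>p. w (dgm p) * schur p a when is_partition p) =
      (\<Sum>p\<in>parts (int (mdeg a)). w (dgm p) * schur p a when is_partition p)"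
  proof (rule Sum_any.expand_superset[OF finite_parts])
    show "{p. (w (dgm p) * schur p a when is_partition p) \<noteq> 0} \<subseteq> parts (int (mdeg a))"
      using schur_dgm_homogeneous[OF maya_dgm] by (auto simp: when_def parts_def schur_eq split: if_splits)
  qed
  also have "\<dots> = (\<Sum>p\<in>parts (int (mdeg a)). w (dgm p) * schur_dgm (dgm p) a)"
    by (rule sum.cong) (auto simp: parts_def schur_eq)
  finally show ?thesis using E_vac_expand[OF w order_refl, of a] by simp
qed

lemma Lambda_hat_E_vac:
  assumes w: "w \<in> fock" and fin: "\<And>n. finite {p. is_partition p \<and> length p \<le> n \<and> w (dgm p) \<noteq> 0}"
  shows "(\<lambda>a. X.E a w {..<0}) \<in> Lambda_hat"
  unfolding Lambda_hat_def using fin E_vac_Sum_any[OF w]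
  by (intro CollectI exI[of _ "\<lambda>p. w (dgm p)"]) auto

subsection \<open>Grothendieck polynomials\<close>

lemma finite_ketG_parts: "finite {p. is_partition p \<and> length p \<le> n \<and> ketG q (dgm p) \<noteq> 0}"
proof (rule finite_imageD)
  show "finite (dgm ` {p. is_partition p \<and> length p \<le> n \<and> ketG q (dgm p) \<noteq> 0})"
    by (rule finite_subset[OF _ finite_ketG_window[of n q]]) (use dgm_window(1) in auto)
  show "inj_on dgm {p. is_partition p \<and> length p \<le> n \<and> ketG q (dgm p) \<noteq> 0}"
    using inj_dgm by (rule inj_on_subset) auto
qed

lemma Const_add: "Const (a + b) = Const a + Const b"
  by (simp add: Const_def single_add)

lemma Const_mult: "Const (a * b) = Const a * Const b"
  by (simp add: Const_def mult_single)

lemma Const_0: "Const 0 = 0" and Const_1: "Const 1 = 1"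
  by (simp_all add: Const_def)

lemma Const_sum: "Const (\<Sum>i\<in>I. f i) = (\<Sum>i\<in>I. Const (f i))"
  by (induction I rule: infinite_finite_induct) (simp_all add: Const_add Const_0)

lemma Const_sign: "Const ((- 1) ^ k) = (- 1) ^ k"
proof -
  have m: "Const (- 1) = - 1" by (simp add: Const_def single_uminus)
  show ?thesis
    by (induction k) (simp_all only: power_0 power_Suc Const_1 Const_mult m)
qed

lemma Const_wedge: "Const (wedge L r M) = wedge L (\<lambda>i s. Const (r i s)) M"
  by (induction L arbitrary: r M) (simp_all add: Const_0 Const_1 Const_sum Const_mult Const_sign)

lemma lookup_Const_mult: "lookup (Const c * f) a = c * lookup f a"
proof -
  have "Const c * f = Poly_Mapping.map ((*) c) f" by (simp add: Const_def mult_map_scale_conv_mult)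
  then show ?thesis by (simp add: Poly_Mapping.map.rep_eq when_def)
qed

lemma FG_eval: "(\<Sum>k\<le>i. Const (fps_nth (FG ^ i) k) * x ^ k) = (1 + Const \<beta> * x) ^ i"
proof (induction i)
  case 0
  then show ?case by (simp add: Const_1)
next
  case (Suc i)
  have "FG ^ Suc i = FG ^ i + fps_const \<beta> * (fps_X * FG ^ i)"
    by (simp add: FG_def algebra_simps)
  then have nth: "fps_nth (FG ^ Suc i) k = fps_nth (FG ^ i) k + (if k = 0 then 0 else \<beta> * fps_nth (FG ^ i) (k - 1))" for k
    by (simp del: power_Suc)
  have "(\<Sum>k\<le>Suc i. Const (fps_nth (FG ^ Suc i) k) * x ^ k) =
      (\<Sum>k\<le>Suc i. Const (fps_nth (FG ^ i) k) * x ^ k) +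
      (\<Sum>k\<le>Suc i. Const (if k = 0 then 0 else \<beta> * fps_nth (FG ^ i) (k - 1)) * x ^ k)"
    unfolding nth Const_add by (simp add: distrib_right sum.distrib del: sum.atMost_Suc)
  also have "(\<Sum>k\<le>Suc i. Const (fps_nth (FG ^ i) k) * x ^ k) = (1 + Const \<beta> * x) ^ i"
    using Suc FG_pow_nth[of i "Suc i"] by (simp add: Const_0)
  also have "(\<Sum>k\<le>Suc i. Const (if k = 0 then 0 else \<beta> * fps_nth (FG ^ i) (k - 1)) * x ^ k) =
      Const \<beta> * x * (1 + Const \<beta> * x) ^ i"
    unfolding Suc[symmetric] sum.atMost_Suc_shift
    by (simp add: Const_0 Const_mult sum_distrib_left mult_ac)
  finally show ?case by (simp add: algebra_simps)
qed

lemma FG_eval_shift: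
  assumes U: "finite U" "{b..b + int i} \<subseteq> U" and b: "0 \<le> b + int n"
  shows "(\<Sum>u\<in>U. Const (fps_nth_int (FG ^ i) (u - b)) * x ^ nat (u + int n)) =
    x ^ nat (b + int n) * (1 + Const \<beta> * x) ^ i"
proof -
  have "(\<Sum>u\<in>U. Const (fps_nth_int (FG ^ i) (u - b)) * x ^ nat (u + int n)) =
      (\<Sum>u\<in>{b..b + int i}. Const (fps_nth_int (FG ^ i) (u - b)) * x ^ nat (u + int n))"
  proof (rule sum.mono_neutral_right[OF U])
    show "\<forall>u\<in>U - {b..b + int i}. Const (fps_nth_int (FG ^ i) (u - b)) * x ^ nat (u + int n) = 0"
    proof
      fix u assume "u \<in> U - {b..b + int i}"
      then have "u - b < 0 \<or> int i < u - b" by auto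
      then have "fps_nth_int (FG ^ i) (u - b) = 0" using fps_nth_int_FG_pow by (auto simp: fps_nth_int_def)
      then show "Const (fps_nth_int (FG ^ i) (u - b)) * x ^ nat (u + int n) = 0" by (simp add: Const_0)
    qed
  qed
  also have "\<dots> = (\<Sum>k\<le>i. Const (fps_nth (FG ^ i) k) * x ^ (nat (b + int n) + k))"
    by (rule sum.reindex_bij_witness[where i = "\<lambda>k. b + int k" and j = "\<lambda>u. nat (u - b)"])
      (use b in \<open>auto simp: fps_nth_int_def nat_add_distrib[symmetric] intro!: arg_cong[where f = "\<lambda>k. x ^ k"]\<close>)
  also have "\<dots> = x ^ nat (b + int n) * (1 + Const \<beta> * x) ^ i"
    unfolding FG_eval[symmetric] sum_distrib_left by (simp add: power_add mult_ac)
  finally show ?thesis .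
qed

definition groth :: "nat list \<Rightarrow> series" where
  "groth p = (\<lambda>a. X.E a (ketG p) {..<0})"

lemma alternant_wedge:
  assumes p: "is_partition p"
  shows "alternant n p = wedge n (\<lambda>i s. X i ^ nat (s + int n)) (beta_num p ` {..<n})"
proof -
  have "wedge n (\<lambda>i s. X i ^ nat (s + int n)) (beta_num p ` {..<n}) =
      det (mat n n (\<lambda>(i, j). X i ^ nat (beta_num p j + int n)))"
    by (rule wedge_det) (rule beta_num_less[OF p])
  moreover have "mat n n (\<lambda>(i, j). X i ^ nat (beta_num p j + int n)) =
      mat n n (\<lambda>(i, j). X i ^ (part p j + n - Suc j))"
  proof (rule cong_mat)
    fix i j assume "j < n"
    then have "nat (beta_num p j + int n) = part p j + n - Suc j" by (simp add: beta_num_def)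
    then show "(case (i, j) of (i, j) \<Rightarrow> X i ^ nat (beta_num p j + int n)) =
        (case (i, j) of (i, j) \<Rightarrow> X i ^ (part p j + n - Suc j))" by simp
  qed simp_all
  ultimately show ?thesis by (simp add: alternant_def)
qed

text \<open>The Schur expansion times the Vandermonde product is a sum of products of two minors,
  one from the coefficients of \<open>|\<lambda>\<rangle>\<^sup>G\<close> and one an alternant.
  Cauchy-Binet makes it a determinant whose entries are evaluated by
  \<open>FG_eval_shift\<close>.\<close>

lemma bialternant_groth:
  assumes p: "is_partition p"
  shows "bialternant \<beta> p (groth p)"
  unfolding bialternant_def
proof (intro allI impI)
  fix n assume n: "n \<ge> length p"
  \<comment> \<open>Longer partitions do not survive in \<open>n\<close> variables, and the length
    bound makes this set finite.\<close>
  define F where "F = {q. is_partition q \<and> length q \<le> n \<and> ketG p (dgm q) \<noteq> 0}"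
  have F: "finite F" unfolding F_def by (rule finite_ketG_parts)
  define G where "G = (\<Sum>q\<in>F. Const (ketG p (dgm q)) * spol n n q)"
  have "restricts_to n (groth p) G"
    unfolding restricts_to_def
  proof
    fix a
    have "lookup G a = (\<Sum>q\<in>F. ketG p (dgm q) * (schur_dgm (dgm q) a when keys a \<subseteq> {..<n}))"
      unfolding G_def lookup_sum lookup_Const_mult
      by (rule sum.cong) (use restricts_to_schur_dgm in \<open>auto simp: F_def restricts_to_def\<close>)
    also have "\<dots> = (groth p a when keys a \<subseteq> {..<n})"
    proof (cases "keys a \<subseteq> {..<n}")
      case True
      have "groth p a = (\<Sum>q\<in>parts (int (mdeg a)). ketG p (dgm q) * schur_dgm (dgm q) a)"
        unfolding groth_def by (rule E_vac_expand[OF ketG_fock order_refl])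
      also have "\<dots> = (\<Sum>q\<in>F. ketG p (dgm q) * schur_dgm (dgm q) a)"
      proof (rule sum.mono_neutral_cong[OF F finite_parts])
        fix q assume q: "q \<in> F - parts (int (mdeg a))"
        then show "ketG p (dgm q) * schur_dgm (dgm q) a = 0"
          using schur_dgm_homogeneous[OF maya_dgm, of q a]
          by (cases "schur_dgm (dgm q) a = 0") (auto simp: parts_def F_def)
      next
        fix q assume q: "q \<in> parts (int (mdeg a)) - F"
        then show "ketG p (dgm q) * schur_dgm (dgm q) a = 0"
          using schur_dgm_eq_0[of q n a] True by (auto simp: parts_def F_def not_le)
      qed simp
      finally show ?thesis using True by simp
    qed simp
    finally show "lookup G a = (groth p a when keys a \<subseteq> {..<n})" .
  qed
  moreover have "G * vander n = det (mat n n (\<lambda>(i, j). X i ^ (part p j + n - Suc j) * (1 + Const \<beta> * X i) ^ j))"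
  proof -
    let ?r = "\<lambda>i s. fps_nth_int (FG ^ i) (s - beta_num p i)"
    let ?c = "\<lambda>i s. Const (?r i s)" and ?x = "\<lambda>i s. X i ^ nat (s + int n)"
    let ?Y = "\<lambda>q. beta_num q ` {..<n}"
    have w: "ketG p (dgm q) = wedge n ?r (?Y q)" if "length q \<le> n" for q
      using ketG_window[OF n maya_dgm dgm_window(1)[OF that]] dgm_window(2)[OF that] by simp
    define M where "M = int n + (\<Sum>j<n. \<bar>beta_num p j\<bar>)"
    let ?U = "{- int n..M}"
    have M: "beta_num p i + int i \<le> M" if "i < n" for i
    proof -
      have "\<bar>beta_num p i\<bar> \<le> (\<Sum>j<n. \<bar>beta_num p j\<bar>)" by (rule member_le_sum) (use that in auto)
      then show ?thesis using that by (simp add: M_def)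
    qed
    have "G * vander n = (\<Sum>q\<in>F. wedge n ?c (?Y q) * wedge n ?x (?Y q))"
      unfolding G_def sum_distrib_right
    proof (rule sum.cong[OF refl])
      fix q assume "q \<in> F"
      then have q: "is_partition q" "length q \<le> n" by (auto simp: F_def)
      have "Const (ketG p (dgm q)) * spol n n q * vander n = Const (ketG p (dgm q)) * alternant n q"
        by (simp add: mult.assoc alternant_spol)
      then show "Const (ketG p (dgm q)) * spol n n q * vander n = wedge n ?c (?Y q) * wedge n ?x (?Y q)"
        by (simp only: alternant_wedge[OF q(1)] w[OF q(2)] Const_wedge)
    qed
    also have "\<dots> = (\<Sum>Y\<in>?Y ` F. wedge n ?c Y * wedge n ?x Y)"
    proof -
      have "inj_on ?Y F"
      proof (rule inj_onI)
        fix q q' assume q: "q \<in> F" "q' \<in> F" "?Y q = ?Y q'"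
        then have l: "length q \<le> n" "length q' \<le> n" and qp: "is_partition q" "is_partition q'" by (auto simp: F_def)
        have "T = {..<- int n} \<union> (T \<inter> {- int n..})" if "{..<- int n} \<subseteq> T" for T using that by auto
        then have "dgm q = dgm q'" using dgm_window[OF l(1)] dgm_window[OF l(2)] q(3) by metis
        then show "q = q'" by (rule dgm_inj[OF qp])
      qed
      then show ?thesis by (simp add: sum.reindex)
    qed
    \<comment> \<open>Cauchy-Binet needs all subsets of a window. A subset with nonzero minor has
      \<open>n\<close> elements, so filling everything below \<open>- int n\<close> gives charge 0
      and hence a partition in \<open>F\<close>.\<close>
    also have "\<dots> = (\<Sum>Y\<in>Pow ?U. wedge n ?c Y * wedge n ?x Y)"
    proof (rule sum.mono_neutral_cong)
      fix Y assume Y: "Y \<in> Pow ?U - ?Y ` F"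
      show "wedge n ?c Y * wedge n ?x Y = 0"
      proof (rule ccontr)
        assume "wedge n ?c Y * wedge n ?x Y \<noteq> 0"
        then have nz: "wedge n ?c Y \<noteq> 0" by auto
        then have nz': "wedge n ?r Y \<noteq> 0" by (auto simp flip: Const_wedge simp: Const_0)
        have cY: "finite Y" "card Y = n" using wedge_eq_0 nz by blast+
        let ?T = "{..<- int n} \<union> Y"
        have T: "?T \<inter> {- int n..} = Y" "{..<- int n} \<subseteq> ?T" using Y by auto
        have mT: "maya ?T" using maya_window[OF T(2)] T(1) cY by simp
        have "charge ?T = 0" using charge_window[OF T(2)] T(1) cY by simp
        then obtain q where q: "is_partition q" "dgm q = ?T" using dgm_surj[OF mT] by metis
        \<comment> \<open>Otherwise the first \<open>n + 1\<close> beta numbers would all lie in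
          \<open>Y\<close>, which has only \<open>n\<close> elements.\<close>
        have lq: "length q \<le> n"
        proof (rule ccontr)
          assume "\<not> length q \<le> n"
          then have "part q n \<noteq> 0" using part_nonzero[OF q(1), of n] by simp
          then have ge: "beta_num q i \<ge> - int n" if "i \<le> n" for i
            using part_antimono[OF q(1) that] that by (simp add: beta_num_def)
          have "beta_num q ` {..n} \<subseteq> Y"
          proof
            fix y assume "y \<in> beta_num q ` {..n}"
            then have "y \<in> dgm q" "y \<ge> - int n" using ge by (auto simp: dgm_def)
            then show "y \<in> Y" using q(2) by auto
          qed
          then have "card (beta_num q ` {..n}) \<le> n" using card_mono[OF cY(1)] cY(2) by metis
          moreover have "card (beta_num q ` {..n}) = Suc n"
            by (subst card_image) (auto simp: inj_on_def beta_num_eq_iff[OF q(1)])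
          ultimately show False by simp
        qed
        have "?Y q = Y" using dgm_window(2)[OF lq] q(2) T(1) by simp
        moreover have "ketG p (dgm q) \<noteq> 0" using w[OF lq] calculation nz' by simp
        then have "q \<in> F" using q(1) lq by (simp add: F_def)
        ultimately show False using Y by auto
      qed
    next
      fix Y assume Y: "Y \<in> ?Y ` F - Pow ?U"
      then obtain q where q: "Y = ?Y q" by auto
      show "wedge n ?c Y * wedge n ?x Y = 0"
      proof (rule ccontr)
        assume "wedge n ?c Y * wedge n ?x Y \<noteq> 0"
        then have nz: "wedge n ?c Y \<noteq> 0" by auto
        have "Y \<subseteq> ?U"
        proof
          fix m assume m: "m \<in> Y"
          obtain i where i: "i < n" "?c i m \<noteq> 0" using wedge_nonzero_support[OF nz m] by auto
          then have "\<not> int i < m - beta_num p i" using fps_nth_int_FG_pow Const_0 by metis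
          then have "m \<le> M" using M[OF i(1)] by simp
          moreover have "- int n \<le> m" using m q beta_num_ge by auto
          ultimately show "m \<in> ?U" by simp
        qed
        then show False using Y by auto
      qed
    qed (use F in auto)
    also have "\<dots> = det (mat n n (\<lambda>(i, j). \<Sum>u\<in>?U. ?c i u * ?x j u))"
      by (rule cauchy_binet) simp
    also have "mat n n (\<lambda>(i, j). \<Sum>u\<in>?U. ?c i u * ?x j u) =
        transpose_mat (mat n n (\<lambda>(i, j). X i ^ (part p j + n - Suc j) * (1 + Const \<beta> * X i) ^ j))"
    proof (rule eq_matI)
      fix i j assume "i < dim_row (transpose_mat (mat n n (\<lambda>(i, j). X i ^ (part p j + n - Suc j) * (1 + Const \<beta> * X i) ^ j)))"
        "j < dim_col (transpose_mat (mat n n (\<lambda>(i, j). X i ^ (part p j + n - Suc j) * (1 + Const \<beta> * X i) ^ j)))"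
      then have ij: "i < n" "j < n" by auto
      have "nat (beta_num p i + int n) = part p i + n - Suc i" using ij by (simp add: beta_num_def)
      moreover have "(\<Sum>u\<in>?U. ?c i u * ?x j u) = X j ^ nat (beta_num p i + int n) * (1 + Const \<beta> * X j) ^ i"
        by (rule FG_eval_shift) (use beta_num_ge[OF ij(1), of p] M[OF ij(1)] in auto)
      ultimately show "mat n n (\<lambda>(i, j). \<Sum>u\<in>?U. ?c i u * ?x j u) $$ (i, j) =
          transpose_mat (mat n n (\<lambda>(i, j). X i ^ (part p j + n - Suc j) * (1 + Const \<beta> * X i) ^ j)) $$ (i, j)"
        using ij by simp
    qed auto
    also have "det (transpose_mat (mat n n (\<lambda>(i, j). X i ^ (part p j + n - Suc j) * (1 + Const \<beta> * X i) ^ j))) =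
        det (mat n n (\<lambda>(i, j). X i ^ (part p j + n - Suc j) * (1 + Const \<beta> * X i) ^ j))"
      by (rule det_transpose[of _ n]) simp
    finally show ?thesis .
  qed
  ultimately show "\<exists>P. restricts_to n (groth p) P \<and> P * (\<Prod>(i, j) \<in> {(i, j). i < j \<and> j < n}. X i - X j) =
        det (mat n n (\<lambda>(i, j). X i ^ (part p j + n - Suc j) * (1 + Const \<beta> * X i) ^ j))"
    by (auto simp: vander_def)
qed

lemma grothendieck_eq:
  assumes "is_partition p"
  shows "grothendieck p = groth p"
  unfolding grothendieck_def
proof (rule the_equality)
  have "groth p \<in> Lambda_hat"
    unfolding groth_def by (rule Lambda_hat_E_vac[OF ketG_fock finite_ketG_parts])
  then show "groth p \<in> Lambda_hat \<and> bialternant \<beta> p (groth p)" using bialternant_groth[OF assms] by simp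
  show "f = groth p" if "f \<in> Lambda_hat \<and> bialternant \<beta> p f" for f
    using bialternant_unique[OF _ bialternant_groth[OF assms]] that by blast
qed

section \<open>Coefficient extraction and Buch's functions\<close>

lemma X_pow: "X i ^ k = single (single i k) 1"
proof (induction k)
  case (Suc k)
  have "X i ^ Suc k = single (single i 1 + single i k) (1 * 1)"
    unfolding power_Suc Suc.IH unfolding X_def by (rule mult_single)
  then show ?case by (simp flip: single_add)
qed simp

definition monom_of :: "nat \<Rightarrow> (nat \<Rightarrow> nat) \<Rightarrow> mono" where
  "monom_of n f = (\<Sum>i<n. single i (f i))"

lemma prod_X_pow: "(\<Prod>i = 0..<n. X i ^ f i) = single (monom_of n f) 1"
  by (induction n) (simp_all add: monom_of_def X_pow mult_single add.commute)

lemma lookup_monom_of: "lookup (monom_of n f) i = (f i when i < n)"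
proof -
  have "lookup (monom_of n f) i = (\<Sum>j<n. if j = i then f i else 0)"
    unfolding monom_of_def lookup_sum by (rule sum.cong) (auto simp: lookup_single when_def)
  then show ?thesis by (simp add: when_def)
qed

lemma monom_of_eq_iff: "monom_of n f = monom_of n g \<longleftrightarrow> (\<forall>i<n. f i = g i)"
proof
  assume eq: "monom_of n f = monom_of n g"
  show "\<forall>i<n. f i = g i"
  proof (intro allI impI)
    fix i assume "i < n"
    then show "f i = g i" using arg_cong[OF eq, of "\<lambda>a. lookup a i"] by (simp add: lookup_monom_of)
  qed
qed (auto simp: monom_of_def)

lemma keys_monom_of: "keys (monom_of n f) \<subseteq> {..<n}"
  by (auto simp: in_keys_iff lookup_monom_of when_def split: if_splits)

definition ext_mon :: "nat \<Rightarrow> nat list \<Rightarrow> mono" where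
  "ext_mon n p = monom_of n (\<lambda>j. part p j + n - Suc j)"

text \<open>The exponents of an alternant are distinct and decreasing. Matching them after a
  permutation makes the two sets of beta numbers equal, hence the partitions equal and the
  permutation trivial.\<close>

lemma lookup_alternant:
  assumes p: "is_partition p" "length p \<le> n" and q: "is_partition q" "length q \<le> n"
  shows "lookup (alternant n q) (ext_mon n p) = (if p = q then 1 else 0)"
proof -
  let ?e = "\<lambda>p j. part p j + n - Suc j"
  have e: "int (?e p j) = beta_num p j + int n" if "j < n" for p j
    using that by (simp add: beta_num_def of_nat_diff)
  have c: "mat n n (\<lambda>(i, j). X i ^ ?e q j) \<in> carrier_mat n n" by simp
  have "alternant n q = (\<Sum>\<sigma> | \<sigma> permutes {0..<n}. signof \<sigma> * (\<Prod>i = 0..<n. X i ^ ?e q (\<sigma> i)))"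
    unfolding alternant_def det_def'[OF c]
  proof (rule sum.cong[OF refl])
    fix \<sigma> assume "\<sigma> \<in> {\<sigma>. \<sigma> permutes {0..<n}}"
    then have \<sigma>: "\<sigma> i < n" if "i < n" for i using that permutes_in_image[of \<sigma> "{0..<n}" i] by simp
    show "signof \<sigma> * (\<Prod>i = 0..<n. mat n n (\<lambda>(i, j). X i ^ ?e q j) $$ (i, \<sigma> i)) =
        signof \<sigma> * (\<Prod>i = 0..<n. X i ^ ?e q (\<sigma> i))"
      by (rule arg_cong[where f = "\<lambda>x. signof \<sigma> * x"], rule prod.cong) (simp_all add: \<sigma>)
  qed
  then have "lookup (alternant n q) (ext_mon n p) =
      (\<Sum>\<sigma> | \<sigma> permutes {0..<n}. lookup (signof \<sigma> * (\<Prod>i = 0..<n. X i ^ ?e q (\<sigma> i)))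
        (ext_mon n p))"
    by (simp add: lookup_sum)
  also have "\<dots> = (\<Sum>\<sigma> | \<sigma> permutes {0..<n}. if p = q \<and> \<sigma> = id then 1 else 0)"
  proof (rule sum.cong[OF refl])
    fix \<sigma> assume "\<sigma> \<in> {\<sigma>. \<sigma> permutes {0..<n}}"
    then have perm: "\<sigma> permutes {0..<n}" by simp
    then have \<sigma>: "\<sigma> i < n" if "i < n" for i using that permutes_in_image[of \<sigma> "{0..<n}" i] by simp
    have "monom_of n (\<lambda>i. ?e q (\<sigma> i)) = ext_mon n p \<longleftrightarrow> (\<forall>i<n. beta_num q (\<sigma> i) = beta_num p i)"
    proof -
      have "?e q (\<sigma> i) = ?e p i \<longleftrightarrow> beta_num q (\<sigma> i) = beta_num p i" if "i < n" for i
        using e[OF that, of p] e[OF \<sigma>[OF that], of q] by linarith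
      then show ?thesis unfolding ext_mon_def monom_of_eq_iff by blast
    qed
    also have "\<dots> \<longleftrightarrow> p = q \<and> \<sigma> = id"
    proof
      assume eq: "\<forall>i<n. beta_num q (\<sigma> i) = beta_num p i"
      have "\<sigma> ` {..<n} = {..<n}" using permutes_image[OF perm] by (simp add: atLeast0LessThan)
      then have "beta_num q ` {..<n} = (\<lambda>i. beta_num q (\<sigma> i)) ` {..<n}" by (metis image_image)
      also have "\<dots> = beta_num p ` {..<n}" using eq by (intro image_cong) auto
      finally have im: "beta_num q ` {..<n} = beta_num p ` {..<n}" .
      have "T = {..<- int n} \<union> (T \<inter> {- int n..})" if "{..<- int n} \<subseteq> T" for T using that by auto
      then have "dgm p = dgm q" using dgm_window[OF p(2)] dgm_window[OF q(2)] im by metis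
      then have pq: "p = q" by (rule dgm_inj[OF p(1) q(1)])
      have "\<sigma> i = i" for i
      proof (cases "i < n")
        case True
        then show ?thesis using eq pq beta_num_eq_iff[OF p(1)] by blast
      next
        case False
        then show ?thesis using permutes_not_in[OF perm, of i] by simp
      qed
      then show "p = q \<and> \<sigma> = id" using pq by auto
    qed auto
    finally have iff: "monom_of n (\<lambda>i. ?e q (\<sigma> i)) = ext_mon n p \<longleftrightarrow> p = q \<and> \<sigma> = id" .
    have "lookup (signof \<sigma> * single (monom_of n (\<lambda>i. ?e q (\<sigma> i))) (1::scalar)) (ext_mon n p) =
        signof \<sigma> * (1 when p = q \<and> \<sigma> = id)"
      using iff by (simp add: sign_def lookup_single)
    then show "lookup (signof \<sigma> * (\<Prod>i = 0..<n. X i ^ ?e q (\<sigma> i))) (ext_mon n p) =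
        (if p = q \<and> \<sigma> = id then 1 else 0)"
      unfolding prod_X_pow by (auto simp: when_def)
  qed
  also have "\<dots> = (if p = q then 1 else 0)"
  proof (cases "p = q")
    case True
    have "finite {\<sigma>. \<sigma> permutes {0..<n}}" by (rule finite_permutations) simp
    then show ?thesis using True permutes_id[of "{0..<n}"] by simp
  qed simp
  finally show ?thesis .
qed

text \<open>The coefficient of \<open>s\<^sub>\<kappa>\<close> in a symmetric function is the coefficient of \<open>x\<^bsup>\<kappa>+\<delta>\<^esup>\<close> in its
  product with the Vandermonde determinant, hence a finite combination of its coefficients.\<close>

lemma extraction:
  assumes k: "is_partition k"
  obtains J :: "(mono \<times> mono) set" and c
  where "finite J" "\<And>p. p \<in> J \<Longrightarrow> int (mdeg (snd p)) = wt (dgm k)"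
    "\<And>u. u \<in> fock \<Longrightarrow> u (dgm k) = (\<Sum>p\<in>J. c p * X.E (snd p) u {..<0})"
proof -
  define d where "d = wt (dgm k)"
  \<comment> \<open>Enough variables for every partition in \<open>parts d\<close>, so that
    \<open>spol\<close> gives all their Schur coefficients.\<close>
  define n where "n = Max (length ` parts d)"
  have kd: "k \<in> parts d" using k by (simp add: parts_def d_def)
  have n: "length q \<le> n" if "q \<in> parts d" for q
    unfolding n_def using that finite_parts by (intro Max_ge) auto
  define c where "c = (\<lambda>p :: mono \<times> mono. lookup (vander n) (fst p))"
  let ?D = "dec (ext_mon n k)"
  \<comment> \<open>The degree filter isolates the homogeneous part of weight \<open>d\<close>;
    without it, components of \<open>u\<close> in other weights would enter.\<close>
  define J where "J = {p \<in> ?D. int (mdeg (snd p)) = d}"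
  have J: "finite J" using finite_dec_mono by (simp add: J_def)
  have dual: "(\<Sum>p\<in>J. c p * schur_dgm (dgm q) (snd p)) = (if k = q then 1 else 0)" if q: "q \<in> parts d" for q
  proof (cases "wt (dgm q) = d")
    case True
    have qp: "is_partition q" using q by (simp add: parts_def)
    have "(\<Sum>p\<in>J. c p * schur_dgm (dgm q) (snd p)) = (\<Sum>p\<in>?D. c p * schur_dgm (dgm q) (snd p))"
    proof (rule sum.mono_neutral_left[OF finite_dec_mono])
      show "\<forall>p\<in>?D - J. c p * schur_dgm (dgm q) (snd p) = 0"
      proof
        fix p assume "p \<in> ?D - J"
        then have "int (mdeg (snd p)) \<noteq> wt (dgm q)" using True by (simp add: J_def)
        then have "schur_dgm (dgm q) (snd p) = 0" using schur_dgm_homogeneous[OF maya_dgm] by metis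
        then show "c p * schur_dgm (dgm q) (snd p) = 0" by simp
      qed
    qed (auto simp: J_def)
    also have "\<dots> = lookup (vander n * spol n n q) (ext_mon n k)"
      unfolding lookup_mult_dec c_def
    proof (rule sum.cong[OF refl])
      fix p assume "p \<in> ?D"
      then obtain x y where p: "p = (x, y)" "x + y = ext_mon n k" by (cases p) auto
      have "keys y \<subseteq> {..<n}"
        using conjunct2[OF keys_dec[OF p(2)]] keys_monom_of[of n] unfolding ext_mon_def by (rule order.trans)
      then show "lookup (vander n) (fst p) * schur_dgm (dgm q) (snd p) =
          (case p of (x, y) \<Rightarrow> lookup (vander n) x * lookup (spol n n q) y)"
        using schur_dgm_spol[OF qp n[OF q]] by (simp add: p(1))
    qed
    also have "\<dots> = lookup (alternant n q) (ext_mon n k)"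
      by (simp only: mult.commute[of "vander n"] alternant_spol)
    also have "\<dots> = (if k = q then 1 else 0)"
      by (rule lookup_alternant[OF k n[OF kd] qp n[OF q]])
    finally show ?thesis .
  next
    case False
    have "schur_dgm (dgm q) (snd p) = 0" if "p \<in> J" for p
      using schur_dgm_homogeneous[OF maya_dgm, of q "snd p"] False that by (auto simp: J_def)
    moreover have "k \<noteq> q" using False by (auto simp: d_def)
    ultimately show ?thesis by simp
  qed
  have "u (dgm k) = (\<Sum>p\<in>J. c p * X.E (snd p) u {..<0})" if u: "u \<in> fock" for u
  proof -
    have "(\<Sum>p\<in>J. c p * X.E (snd p) u {..<0}) = (\<Sum>p\<in>J. \<Sum>q\<in>parts d. u (dgm q) * (c p * schur_dgm (dgm q) (snd p)))"
    proof (rule sum.cong[OF refl])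
      fix p assume "p \<in> J"
      then have "int (mdeg (snd p)) \<le> d" by (simp add: J_def)
      from E_vac_expand[OF u this] show "c p * X.E (snd p) u {..<0} =
          (\<Sum>q\<in>parts d. u (dgm q) * (c p * schur_dgm (dgm q) (snd p)))"
        by (simp add: sum_distrib_left mult_ac)
    qed
    also have "\<dots> = (\<Sum>q\<in>parts d. u (dgm q) * (\<Sum>p\<in>J. c p * schur_dgm (dgm q) (snd p)))"
      by (subst sum.swap) (simp add: sum_distrib_left)
    also have "\<dots> = (\<Sum>q\<in>parts d. if q = k then u (dgm k) else 0)"
      by (rule sum.cong[OF refl]) (auto simp: dual)
    also have "\<dots> = u (dgm k)" using kd finite_parts by simp
    finally show ?thesis ..
  qed
  then show thesis by (intro that[of J c] J) (auto simp: J_def d_def)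
qed

text \<open>\<open>ketG q\<close> lives in weights at least that of \<open>q\<close> and Schur
  functions are homogeneous, so \<open>groth q\<close> starts in degree
  \<open>wt (dgm q)\<close>.\<close>

lemma groth_support:
  assumes "is_partition q" "groth q a \<noteq> 0"
  shows "q \<in> parts (int (mdeg a))"
proof -
  have "(\<Sum>k\<in>parts (int (mdeg a)). ketG q (dgm k) * schur_dgm (dgm k) a) \<noteq> 0"
    using assms(2) E_vac_expand[OF ketG_fock order_refl, of a q] by (simp add: groth_def)
  then obtain k where "k \<in> parts (int (mdeg a))" "ketG q (dgm k) * schur_dgm (dgm k) a \<noteq> 0"
    by (rule sum.not_neutral_contains_not_neutral)
  then have "k \<in> parts (int (mdeg a))" "ketG q (dgm k) \<noteq> 0" by auto
  then show ?thesis using ketG_support[OF assms(1), of "dgm k"] assms(1) by (auto simp: parts_def)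
qed

lemma Sum_any_groth:
  assumes d: "int (mdeg a) \<le> d"
  shows "Sum_any (\<lambda>q. grothendieck q a * F q when is_partition q) = (\<Sum>q\<in>parts d. groth q a * F q)"
proof -
  have "Sum_any (\<lambda>q. grothendieck q a * F q when is_partition q) =
      (\<Sum>q\<in>parts d. grothendieck q a * F q when is_partition q)"
  proof (rule Sum_any.expand_superset[OF finite_parts])
    show "{q. (grothendieck q a * F q when is_partition q) \<noteq> 0} \<subseteq> parts d"
      using d groth_support by (fastforce simp: when_def parts_def grothendieck_eq split: if_splits)
  qed
  also have "\<dots> = (\<Sum>q\<in>parts d. groth q a * F q)"
    by (rule sum.cong) (auto simp: parts_def grothendieck_eq)
  finally show ?thesis .
qed

section \<open>The bracket as a coproduct component\<close>

definition skew :: "nat list \<Rightarrow> nat list \<Rightarrow> series" where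
  "skew p q = (\<lambda>a. omega (ketg q) (X.E a (ketG p)))"

text \<open>The coefficient of \<open>a\<close> reads the vector for the second alphabet only in
  weights up to \<open>d\<close>, so the truncated completeness relation can be inserted.\<close>

lemma coproduct_groth:
  assumes d: "int (mdeg a) \<le> d"
  shows "coproduct (groth p) a c = (\<Sum>q\<in>parts d. groth q a * skew p q c)"
proof -
  let ?u = "X.E c (ketG p)"
  have "coproduct (groth p) a c = X.E a ?u {..<0}"
    by (simp add: coproduct_def groth_def E_interleave[OF ketG_fock maya_lessThan])
  also have "\<dots> = (\<Sum>k\<in>parts d. ?u (dgm k) * schur_dgm (dgm k) a)"
    by (rule E_vac_expand[OF X.E_fock[OF ketG_fock] d])
  also have "\<dots> = (\<Sum>k\<in>parts d. \<Sum>q\<in>parts d. (ketG q (dgm k) * schur_dgm (dgm k) a) * skew p q c)"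
  proof (rule sum.cong[OF refl])
    fix k assume "k \<in> parts d"
    from completeness[OF this, of ?u] show "?u (dgm k) * schur_dgm (dgm k) a =
        (\<Sum>q\<in>parts d. (ketG q (dgm k) * schur_dgm (dgm k) a) * skew p q c)"
      by (simp add: skew_def sum_distrib_left sum_distrib_right mult_ac)
  qed
  also have "\<dots> = (\<Sum>q\<in>parts d. groth q a * skew p q c)"
    by (subst sum.swap) (simp add: groth_def E_vac_expand[OF ketG_fock d] sum_distrib_right)
  finally show ?thesis .
qed

text \<open>The diagram read by \<open>E\<close> is at most \<open>mdeg a\<close> deeper than that
  of \<open>q\<close>, leaving finitely many with nonzero coefficient. Its weight is at least that
  of \<open>q\<close>, so only finitely many \<open>q\<close> remain.\<close>

lemma finite_E_ketG_parts: "finite {q. is_partition q \<and> length q \<le> n \<and> X.E a (ketG p) (dgm q) \<noteq> 0}"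
proof -
  let ?T = "{T. {..<- int (n + mdeg a)} \<subseteq> T \<and> ketG p T \<noteq> 0}"
  have "finite ?T" by (rule finite_ketG_window)
  then have fin: "finite (\<Union>T\<in>?T. parts (wt T))" using finite_parts by auto
  show ?thesis
  proof (rule finite_subset[OF _ fin], rule subsetI)
    fix q assume "q \<in> {q. is_partition q \<and> length q \<le> n \<and> X.E a (ketG p) (dgm q) \<noteq> 0}"
    then have q: "is_partition q" "length q \<le> n" "X.E a (ketG p) (dgm q) \<noteq> 0" by auto
    obtain T where T: "T \<in> reach (1 * int (mdeg a)) (dgm q)" "ketG p T \<noteq> 0"
      using X.E_nonzero[OF ketG_fock maya_dgm q(3)] by blast
    have "{..<- int n} \<subseteq> dgm q" by (rule dgm_window(1)[OF q(2)])
    then have "{..<- int n - int (mdeg a)} \<subseteq> T" "wt (dgm q) \<le> wt T" using T(1) by (auto simp: reach_def)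
    then show "q \<in> (\<Union>T\<in>?T. parts (wt T))"
      using T(2) q(1) by (auto simp: parts_def algebra_simps intro!: exI[of _ T])
  qed
qed

text \<open>Each needed coordinate at \<open>dgm k\<close> is by \<open>extraction\<close> a finite
  combination of vacuum coefficients. Moving the extracting operators through
  \<open>e\<^sup>H\<close> turns the bracket into the image of one Fock vector.\<close>

lemma skew_Lambda_hat:
  assumes q: "is_partition q"
  shows "skew p q \<in> Lambda_hat"
proof -
  let ?K = "parts (wt (dgm q))"
  let ?P = "\<lambda>k (x :: (mono \<times> mono) set \<times> (mono \<times> mono \<Rightarrow> scalar)). finite (fst x) \<and>
    (\<forall>u\<in>fock. u (dgm k) = (\<Sum>p\<in>fst x. snd x p * X.E (snd p) u {..<0}))"
  have "\<forall>k\<in>?K. \<exists>x. ?P k x"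
  proof
    fix k assume "k \<in> ?K"
    then have "is_partition k" by (simp add: parts_def)
    then obtain J :: "(mono \<times> mono) set" and c
      where "finite J" "\<And>u. u \<in> fock \<Longrightarrow> u (dgm k) = (\<Sum>p\<in>J. c p * X.E (snd p) u {..<0})"
      by (rule extraction) blast
    then show "\<exists>x. ?P k x" by (intro exI[of _ "(J, c)"]) simp
  qed
  from bchoice[OF this] obtain f where f: "\<And>k. k \<in> ?K \<Longrightarrow> ?P k (f k)" by (elim exE) blast
  define J c where "J = fst \<circ> f" and "c = snd \<circ> f"
  have J: "\<And>k. k \<in> ?K \<Longrightarrow> finite (J k)"
    and c: "\<And>k u. k \<in> ?K \<Longrightarrow> u \<in> fock \<Longrightarrow> u (dgm k) = (\<Sum>p\<in>J k. c k p * X.E (snd p) u {..<0})"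
    using f unfolding J_def c_def o_apply by blast+
  define I where "I = Sigma ?K J"
  \<comment> \<open>This is the image of \<open>ketG p\<close> under the operator that plays the
    role of \<open>g\<^sub>\<mu>\<^sup>\<perp>\<close>.\<close>
  define w where "w = (\<lambda>T. \<Sum>i\<in>I. (ketg q (dgm (fst i)) * c (fst i) (snd i)) * X.E (snd (snd i)) (ketG p) T)"
  have I: "finite I" using J finite_parts by (auto simp: I_def)
  have w: "w \<in> fock" unfolding w_def by (rule X.sum_fock) (rule X.E_fock[OF ketG_fock])
  have "skew p q a = X.E a w {..<0}" for a
  proof -
    have "skew p q a = (\<Sum>k\<in>?K. ketg q (dgm k) * X.E a (ketG p) (dgm k))"
      unfolding skew_def by (rule omega_ketg) (use q in \<open>simp add: parts_def\<close>)
    also have "\<dots> = (\<Sum>k\<in>?K. \<Sum>p'\<in>J k. (ketg q (dgm k) * c k p') * X.E a (X.E (snd p') (ketG p)) {..<0})"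
    proof (rule sum.cong[OF refl])
      fix k assume k: "k \<in> ?K"
      show "ketg q (dgm k) * X.E a (ketG p) (dgm k) =
          (\<Sum>p'\<in>J k. (ketg q (dgm k) * c k p') * X.E a (X.E (snd p') (ketG p)) {..<0})"
        by (simp add: c[OF k X.E_fock[OF ketG_fock]] sum_distrib_left mult.assoc
            E_commute[OF ketG_fock maya_lessThan, of a])
    qed
    also have "\<dots> = (\<Sum>i\<in>I. (ketg q (dgm (fst i)) * c (fst i) (snd i)) * X.E a (X.E (snd (snd i)) (ketG p)) {..<0})"
      unfolding I_def using J finite_parts by (subst sum.Sigma) (auto simp: split_def)
    also have "\<dots> = X.E a w {..<0}"
      unfolding w_def by (rule X.E_sum[symmetric]) (auto intro: X.E_fock ketG_fock maya_lessThan)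
    finally show ?thesis .
  qed
  then have eq: "skew p q = (\<lambda>a. X.E a w {..<0})" ..
  have "finite {r. is_partition r \<and> length r \<le> n \<and> w (dgm r) \<noteq> 0}" for n
  proof (rule finite_subset)
    show "{r. is_partition r \<and> length r \<le> n \<and> w (dgm r) \<noteq> 0} \<subseteq>
        (\<Union>i\<in>I. {r. is_partition r \<and> length r \<le> n \<and> X.E (snd (snd i)) (ketG p) (dgm r) \<noteq> 0})"
    proof
      fix r assume r: "r \<in> {r. is_partition r \<and> length r \<le> n \<and> w (dgm r) \<noteq> 0}"
      then have "w (dgm r) \<noteq> 0" by simp
      then obtain i where "i \<in> I" "(ketg q (dgm (fst i)) * c (fst i) (snd i)) * X.E (snd (snd i)) (ketG p) (dgm r) \<noteq> 0"
        unfolding w_def by (rule sum.not_neutral_contains_not_neutral)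
      then show "r \<in> (\<Union>i\<in>I. {r. is_partition r \<and> length r \<le> n \<and> X.E (snd (snd i)) (ketG p) (dgm r) \<noteq> 0})"
        using r by auto
    qed
  qed (use I finite_E_ketG_parts in auto)
  then show ?thesis unfolding eq by (rule Lambda_hat_E_vac[OF w])
qed

text \<open>A relation in all degrees up to \<open>d\<close> makes the combination \<open>u\<close>
  of the \<open>ketG r\<close> vanish at diagrams of weight at most \<open>d\<close>, by
  \<open>extraction\<close>. Pairing with \<open>ketg q\<close> reads only these diagrams and
  returns \<open>D q\<close>.\<close>

lemma groth_independent:
  assumes zero: "\<And>a d. int (mdeg a) \<le> d \<Longrightarrow> (\<Sum>q\<in>parts d. groth q a * D q) = 0" and q: "is_partition q"
  shows "D q = 0"
proof -
  define d where "d = wt (dgm q)"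
  have qd: "q \<in> parts d" using q by (simp add: parts_def d_def)
  define u where "u = (\<lambda>T. \<Sum>r\<in>parts d. D r * ketG r T)"
  have u: "u \<in> fock" unfolding u_def by (rule X.sum_fock) (rule ketG_fock)
  have Eu: "X.E a u {..<0} = 0" if "int (mdeg a) \<le> d" for a
  proof -
    have "X.E a u {..<0} = (\<Sum>r\<in>parts d. D r * X.E a (ketG r) {..<0})"
      unfolding u_def by (rule X.E_sum[OF ketG_fock maya_lessThan])
    then show ?thesis using zero[OF that] by (simp add: groth_def mult.commute)
  qed
  have "u (dgm k) = 0" if "k \<in> parts d" for k
  proof -
    have k: "is_partition k" "wt (dgm k) \<le> d" using that by (auto simp: parts_def)
    obtain J :: "(mono \<times> mono) set" and c where J: "\<And>p. p \<in> J \<Longrightarrow> int (mdeg (snd p)) = wt (dgm k)"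
      "\<And>u. u \<in> fock \<Longrightarrow> u (dgm k) = (\<Sum>p\<in>J. c p * X.E (snd p) u {..<0})"
      by (rule extraction[OF k(1)]) blast
    show ?thesis unfolding J(2)[OF u] by (rule sum.neutral) (use J(1) Eu k(2) in auto)
  qed
  then have "omega (ketg q) u = 0" by (simp add: omega_ketg[OF qd])
  moreover have "omega (ketg q) u = (\<Sum>r\<in>parts d. D r * omega (ketg q) (ketG r))"
    unfolding omega_ketg[OF qd] u_def sum_distrib_left
    by (subst sum.swap) (simp add: mult_ac)
  moreover have "\<dots> = (\<Sum>r\<in>parts d. if r = q then D q else 0)"
    by (rule sum.cong[OF refl]) (use q in \<open>auto simp: omega_ketg_ketG parts_def\<close>)
  ultimately show ?thesis using qd finite_parts by simp
qed

lemma buch_eq: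
  assumes p: "is_partition p"
  shows "buch p = (\<lambda>q. if is_partition q then skew p q else (\<lambda>_. 0))"
  unfolding buch_def
proof (rule the_equality, intro conjI allI impI)
  let ?F = "\<lambda>q. if is_partition q then skew p q else (\<lambda>_. 0)"
  show "?F q \<in> Lambda_hat" if "is_partition q" for q using that skew_Lambda_hat by simp
  show "?F q = (\<lambda>_. 0)" if "\<not> is_partition q" for q using that by simp
  show "coproduct (grothendieck p) a c = Sum_any (\<lambda>q. grothendieck q a * ?F q c when is_partition q)" for a c
    unfolding Sum_any_groth[OF order_refl] grothendieck_eq[OF p] coproduct_groth[OF order_refl]
    by (rule sum.cong) (auto simp: parts_def)
next
  fix F
  assume F: "(\<forall>q. is_partition q \<longrightarrow> F q \<in> Lambda_hat) \<and> (\<forall>q. \<not> is_partition q \<longrightarrow> F q = (\<lambda>_. 0)) \<and>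
     (\<forall>a c. coproduct (grothendieck p) a c = Sum_any (\<lambda>q. grothendieck q a * F q c when is_partition q))"
  show "F = (\<lambda>q. if is_partition q then skew p q else (\<lambda>_. 0))"
  proof
    fix q
    show "F q = (if is_partition q then skew p q else (\<lambda>_. 0))"
    proof (cases "is_partition q")
      case True
      have "F q c = skew p q c" for c
      proof -
        \<comment> \<open>For a fixed monomial \<open>c\<close> of the second alphabet, the
          difference of two candidate families is a linear relation between the
          \<open>groth r\<close>.\<close>
        have "(\<Sum>r\<in>parts d. groth r a * (F r c - skew p r c)) = 0" if d: "int (mdeg a) \<le> d" for a d
        proof -
          have "(\<Sum>r\<in>parts d. groth r a * F r c) = coproduct (groth p) a c"
            using F Sum_any_groth[OF d, of "\<lambda>q. F q c"] by (simp add: grothendieck_eq[OF p])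
          also have "\<dots> = (\<Sum>r\<in>parts d. groth r a * skew p r c)" by (rule coproduct_groth[OF d])
          finally show ?thesis by (simp add: right_diff_distrib sum_subtractf)
        qed
        from groth_independent[OF this True] show ?thesis by simp
      qed
      then show ?thesis using True by auto
    qed (use F in simp)
  qed
qed

theorem theorem4p1:
  fixes lam mu :: "nat list" and r s :: nat
  assumes "is_partition lam" and "is_partition mu" and "length lam \<le> r" and "length mu \<le> s"
  shows "buch lam mu = (\<lambda>\<alpha>. omega (ket_g s mu) (exp_Hx (ket_G r lam) \<alpha>))"
  using assms by (simp add: buch_eq skew_def ket_g_eq ket_G_eq exp_Hx_eq ketG_fock)

end
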